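(* Let $\{(G_t,Y_t)\}_{t\ge 0}$ be a DED process with period $K$, parameter set $\Theta\subseteq\mathbb R^d$, event probabilities $p_t(\theta)=1-\exp(-\lambda_t(\theta))$ with $\lambda_t=\lambda_{t\bmod K}$, and limiting gating frequencies $\gamma(\theta)$. Let $\theta_0\in\operatorname{int}(\Theta)$, and assume: (1) there are constants $0<\lambda_{\min}\le\lambda_{\max}<\infty$ with $\lambda_{\min}\le\lambda_r(\theta)\le\lambda_{\max}$ for all $r=0,\dots,K-1$ and $\theta\in\Theta$; (2) for each $r=0,\dots,K-1$, $\lambda_r:\Theta\to\mathbb R$ extends to a $C^3$ map on an open set containing $\Theta$; (3) if $\theta\in\Theta$ satisfies $\lambda_r(\theta)=\lambda_r(\theta_0)$ for all $r$ with $\gamma_r(\theta_0)>0$, then $\theta=\theta_0$; (4) $\Theta$ is compact; (5) the matrix $\mathcal I_0=\mathcal I(\theta_0;\gamma(\theta_0))$ is positive definite. Let $\hat\theta_T$ be any maximum likelihood estimator, i.e. any sequence of estimators with $\hat\theta_T\in\arg\max_{\theta\in\Theta}\ell_T(\theta)$ for each $T$, where $\ell_T(\theta)=\log P_{\theta,T}(X_0,\dots,X_{T-1})$ is the log-likelihood. Then, as $T\to\infty$: 1. $\hat\theta_T$ is consistent: $\hat\theta_T\to\theta_0$ in $P_{\theta_0,T}$-probability. 2. $\hat\theta_T$ is asymptotically efficient, i.e. $\sqrt T(\hat\theta_T-\theta_0)\Rightarrow\mathcal N(0,\mathcal I_0^{-1})$ under $P_{\theta_0,T}$. 3. $\hat\theta_T$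 is regular: for every fixed $h\in\mathbb R^d$, $$\sqrt T\Bigl(\hat\theta_T-\theta_0-\frac h{\sqrt T}\Bigr)\Rightarrow\mathcal N(0,\mathcal I_0^{-1})\quad\text{under }P_{\theta_0+h/\sqrt T,\,T}.$$
   Context: $\mathbb N=\{0,1,2,\dots\}$. Fix an integer $K\ge 1$ (period), an integer $D\in\mathbb N$ (dead time), and a parameter set $\Theta\subseteq\mathbb R^d$. For each $\theta\in\Theta$ let $p_t(\theta)\in[0,1]$, $t\in\mathbb N$, with $p_{t+K}(\theta)=p_t(\theta)$, written $p_t(\theta)=1-\exp(-\lambda_t(\theta))$. A DED (dead-time event detection) process is a stochastic process $\{(G_t,Y_t)\}_{t\ge0}$ with $G_t,Y_t\in\{0,1\}$, whose law under parameter $\theta$ is denoted $P_\theta$, such that: (i) (observation) under $P_\theta$ there are independent $Z_t\sim\mathrm{Ber}(p_t(\theta))$, $t\in\mathbb N$, with $Y_t=G_tZ_t$; (ii) (dead time) almost surely, $Y_t=1$ implies $G_s=0$ for all $s\in\{t+1,\dots,t+D\}$; (iii) (causality) for every $t$ there are $U_t\sim\mathrm{Unif}([0,1])$, jointly independent of the event sequence $\{Z_s\}_{s\ge0}$ and the past observations $\{(G_s,Y_s)\}_{s=0}^{t-1}$, and a measurable map $\Phi_t:\{0,1\}^{2t}\times[0,1]\to\{0,1\}$, not depending on $\theta$, such that $G_t=\Phi_t(G_0,Y_0,\dots,G_{t-1},Y_{t-1},U_t)$ a.s.; (iv) (gating-frequency convergence) for every $\theta\in\Theta$ there is $\gamma(\theta)\in[0,1]^K$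 such that for each $r=0,\dots,K-1$, $\frac1L\sum_{\ell=0}^{L-1}G_{r+\ell K}\to\gamma_r(\theta)$ in $P_\theta$-probability as $L\to\infty$. $X_t=(G_t,Y_t)$, and $P_{\theta,T}$ denotes the law of $X_{0:T-1}=(X_0,\dots,X_{T-1})$ under $\theta$. Up to an additive term not depending on $\theta$, the log-likelihood is $$\ell_T(\theta)=\sum_{r=0}^{K-1}\bigl[S_r(T)\log p_r(\theta)+(N_r(T)-S_r(T))\log(1-p_r(\theta))\bigr],$$ with $N_r(T)=\sum_{0\le t<T,\ t\bmod K=r}G_t$ and $S_r(T)=\sum_{0\le t<T,\ t\bmod K=r}Y_t$. Fisher information: for $r=0,\dots,K-1$, $\mathcal I_r(\theta)=\frac{1-p_r(\theta)}{p_r(\theta)}\nabla\lambda_r(\theta)\nabla\lambda_r(\theta)^\top$; for $\alpha\in[0,1]^K$, $\mathcal I(\theta;\alpha)=\frac1K\sum_{r=0}^{K-1}\alpha_r\mathcal I_r(\theta)$. *)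

theory Defs
  imports "HOL-Probability.Probability"
begin

section \<open>Analysis\<close>

text \<open>
  \<open>C_k_on k f S\<close> is meant for open \<open>S\<close>; there it says that all partial derivatives of \<open>f\<close>
  up to order \<open>k\<close> exist and are continuous.
\<close>

fun C_k_on :: "nat \<Rightarrow> ('a::real_normed_vector \<Rightarrow> real) \<Rightarrow> 'a set \<Rightarrow> bool" where
  "C_k_on 0 f S \<longleftrightarrow> continuous_on S f"
| "C_k_on (Suc k) f S \<longleftrightarrow>
     (\<forall>x\<in>S. f differentiable (at x)) \<and> (\<forall>v. C_k_on k (\<lambda>x. frechet_derivative f (at x) v) S)"

definition gradient :: "('a::real_inner \<Rightarrow> real) \<Rightarrow> 'a \<Rightarrow> 'a" where
  "gradient f x = (THE D. GDERIV f x :> D)"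

definition outer_product :: "real^'n \<Rightarrow> real^'m \<Rightarrow> real^'m^'n" where
  "outer_product v w = (\<chi> i j. v $ i * w $ j)"

definition pos_definite :: "real^'n^'n \<Rightarrow> bool" where
  "pos_definite A \<longleftrightarrow> transpose A = A \<and> (\<forall>x. x \<noteq> 0 \<longrightarrow> 0 < x \<bullet> (A *v x))"

section \<open>Probability\<close>

text \<open>The measure, and even the underlying measurable space, may vary along the sequence.\<close>

definition tendsto_in_prob ::
    "(nat \<Rightarrow> 'a measure) \<Rightarrow> (nat \<Rightarrow> 'a \<Rightarrow> 'b::metric_space) \<Rightarrow> 'b \<Rightarrow> bool" where
  "tendsto_in_prob M X c \<longleftrightarrow>
     (\<forall>\<epsilon>>0. (\<lambda>n. measure (M n) {\<omega> \<in> space (M n). dist (X n \<omega>) c > \<epsilon>}) \<longlonglongrightarrow> 0)"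

text \<open>
  Literally the library's \<open>indep_var\<close>, which however requires both variables to have the same
  value type.
\<close>

definition indep_rv ::
    "'w measure \<Rightarrow> 'a measure \<Rightarrow> ('w \<Rightarrow> 'a) \<Rightarrow> 'b measure \<Rightarrow> ('w \<Rightarrow> 'b) \<Rightarrow> bool" where
  "indep_rv M N1 X1 N2 X2 \<longleftrightarrow>
     X1 \<in> measurable M N1 \<and> X2 \<in> measurable M N2 \<and>
     prob_space.indep_set M {X1 -` A \<inter> space M | A. A \<in> sets N1} {X2 -` A \<inter> space M | A. A \<in> sets N2}"

text \<open>
  Weak convergence of Borel measures by bounded continuous test functions; the distribution's
  \<open>weak_conv_m\<close> is limited to measures on the real line.
\<close>

definition weak_conv_borel :: "(nat \<Rightarrow> 'a::topological_space measure) \<Rightarrow> 'a measure \<Rightarrow> bool" where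
  "weak_conv_borel \<mu> \<nu> \<longleftrightarrow>
     (\<forall>f :: 'a \<Rightarrow> real. continuous_on UNIV f \<and> bounded (range f) \<longrightarrow>
        (\<lambda>n. integral\<^sup>L (\<mu> n) f) \<longlonglongrightarrow> integral\<^sup>L \<nu> f)"

text \<open>The normal law on \<open>real^'d\<close>, for positive definite covariance \<open>\<Sigma>\<close> only.\<close>

definition mv_normal :: "real^'d \<Rightarrow> real^'d^'d \<Rightarrow> (real^'d) measure" where
  "mv_normal m \<Sigma> = density lborel (\<lambda>x. ennreal
     (exp (- (1 / 2) * ((x - m) \<bullet> (matrix_inv \<Sigma> *v (x - m)))) / sqrt ((2 * pi) ^ CARD('d) * det \<Sigma>)))"

section \<open>DED processes\<close>

text \<open>
  The values 0 and 1 are represented by \<open>False\<close> and \<open>True\<close>, so that \<open>G t \<cdot> Z t\<close> becomes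
  a conjunction, and \<open>(X 0, \<dots>, X (T - 1))\<close> with \<open>X t = (G t, Y t)\<close> is a list of length \<open>T\<close>.
\<close>

definition obs ::
    "(nat \<Rightarrow> 'w \<Rightarrow> bool) \<Rightarrow> (nat \<Rightarrow> 'w \<Rightarrow> bool) \<Rightarrow> nat \<Rightarrow> 'w \<Rightarrow> (bool \<times> bool) list" where
  "obs G Y T \<omega> = map (\<lambda>t. (G t \<omega>, Y t \<omega>)) [0..<T]"

definition ded_observation ::
    "'w measure \<Rightarrow> (nat \<Rightarrow> real) \<Rightarrow> (nat \<Rightarrow> 'w \<Rightarrow> bool) \<Rightarrow> (nat \<Rightarrow> 'w \<Rightarrow> bool) \<Rightarrow> (nat \<Rightarrow> 'w \<Rightarrow> bool) \<Rightarrow> bool"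
  where
  "ded_observation M q G Y Z \<longleftrightarrow>
     prob_space.indep_vars M (\<lambda>_. count_space UNIV) Z UNIV \<and>
     (\<forall>t. distr M (count_space UNIV) (Z t) = measure_pmf (bernoulli_pmf (q t))) \<and>
     (\<forall>t. AE \<omega> in M. Y t \<omega> \<longleftrightarrow> G t \<omega> \<and> Z t \<omega>)"

definition ded_dead_time ::
    "'w measure \<Rightarrow> nat \<Rightarrow> (nat \<Rightarrow> 'w \<Rightarrow> bool) \<Rightarrow> (nat \<Rightarrow> 'w \<Rightarrow> bool) \<Rightarrow> bool" where
  "ded_dead_time M D G Y \<longleftrightarrow>
     (\<forall>t. AE \<omega> in M. Y t \<omega> \<longrightarrow> (\<forall>s\<in>{t + 1..t + D}. \<not> G s \<omega>))"

text \<open>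
  The sequence \<open>Z\<close> and the past observations are in general dependent on each other, so
  ``jointly independent of'' is independence of \<open>U t\<close> from the pair they form.
\<close>

definition ded_causal ::
    "'w measure \<Rightarrow> (nat \<Rightarrow> (bool \<times> bool) list \<Rightarrow> real \<Rightarrow> bool) \<Rightarrow> (nat \<Rightarrow> 'w \<Rightarrow> bool) \<Rightarrow>
     (nat \<Rightarrow> 'w \<Rightarrow> bool) \<Rightarrow> (nat \<Rightarrow> 'w \<Rightarrow> bool) \<Rightarrow> (nat \<Rightarrow> 'w \<Rightarrow> real) \<Rightarrow> bool" where
  "ded_causal M \<Phi> G Y Z U \<longleftrightarrow>
     (\<forall>t. distr M borel (U t) = uniform_measure lborel {0..1} \<and>
          indep_rv M borel (U t)
            (PiM UNIV (\<lambda>_. count_space UNIV) \<Otimes>\<^sub>M count_space UNIV) (\<lambda>\<omega>. (\<lambda>s. Z s \<omega>, obs G Y t \<omega>)) \<and>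
          (AE \<omega> in M. G t \<omega> = \<Phi> t (obs G Y t \<omega>) (U t \<omega>)))"

definition gating_freq :: "nat \<Rightarrow> (nat \<Rightarrow> 'w \<Rightarrow> bool) \<Rightarrow> nat \<Rightarrow> nat \<Rightarrow> 'w \<Rightarrow> real" where
  "gating_freq K G r L \<omega> = (1 / real L) * (\<Sum>l<L. of_bool (G (r + l * K) \<omega>))"

text \<open>
  \<open>P \<theta>\<close> is the probability measure under parameter \<open>\<theta>\<close>, and is unconstrained for \<open>\<theta>\<close> outside
  \<open>\<Theta>\<close>. The auxiliary variables \<open>Z\<close> and \<open>U\<close> may depend on \<open>\<theta>\<close>, the maps \<open>\<Phi>\<close> may not.
\<close>

definition ded_process ::
    "nat \<Rightarrow> nat \<Rightarrow> (real^'d) set \<Rightarrow> (nat \<Rightarrow> real^'d \<Rightarrow> real) \<Rightarrow> (real^'d \<Rightarrow> nat \<Rightarrow> real) \<Rightarrow>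
     (real^'d \<Rightarrow> 'w measure) \<Rightarrow> (nat \<Rightarrow> 'w \<Rightarrow> bool) \<Rightarrow> (nat \<Rightarrow> 'w \<Rightarrow> bool) \<Rightarrow> bool" where
  "ded_process K D \<Theta> p \<gamma> P G Y \<longleftrightarrow>
     (\<forall>\<theta>\<in>\<Theta>. \<forall>t. p t \<theta> \<in> {0..1} \<and> p (t + K) \<theta> = p t \<theta>) \<and>
     (\<forall>\<theta>\<in>\<Theta>. prob_space (P \<theta>) \<and>
        (\<forall>t. G t \<in> measurable (P \<theta>) (count_space UNIV) \<and> Y t \<in> measurable (P \<theta>) (count_space UNIV))) \<and>
     (\<exists>\<Phi>. (\<forall>t. case_prod (\<Phi> t) \<in> measurable
              (count_space {x. length x = t} \<Otimes>\<^sub>M restrict_space borel {0..1}) (count_space UNIV)) \<and>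
          (\<forall>\<theta>\<in>\<Theta>. \<exists>Z U. ded_observation (P \<theta>) (\<lambda>t. p t \<theta>) G Y Z \<and> ded_causal (P \<theta>) \<Phi> G Y Z U)) \<and>
     (\<forall>\<theta>\<in>\<Theta>. ded_dead_time (P \<theta>) D G Y) \<and>
     (\<forall>\<theta>\<in>\<Theta>. \<forall>r<K. \<gamma> \<theta> r \<in> {0..1} \<and>
        tendsto_in_prob (\<lambda>_. P \<theta>) (gating_freq K G r) (\<gamma> \<theta> r))"

definition obs_law ::
    "('p \<Rightarrow> 'w measure) \<Rightarrow> (nat \<Rightarrow> 'w \<Rightarrow> bool) \<Rightarrow> (nat \<Rightarrow> 'w \<Rightarrow> bool) \<Rightarrow> 'p \<Rightarrow> nat \<Rightarrow>
     (bool \<times> bool) list measure" where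
  "obs_law P G Y \<theta> T = distr (P \<theta>) (count_space UNIV) (obs G Y T)"

text \<open>Extended-real valued, because \<open>ln 0 = 0\<close> in HOL whereas the log-likelihood must be \<open>-\<infinity>\<close>.\<close>

definition log_lik ::
    "('p \<Rightarrow> 'w measure) \<Rightarrow> (nat \<Rightarrow> 'w \<Rightarrow> bool) \<Rightarrow> (nat \<Rightarrow> 'w \<Rightarrow> bool) \<Rightarrow> nat \<Rightarrow>
     (bool \<times> bool) list \<Rightarrow> 'p \<Rightarrow> ereal" where
  "log_lik P G Y T x \<theta> =
     (let q = measure (obs_law P G Y \<theta> T) {x} in if q = 0 then -\<infinity> else ereal (ln q))"

text \<open>
  An estimator is a function of the observed data; no measurability is imposed since for each
  \<open>T\<close> there are only finitely many data sets.
\<close>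

definition is_mle ::
    "'p set \<Rightarrow> ('p \<Rightarrow> 'w measure) \<Rightarrow> (nat \<Rightarrow> 'w \<Rightarrow> bool) \<Rightarrow> (nat \<Rightarrow> 'w \<Rightarrow> bool) \<Rightarrow>
     (nat \<Rightarrow> (bool \<times> bool) list \<Rightarrow> 'p) \<Rightarrow> bool" where
  "is_mle \<Theta> P G Y est \<longleftrightarrow>
     (\<forall>T x. length x = T \<longrightarrow> is_arg_max (log_lik P G Y T x) (\<lambda>\<theta>. \<theta> \<in> \<Theta>) (est T x))"

section \<open>Fisher information\<close>

text \<open>
  \<open>gradient\<close> is the two-sided derivative, so these definitions are meaningful for \<open>\<theta>\<close> in the
  interior of the parameter set.
\<close>

definition fisher_phase ::
    "(nat \<Rightarrow> real^'d \<Rightarrow> real) \<Rightarrow> (nat \<Rightarrow> real^'d \<Rightarrow> real) \<Rightarrow> nat \<Rightarrow> real^'d \<Rightarrow> real^'d^'d" where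
  "fisher_phase p lam r \<theta> =
     ((1 - p r \<theta>) / p r \<theta>) *\<^sub>R outer_product (gradient (lam r) \<theta>) (gradient (lam r) \<theta>)"

definition fisher_info ::
    "nat \<Rightarrow> (nat \<Rightarrow> real^'d \<Rightarrow> real) \<Rightarrow> (nat \<Rightarrow> real^'d \<Rightarrow> real) \<Rightarrow> real^'d \<Rightarrow> (nat \<Rightarrow> real) \<Rightarrow> real^'d^'d"
  where
  "fisher_info K p lam \<theta> \<alpha> = (1 / real K) *\<^sub>R (\<Sum>r<K. \<alpha> r *\<^sub>R fisher_phase p lam r \<theta>)"

end

theory Submission
  imports Defs
begin

text \<open>
  The gating maps do not depend on the parameter, so the likelihood of an observed path is a
  parameter-free factor times \<open>\<Prod>\<^sub>r p\<^sub>r\<^bsup>S\<^sub>r\<^esup> (1 - p\<^sub>r)\<^bsup>N\<^sub>r - S\<^sub>r\<^esup>\<close>. Given the gate, an event is a fresh Bernoulli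
  variable: hence \<open>S\<^sub>r - p\<^sub>r N\<^sub>r\<close> is a martingale with second moment at most \<open>T\<close>, and \<open>exp (i u \<cdot> score)\<close>
  divided by its conditional characteristic functions has expectation exactly one. As
  \<open>N\<^sub>r / T \<rightarrow> \<gamma>\<^sub>r / K\<close>, this gives the central limit theorem for the score, and Gibbs' inequality
  gives consistency. The second moment of the likelihood ratio between \<open>\<theta>\<^sub>0\<close> and \<open>\<theta>\<^sub>0 + h / \<surd>T\<close> is
  bounded, so everything that is negligible under \<open>\<theta>\<^sub>0\<close> is negligible under the local parameters.
  The score equation is therefore linearised directly around \<open>\<theta>\<^sub>0 + h / \<surd>T\<close>, for all \<open>h\<close> at once;
  efficiency is the case \<open>h = 0\<close> of regularity.
\<close>

section \<open>Weak convergence from characteristic functions\<close>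

text \<open>The gates may depend on the whole past, and neither mixing nor stationarity is assumed:
  the random conditional variances of the score are controlled by the convergence of the gating
  frequencies alone. That convergence is assumed for each fixed parameter and says nothing about the
  moving parameter \<open>\<theta>\<^sub>0 + h / sqrt T\<close>. This gap is the reason for the
  second moment of the likelihood ratio. It stays bounded because each of the T steps contributes a
  factor 1 + O(1/T), the gate probabilities cancelling from the ratio. Consistency provides no rate,
  so the remainder of the linearisation is at first bounded only by a small multiple of 1 + |Y|,
  where Y is the rescaled error. Invertibility of the information lets the term in |Y| be absorbed,
  which yields tightness of Y and smallness of the remainder together. Tightness serves again in the
  passage from characteristic functions to bounded continuous test functions, which are approximated
  on balls by trigonometric sums.\<close>

inductive trig_function :: "('a::euclidean_space \<Rightarrow> real) \<Rightarrow> bool" where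
  "trig_function (\<lambda>x. Re (c * iexp (u \<bullet> x)))"
| "trig_function f \<Longrightarrow> trig_function g \<Longrightarrow> trig_function (\<lambda>x. f x + g x)"

lemma trig_function_const: "trig_function (\<lambda>_::'a::euclidean_space. c)"
  using trig_function.intros(1)[of "of_real c" "0::'a"] by simp

lemma trig_function_sin: "trig_function (\<lambda>x. sin (u \<bullet> x))"
  using trig_function.intros(1)[of "-\<i>" u] by (simp add: Im_exp)

text \<open>Re z * Re w is half of Re (z * w) + Re (z * cnj w), so multiplying frequencies
  \<open>u\<close> and \<open>v\<close> yields \<open>u + v\<close> and \<open>u - v\<close>. The
  complex coefficient carries cosine and sine together, so one product rule suffices.\<close>

lemma trig_function_mult:
  fixes f g :: "'a::euclidean_space \<Rightarrow> real"
  assumes "trig_function f" "trig_function g"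
  shows "trig_function (\<lambda>x. f x * g x)"
  using assms
proof (induction arbitrary: g)
  case (1 c u)
  from 1 show ?case
  proof induction
    case (1 d v)
    have prod: "Re (c * z) * Re (d * w) = Re (c * d / 2 * (z * w)) + Re (c * cnj d / 2 * (z * cnj w))" for z w
      by (simp add: field_simps)
    have "iexp ((u + v) \<bullet> x) = iexp (u \<bullet> x) * iexp (v \<bullet> x)"
      "iexp ((u - v) \<bullet> x) = iexp (u \<bullet> x) * cnj (iexp (v \<bullet> x))" for x
      by (simp_all add: inner_add_left inner_diff_left distrib_left right_diff_distrib exp_add exp_diff exp_cnj exp_minus divide_inverse)
    then have "(\<lambda>x. Re (c * iexp (u \<bullet> x)) * Re (d * iexp (v \<bullet> x)))
      = (\<lambda>x. Re (c * d / 2 * iexp ((u + v) \<bullet> x)) + Re (c * cnj d / 2 * iexp ((u - v) \<bullet> x)))"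
      by (simp only: prod)
    then show ?case by (simp only:) (intro trig_function.intros)
  next
    case (2 f g)
    then show ?case by (simp add: distrib_left trig_function.intros(2))
  qed
next
  case (2 f1 f2)
  then show ?case by (simp add: distrib_right trig_function.intros(2))
qed

text \<open>The trigonometric functions form an algebra containing the constants, so a polynomial
  may be evaluated at a map with trigonometric coordinates; below, this map is the coordinatewise
  sine.\<close>

lemma trig_function_polynomial:
  fixes p :: "'a::euclidean_space \<Rightarrow> real" and s :: "'b::euclidean_space \<Rightarrow> 'a"
  assumes "real_polynomial_function p" "\<And>b. b \<in> Basis \<Longrightarrow> trig_function (\<lambda>x. s x \<bullet> b)"
  shows "trig_function (\<lambda>x. p (s x))"
  using assms(1)
proof induction
  case (linear f)
  interpret bounded_linear f by fact
  have "trig_function (\<lambda>x. \<Sum>b\<in>B. f b * (s x \<bullet> b))" if "finite B" "B \<subseteq> Basis" for B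
    using that by (induction B rule: finite_induct)
      (auto intro!: trig_function_const trig_function.intros(2) trig_function_mult assms(2))
  from this[of Basis] have "trig_function (\<lambda>x. \<Sum>b\<in>Basis. f b * (s x \<bullet> b))" by simp
  moreover have "f (s x) = (\<Sum>b\<in>Basis. f b * (s x \<bullet> b))" for x
    by (subst euclidean_representation[of "s x", symmetric]) (simp add: sum scale mult.commute del: euclidean_representation)
  ultimately show ?case by simp
qed (auto intro: trig_function_const trig_function.intros(2) trig_function_mult)

lemma trig_function_bounded_continuous:
  assumes "trig_function f"
  shows "continuous_on UNIV f \<and> bounded (range f)"
  using assms
proof induction
  case (1 c u)
  have "\<bar>Re (c * iexp (u \<bullet> x))\<bar> \<le> cmod c" for x
    using abs_Re_le_cmod[of "c * iexp (u \<bullet> x)"] by (simp add: norm_mult)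
  then have "bounded (range (\<lambda>x. Re (c * iexp (u \<bullet> x))))"
    by (auto simp: bounded_iff)
  then show ?case by (auto intro!: continuous_intros)
next
  case (2 f g)
  then show ?case by (auto intro!: continuous_intros bounded_plus_comp)
qed

text \<open>
  Polynomials in \<open>sin (x\<^sub>i / R)\<close> are bounded on the whole space by their values on a cube, on which
  they approximate \<open>f\<close> read off through \<open>arcsin\<close>; hence \<open>f\<close> need not have compact support.
\<close>

lemma trig_approximation:
  fixes f :: "'a::euclidean_space \<Rightarrow> real"
  assumes f: "continuous_on UNIV f" "\<And>x. \<bar>f x\<bar> \<le> C" and "e > 0" "R > 0"
  obtains g where "trig_function g" "\<And>x. norm x \<le> R \<Longrightarrow> \<bar>f x - g x\<bar> < e" "\<And>x. \<bar>g x\<bar> \<le> C + e"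
proof -
  define s :: "'a \<Rightarrow> 'a" where "s x = (\<Sum>b\<in>Basis. sin ((x \<bullet> b) / R) *\<^sub>R b)" for x
  define F :: "'a \<Rightarrow> real" where "F y = f (\<Sum>b\<in>Basis. (R * arcsin (y \<bullet> b)) *\<^sub>R b)" for y
  have comp: "compact (cbox (-One) (One::'a))" by simp
  have cont: "continuous_on (cbox (-One) One) F"
    unfolding F_def
    by (rule continuous_on_compose2[OF f(1)]) (auto intro!: continuous_intros simp: mem_box)
  obtain p where p: "real_polynomial_function p" "\<And>y. y \<in> cbox (-One) One \<Longrightarrow> \<bar>F y - p y\<bar> < e"
    using Stone_Weierstrass_real_polynomial_function[OF comp cont \<open>e > 0\<close>] by blast
  have s_in: "s x \<in> cbox (-One) One" for x
    by (simp add: s_def mem_box)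
  have Fs: "F (s x) = f x" if "norm x \<le> R" for x
  proof -
    have "arcsin (sin ((x \<bullet> b) / R)) = (x \<bullet> b) / R" if "b \<in> Basis" for b
    proof (rule arcsin_sin)
      have "\<bar>x \<bullet> b\<bar> \<le> R" using Basis_le_norm[OF that, of x] \<open>norm x \<le> R\<close> by linarith
      then have "\<bar>(x \<bullet> b) / R\<bar> \<le> 1" using \<open>R > 0\<close> by simp
      then show "- (pi / 2) \<le> (x \<bullet> b) / R" "(x \<bullet> b) / R \<le> pi / 2" using pi_ge_two by linarith+
    qed
    then show ?thesis using \<open>R > 0\<close> by (simp add: F_def s_def euclidean_representation)
  qed
  have "trig_function (\<lambda>x. s x \<bullet> b)" if "b \<in> Basis" for b
    using that trig_function_sin[of "b /\<^sub>R R"] by (simp add: s_def inner_sum_left inner_Basis inner_commute[of b] divide_inverse mult.commute if_distrib sum.delta cong: if_cong)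
  then have tr: "trig_function (\<lambda>x. p (s x))"
    by (rule trig_function_polynomial[OF p(1)])
  moreover have "\<bar>p (s x)\<bar> \<le> C + e" for x
  proof -
    have "\<bar>F (s x)\<bar> \<le> C" by (simp add: F_def f(2))
    then show ?thesis using p(2)[OF s_in[of x]] by linarith
  qed
  ultimately show thesis using that p(2)[OF s_in] Fs by metis
qed

lemma expectation_diff_bound:
  fixes f g :: "'a::euclidean_space \<Rightarrow> real"
  assumes "prob_space N" "sets N = sets borel"
    and "f \<in> borel_measurable borel" "g \<in> borel_measurable borel"
    and near: "\<And>x. norm x \<le> R \<Longrightarrow> \<bar>f x - g x\<bar> \<le> e" "e \<ge> 0"
    and bnd: "\<And>x. \<bar>f x\<bar> \<le> C" "\<And>x. \<bar>g x\<bar> \<le> C"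
  shows "\<bar>integral\<^sup>L N f - integral\<^sup>L N g\<bar> \<le> e + 2 * C * measure N {x. norm x > R}"
proof -
  interpret prob_space N by fact
  have [measurable_cong]: "sets N = sets borel" by fact
  have [measurable]: "f \<in> borel_measurable borel" "g \<in> borel_measurable borel" by fact+
  have fi: "integrable N f" "integrable N g"
    using bnd by (auto intro!: integrable_const_bound[where B=C])
  have spN: "space N = UNIV" using sets_eq_imp_space_eq[OF assms(2)] by simp
  have "\<bar>integral\<^sup>L N f - integral\<^sup>L N g\<bar> = \<bar>\<integral>x. f x - g x \<partial>N\<bar>" using fi by simp
  also have "\<dots> \<le> (\<integral>x. \<bar>f x - g x\<bar> \<partial>N)" by (rule integral_abs_bound)
  also have "\<dots> \<le> (\<integral>x. e + 2 * C * indicator {x. norm x > R} x \<partial>N)"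
  proof (rule integral_mono)
    show "integrable N (\<lambda>x. e + 2 * C * indicator {x. norm x > R} x)"
      by (intro Bochner_Integration.integrable_add integrable_mult_right integrable_real_indicator) (auto simp: assms(2) less_top[symmetric])
    show "\<bar>f x - g x\<bar> \<le> e + 2 * C * indicator {x. norm x > R} x" for x
    proof (cases "norm x \<le> R")
      case False
      then show ?thesis using bnd[of x] \<open>e \<ge> 0\<close> by (auto simp: indicator_def abs_le_iff)
    qed (use near in \<open>auto simp: indicator_def\<close>)
  qed (use fi in auto)
  also have "\<dots> = e + 2 * C * measure N {x. norm x > R}"
    by (subst Bochner_Integration.integral_add)
       (auto simp: assms(2) less_top[symmetric] prob_space[unfolded spN] spN)
  finally show ?thesis .
qed

text \<open>By linearity, convergence of characteristic functions is convergence of the integrals of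
  all trigonometric functions. Tightness leaves little mass outside a ball; inside it
  \<open>f\<close> is close to a trigonometric \<open>g\<close>, and outside it the global bound on
  \<open>g\<close> limits the error. The measures are probabilities only eventually, since early
  local parameters may leave \<Theta>.\<close>

lemma weak_conv_borel_if_char_tight:
  fixes \<mu> :: "nat \<Rightarrow> 'a::euclidean_space measure"
  assumes \<mu>: "\<forall>\<^sub>F n in sequentially. prob_space (\<mu> n) \<and> sets (\<mu> n) = sets borel"
    and \<nu>: "prob_space \<nu>" "sets \<nu> = sets borel"
    and tight: "\<And>e. e > 0 \<Longrightarrow> \<exists>R>0. \<forall>\<^sub>F n in sequentially. measure (\<mu> n) {x. norm x > R} \<le> e"
    and char: "\<And>u. (\<lambda>n. CLINT x|\<mu> n. iexp (u \<bullet> x)) \<longlonglongrightarrow> (CLINT x|\<nu>. iexp (u \<bullet> x))"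
  shows "weak_conv_borel \<mu> \<nu>"
  unfolding weak_conv_borel_def
proof (intro allI impI, elim conjE)
  fix f :: "'a \<Rightarrow> real" assume f: "continuous_on UNIV f" "bounded (range f)"
  have trig: "(\<lambda>n. integral\<^sup>L (\<mu> n) g) \<longlonglongrightarrow> integral\<^sup>L \<nu> g" if "trig_function g" for g :: "'a \<Rightarrow> real"
  proof -
    have int: "integrable N h" if N: "prob_space N" "sets N = sets borel" and h: "trig_function h" for N and h :: "'a \<Rightarrow> real"
    proof -
      interpret prob_space N by fact
      obtain C where "\<And>x. \<bar>h x\<bar> \<le> C"
        using trig_function_bounded_continuous[OF h] by (auto simp: bounded_iff)
      moreover have "h \<in> borel_measurable N"
        using trig_function_bounded_continuous[OF h] N(2)
        by (auto intro: borel_measurable_continuous_onI cong: measurable_cong_sets)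
      ultimately show ?thesis by (intro integrable_const_bound[where B=C]) auto
    qed
    have intc: "integrable N (\<lambda>x. iexp (u \<bullet> x))" if "prob_space N" "sets N = sets borel" for N and u :: 'a
    proof -
      interpret prob_space N by fact
      have "(\<lambda>x. iexp (u \<bullet> x)) \<in> borel_measurable N" using that(2) by (auto intro!: borel_measurable_continuous_onI continuous_intros cong: measurable_cong_sets)
      then show ?thesis by (intro integrable_const_bound[where B=1]) auto
    qed
    show ?thesis using that
    proof induction
      case (1 c u)
      have eq: "integral\<^sup>L N (\<lambda>x. Re (c * iexp (u \<bullet> x))) = Re (c * (CLINT x|N. iexp (u \<bullet> x)))"
        if "prob_space N" "sets N = sets borel" for N
        using intc[OF that, of u] by (simp only: integral_Re integral_mult_right_zero[symmetric] integrable_mult_right)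
      have "(\<lambda>n. Re (c * (CLINT x|\<mu> n. iexp (u \<bullet> x)))) \<longlonglongrightarrow> Re (c * (CLINT x|\<nu>. iexp (u \<bullet> x)))"
        by (intro tendsto_intros char)
      then show ?case unfolding eq[OF \<nu>]
        by (rule Lim_transform_eventually) (use \<mu> in eventually_elim, use eq in auto)
    next
      case (2 g h)
      have "(\<lambda>n. integral\<^sup>L (\<mu> n) g + integral\<^sup>L (\<mu> n) h) \<longlonglongrightarrow> integral\<^sup>L \<nu> g + integral\<^sup>L \<nu> h"
        by (intro tendsto_intros 2)
      moreover have "\<forall>\<^sub>F n in sequentially. integral\<^sup>L (\<mu> n) g + integral\<^sup>L (\<mu> n) h = integral\<^sup>L (\<mu> n) (\<lambda>x. g x + h x)"
        using \<mu> by eventually_elim (simp add: int 2)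
      ultimately show ?case using \<nu> by (auto simp: int 2 intro: Lim_transform_eventually)
    qed
  qed
  obtain C where C: "C > 0" "\<And>x. \<bar>f x\<bar> \<le> C"
    using f(2) by (auto simp: bounded_pos)
  show "(\<lambda>n. integral\<^sup>L (\<mu> n) f) \<longlonglongrightarrow> integral\<^sup>L \<nu> f"
  proof (rule tendstoI)
    fix e :: real assume "e > 0"
    \<comment> \<open>Replacing \<open>f\<close> by \<open>g\<close> costs d + 2 * (C + 1) * d for
      each of the two measures, and the integrals of \<open>g\<close> differ by less than d:
      together less than d * (4 * C + 7), which is at most e. The bound d \<le> 1 gives |g| \<le> C
      + 1.\<close>
    define d where "d = min 1 (e / (8 * C + 8))"
    have d: "d > 0" "d \<le> 1" using \<open>e > 0\<close> C by (auto simp: d_def)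
    obtain R1 where R1: "R1 > 0" "\<forall>\<^sub>F n in sequentially. measure (\<mu> n) {x. norm x > R1} \<le> d"
      using tight[OF d(1)] by blast
    interpret \<nu>: prob_space \<nu> by fact
    have [measurable_cong]: "sets \<nu> = sets borel" by fact
    have "(\<lambda>n. measure \<nu> {x. norm x > real n}) \<longlonglongrightarrow> measure \<nu> (\<Inter>n. {x. norm x > real n})"
      by (rule \<nu>.finite_Lim_measure_decseq) (auto simp: decseq_def \<nu>(2))
    moreover have "\<exists>n. \<not> norm x > real n" for x :: 'a
      using real_arch_simple[of "norm x"] by (simp add: not_less)
    then have "(\<Inter>n. {x::'a. norm x > real n}) = {}"
      by blast
    ultimately have "\<forall>\<^sub>F n in sequentially. measure \<nu> {x. norm x > real n} < d"
      using d by (auto dest: order_tendstoD(2))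
    then obtain n where n: "measure \<nu> {x. norm x > real n} < d" by (auto simp: eventually_sequentially)
    define R where "R = max R1 (real n)"
    have "R > 0" using R1 by (simp add: R_def)
    have R_nu: "measure \<nu> {x. norm x > R} \<le> d"
      by (rule order_trans[OF \<nu>.finite_measure_mono less_imp_le[OF n]]) (auto simp: R_def \<nu>(2))
    have R_mu: "\<forall>\<^sub>F n in sequentially. measure (\<mu> n) {x. norm x > R} \<le> d"
      using R1(2) \<mu>
    proof eventually_elim
      case (elim n)
      interpret prob_space "\<mu> n" using elim by simp
      show ?case
        by (rule order_trans[OF finite_measure_mono elim(1)]) (use elim in \<open>auto simp: R_def\<close>)
    qed
    obtain g where g: "trig_function g" "\<And>x. norm x \<le> R \<Longrightarrow> \<bar>f x - g x\<bar> < d" "\<And>x. \<bar>g x\<bar> \<le> C + d"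
      using trig_approximation[OF f(1) C(2) d(1) \<open>R > 0\<close>] by blast
    have fg: "\<bar>integral\<^sup>L N f - integral\<^sup>L N g\<bar> \<le> d + 2 * (C + 1) * measure N {x. norm x > R}"
      if "prob_space N" "sets N = sets borel" for N
    proof (rule expectation_diff_bound[OF that])
      show "f \<in> borel_measurable borel" "g \<in> borel_measurable borel"
        using f(1) trig_function_bounded_continuous[OF g(1)] by (auto intro: borel_measurable_continuous_onI)
      show "\<bar>f x - g x\<bar> \<le> d" if "norm x \<le> R" for x using g(2)[OF that] by simp
      show "\<bar>f x\<bar> \<le> C + 1" "\<bar>g x\<bar> \<le> C + 1" for x using C(2)[of x] g(3)[of x] d by linarith+
    qed (use d in auto)
    have fg': "\<bar>integral\<^sup>L N f - integral\<^sup>L N g\<bar> \<le> d + 2 * (C + 1) * d"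
      if "prob_space N" "sets N = sets borel" "measure N {x. norm x > R} \<le> d" for N
    proof -
      have "2 * (C + 1) * measure N {x. norm x > R} \<le> 2 * (C + 1) * d"
        using that(3) C by (intro mult_left_mono) auto
      then show ?thesis using fg[OF that(1,2)] by linarith
    qed
    have "\<forall>\<^sub>F n in sequentially. dist (integral\<^sup>L (\<mu> n) g) (integral\<^sup>L \<nu> g) < d"
      using tendstoD[OF trig[OF g(1)] d(1)] .
    then show "\<forall>\<^sub>F n in sequentially. dist (integral\<^sup>L (\<mu> n) f) (integral\<^sup>L \<nu> f) < e"
      using R_mu \<mu>
    proof eventually_elim
      case (elim n)
      have "dist (integral\<^sup>L (\<mu> n) f) (integral\<^sup>L \<nu> f) < 2 * (d + 2 * (C + 1) * d) + d"
        using elim fg'[of "\<mu> n"] fg'[OF \<nu> R_nu] by (simp add: dist_real_def)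
      also have "\<dots> = d * (4 * C + 7)" by (simp add: algebra_simps)
      also have "\<dots> \<le> d * (8 * C + 8)" using d C by (intro mult_left_mono) auto
      also have "\<dots> \<le> e / (8 * C + 8) * (8 * C + 8)" using C by (intro mult_right_mono) (auto simp: d_def)
      also have "\<dots> = e" using C by simp
      finally show ?case .
    qed
  qed
qed

section \<open>The multivariate normal law\<close>

text \<open>The library's \<open>measure_linear_image\<close> needs a well-ordered index type.\<close>

lemma measure_linear_image_cart:
  fixes f :: "real^'n \<Rightarrow> real^'n"
  assumes "linear f" "S \<in> lmeasurable"
  shows "f ` S \<in> lmeasurable \<and> measure lebesgue (f ` S) = \<bar>det (matrix f)\<bar> * measure lebesgue S"
proof -
  have "\<forall>S \<in> lmeasurable. f ` S \<in> lmeasurable \<and>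
          measure lebesgue (f ` S) = \<bar>det (matrix f)\<bar> * measure lebesgue S"
  \<comment> \<open>The cases are composition, a map with a vanishing coordinate, a diagonal map, a
    swap of two coordinates and a shear. For the last two it suffices to compare volumes of
    boxes.\<close>
  proof (rule induct_linear_elementary [OF \<open>linear f\<close>], goal_cases)
    case (1 f g)
    then show ?case
      by (auto simp: matrix_compose[unfolded o_def] abs_mult det_mul o_def image_image[of f g, symmetric])
  next
    case (2 f i)
    then have "\<not> inj f"
      by (metis (full_types) linear_injective_imp_surjective one_neq_zero surjE vec_component)
    then have "det (matrix f) = 0" "negligible (f ` S)" for S
      using 2 det_nz_iff_inj negligible_linear_singular_image by blast+
    then show ?case
      by (auto simp: negligible_iff_measure)
  next
    case (3 c)
    then show ?case
      by (auto simp: measurable_stretch measure_stretch axis_def matrix_def det_diagonal)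
  next
    case (4 m n)
    let ?h = "\<lambda>v :: real^'n. \<chi> i. v $ Transposition.transpose m n i"
    have lin: "linear ?h"
      by (rule linearI) (simp_all add: plus_vec_def scaleR_vec_def)
    have image_swap: "?h ` cbox a b = cbox (?h a) (?h b)" for a b
    proof (intro set_eqI iffI)
      fix x assume "x \<in> cbox (?h a) (?h b)"
      then have "?h x \<in> cbox a b"
        by (auto simp: mem_box_cart) (metis transpose_involutory)+
      moreover have "x = ?h (?h x)"
        by (simp add: vec_eq_iff)
      ultimately show "x \<in> ?h ` cbox a b" by blast
    qed (auto simp: mem_box_cart)
    have prod_swap: "(\<Prod>i\<in>UNIV. w $ Transposition.transpose m n i) = prod (($) w) UNIV" for w :: "real^'n"
      using prod.permute[OF permutes_swap_id[of m UNIV n], of "($) w"] by (simp add: o_def)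
    have meq: "measure lebesgue (?h ` cbox a b) = measure lebesgue (cbox a b)" for a b
    proof (cases "cbox a b = {}")
      case False
      then have "?h ` cbox a b \<noteq> {}" by blast
      with False show ?thesis
        using prod_swap[of "b - a"] image_swap[of a b] by (simp add: content_cbox_cart)
    qed auto
    have "matrix ?h = (\<chi> i j. mat 1 $ i $ Transposition.transpose m n j)"
    proof -
      have "Transposition.transpose m n i = j \<longleftrightarrow> i = Transposition.transpose m n j" for i j
        by (metis transpose_involutory)
      then show ?thesis by (simp add: vec_eq_iff matrix_def axis_def mat_def)
    qed
    then have det1: "\<bar>det (matrix ?h)\<bar> = 1"
      by (simp add: det_permute_columns permutes_swap_id sign_swap_id abs_mult)
    show ?case
    proof
      fix S :: "(real^'n) set" assume "S \<in> lmeasurable"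
      with lin have "?h ` S \<in> lmeasurable \<and> 1 * measure lebesgue S = measure lebesgue (?h ` S)"
        by (rule measure_linear_sufficient) (simp only: meq mult_1)
      then show "?h ` S \<in> lmeasurable \<and>
          measure lebesgue (?h ` S) = \<bar>det (matrix ?h)\<bar> * measure lebesgue S"
        by (simp only: det1 simp_thms)
    qed
  next
    case (5 m n)
    let ?h = "\<lambda>v :: real^'n. \<chi> i. if i = m then v $ m + v $ n else v $ i"
    have lin: "linear ?h"
      by (rule linearI) (auto simp: algebra_simps plus_vec_def scaleR_vec_def vec_eq_iff)
    have meq: "measure lebesgue (?h ` cbox a b) = measure lebesgue (cbox a b)" for a b
    proof (cases "cbox a b = {}")
      case False
      \<comment> \<open>Translating the box puts its lower corner at 0, so that the volume formula
        for sheared boxes with nonnegative lower corner applies.\<close>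
      have "cbox a b = (+) a ` cbox 0 (b - a)"
        by (simp add: cbox_translation[symmetric])
      then have "?h ` cbox a b = (+) (?h a) ` ?h ` cbox 0 (b - a)"
        by (simp add: image_image linear_add[OF lin])
      also have "measure lebesgue \<dots> = measure lebesgue (cbox 0 (b - a))"
        using 5 False by (simp only: measure_translation) (intro measure_shear_interval, auto simp: box_ne_empty inner_diff_left)
      also have "\<dots> = measure lebesgue (cbox a b)"
        by (subst \<open>cbox a b = _\<close>) (simp only: measure_translation)
      finally show ?thesis .
    qed auto
    have "matrix ?h = (\<chi> k. if k = m then row m (mat 1) + 1 *s row n (mat 1) else row k (mat 1))"
      using 5 by (auto simp: vec_eq_iff matrix_def axis_def mat_def row_def)
    then have det1: "\<bar>det (matrix ?h)\<bar> = 1"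
      by (simp only: det_row_operation[OF 5] det_I abs_1)
    show ?case
    proof
      fix S :: "(real^'n) set" assume "S \<in> lmeasurable"
      with lin have "?h ` S \<in> lmeasurable \<and> 1 * measure lebesgue S = measure lebesgue (?h ` S)"
        by (rule measure_linear_sufficient) (simp only: meq mult_1)
      then show "?h ` S \<in> lmeasurable \<and>
          measure lebesgue (?h ` S) = \<bar>det (matrix ?h)\<bar> * measure lebesgue S"
        by (simp only: det1 simp_thms)
    qed
  qed
  with assms show ?thesis by blast
qed

text \<open>Lebesgue measure is determined by its values on boxes. The preimage of a box under
  \<open>A\<close> is its image under the inverse \<open>B\<close>, whose volume is |det B| times
  that of the box, and |det A| * |det B| = 1.\<close>

lemma lborel_linear_cart:
  fixes A :: "real^'n^'n"
  assumes A: "invertible A"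
  shows "lborel = density (distr lborel borel ((*v) A)) (\<lambda>_. ennreal \<bar>det A\<bar>)"
proof (rule lborel_eqI)
  fix l u :: "real^'n" assume le: "\<And>b. b \<in> Basis \<Longrightarrow> l \<bullet> b \<le> u \<bullet> b"
  have [measurable]: "(*v) A \<in> borel_measurable borel"
    by (intro borel_measurable_continuous_onI linear_continuous_on bounded_linear_intros) (simp add: matrix_vector_mul_bounded_linear)
  obtain B where B: "A ** B = mat 1" "B ** A = mat 1"
    using A by (auto simp: invertible_def)
  have vim: "(*v) A -` box l u = (*v) B ` box l u"
  proof (intro set_eqI iffI)
    fix x assume "x \<in> (*v) A -` box l u"
    moreover have "x = B *v (A *v x)" by (simp add: matrix_vector_mul_assoc B)
    ultimately show "x \<in> (*v) B ` box l u" by blast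
  qed (auto simp: matrix_vector_mul_assoc B)
  have lm: "(*v) B ` box l u \<in> lmeasurable" and
    me: "measure lebesgue ((*v) B ` box l u) = \<bar>det B\<bar> * measure lebesgue (box l u)"
    using measure_linear_image_cart[of "(*v) B" "box l u"] by (auto simp: matrix_vector_mul_linear)
  have AB: "\<bar>det A\<bar> * \<bar>det B\<bar> = 1"
    using B(1) by (metis abs_1 abs_mult det_I det_mul)
  have bm: "(*v) B ` box l u \<in> sets borel"
    unfolding vim[symmetric] using measurable_sets[OF \<open>(*v) A \<in> _\<close>, of "box l u"] by simp
  have "emeasure lborel ((*v) B ` box l u) = ennreal (\<bar>det B\<bar> * measure lborel (box l u))"
    using lm me bm by (subst emeasure_eq_ennreal_measure) (auto simp: fmeasurable_def)
  then have "emeasure (density (distr lborel borel ((*v) A)) (\<lambda>_. ennreal \<bar>det A\<bar>)) (box l u)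
     = ennreal \<bar>det A\<bar> * ennreal (\<bar>det B\<bar> * measure lborel (box l u))"
    by (simp add: emeasure_density nn_integral_cmult emeasure_distr vim)
  also have "\<dots> = ennreal (measure lborel (box l u))"
    using AB by (simp add: ennreal_mult[symmetric] mult.assoc[symmetric])
  finally show "emeasure (density (distr lborel borel ((*v) A)) (\<lambda>_. ennreal \<bar>det A\<bar>)) (box l u)
     = ennreal (\<Prod>b\<in>Basis. (u - l) \<bullet> b)"
    using le by (simp add: measure_lborel_box_eq)
qed simp

text \<open>Gram-Schmidt for the inner product x \<bullet> (S *v y); the columns of \<open>A\<close>
  are an orthonormal basis. Then A A^T is the inverse of S, so \<open>A\<close> serves as a square
  root of the covariance without diagonalisation.\<close>

lemma pos_definite_orthonormalizer:
  fixes S :: "real^'n^'n"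
  assumes S: "pos_definite S"
  obtains A :: "real^'n^'n" where "transpose A ** S ** A = mat 1"
proof -
  define ip where "ip x y = x \<bullet> (S *v y)" for x y
  have sym: "ip x y = ip y x" for x y
    using S by (simp add: ip_def pos_definite_def dot_lmul_matrix[symmetric] vector_transpose_matrix inner_commute)
      (metis dot_lmul_matrix inner_commute transpose_matrix_vector)
  have ip_add: "ip x (y + z) = ip x y + ip x z" and ip_scale: "ip x (c *\<^sub>R y) = c * ip x y"
    and ip_sum: "finite F \<Longrightarrow> ip x (\<Sum>v\<in>F. g v) = (\<Sum>v\<in>F. ip x (g v))" for x y z c and F :: "(real^'n) set" and g
    by (simp_all add: ip_def matrix_vector_right_distrib inner_add_right matrix_vector_mult_scaleR
        linear_sum[OF matrix_vector_mul_linear] inner_sum_right)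
  have pos: "x \<noteq> 0 \<Longrightarrow> ip x x > 0" for x
    using S by (simp add: ip_def pos_definite_def)
  define ON where "ON B \<longleftrightarrow> finite B \<and> (\<forall>x\<in>B. \<forall>y\<in>B. ip x y = of_bool (x = y))" for B
  have ON_coeff: "ip x (\<Sum>v\<in>B. c v *\<^sub>R v) = c x" if "ON B" "x \<in> B" for B x c
  proof -
    have "ip x (\<Sum>v\<in>B. c v *\<^sub>R v) = (\<Sum>v\<in>B. c v * of_bool (x = v))"
      using that by (subst ip_sum) (auto simp: ON_def ip_scale intro!: sum.cong)
    also have "\<dots> = c x" using that by (simp add: ON_def of_bool_def if_distrib sum.delta cong: if_cong)
    finally show ?thesis .
  qed
  have ind: "independent B" if "ON B" for B
    unfolding independent_explicit
  proof (intro conjI allI impI ballI)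
    show "finite B" using that by (simp add: ON_def)
    fix c x assume "(\<Sum>v\<in>B. c v *\<^sub>R v) = 0" "x \<in> B"
    with ON_coeff[OF that \<open>x \<in> B\<close>, of c] show "c x = 0" by (simp add: ip_def)
  qed
  have ex: "\<exists>B. ON B \<and> card B = k" if "k \<le> CARD('n)" for k
    using that
  proof (induction k)
    case 0
    show ?case by (intro exI[of _ "{}"]) (simp add: ON_def)
  next
    case (Suc k)
    then obtain B where B: "ON B" "card B = k" by auto
    have "span B \<noteq> UNIV"
      using Suc.prems B ind[OF B(1)] by (metis DIM_cart DIM_real Suc_n_not_le_n dim_UNIV dim_eq_card_independent dim_span mult.right_neutral)
    then obtain v where v: "v \<notin> span B" by blast
    define w where "w = v - (\<Sum>b\<in>B. ip b v *\<^sub>R b)"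
    have "w \<noteq> 0"
    proof
      assume "w = 0"
      then have "v = (\<Sum>b\<in>B. ip b v *\<^sub>R b)" by (simp add: w_def)
      also have "\<dots> \<in> span B" by (intro span_sum span_scale span_base)
      finally show False using v by simp
    qed
    have "ip x w = 0" if "x \<in> B" for x
    proof -
      have "ip x v = ip x (w + (\<Sum>b\<in>B. ip b v *\<^sub>R b))" by (simp add: w_def)
      then show ?thesis using ON_coeff[OF B(1) that] by (simp add: ip_add)
    qed
    note orth = this
    define e where "e = (1 / sqrt (ip w w)) *\<^sub>R w"
    have xe: "ip x e = 0" if "x \<in> B" for x using orth[OF that] by (simp add: e_def ip_scale)
    have ex: "ip e x = 0" if "x \<in> B" for x
      using xe[OF that] sym[of e x] by simp
    have "ip e e = 1"
    proof -
      have "ip e e = (1 / sqrt (ip w w)) * ip w e"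
        by (subst (2) e_def) (simp only: ip_scale sym[of e w])
      also have "ip w e = (1 / sqrt (ip w w)) * ip w w"
        by (simp only: e_def ip_scale)
      finally show ?thesis using pos[OF \<open>w \<noteq> 0\<close>] by simp
    qed
    moreover have "e \<notin> B" using xe[of e] \<open>ip e e = 1\<close> by auto
    ultimately have "ON (insert e B)"
      using B(1) xe ex by (auto simp: ON_def)
    then show ?case using \<open>e \<notin> B\<close> B by (intro exI[of _ "insert e B"]) (simp add: ON_def)
  qed
  obtain B where B: "ON B" "card B = CARD('n)" using ex by blast
  then obtain f where f: "bij_betw f (UNIV :: 'n set) B"
    using finite_same_card_bij[of "UNIV :: 'n set" B] by (auto simp: ON_def)
  define A :: "real^'n^'n" where "A = (\<chi> i j. f j $ i)"
  have "(transpose A ** S ** A) $ i $ j = ip (f i) (f j)" for i j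
    by (simp add: A_def matrix_matrix_mult_def matrix_vector_mult_def transpose_def ip_def inner_vec_def
        sum_distrib_left sum_distrib_right)
      (subst sum.swap, simp add: mult.assoc)
  moreover have "ip (f i) (f j) = of_bool (i = j)" for i j
    using B(1) f by (auto simp: ON_def bij_betw_def inj_on_def)
  ultimately have "transpose A ** S ** A = mat 1"
    by (simp add: vec_eq_iff mat_def)
  then show thesis by (rule that)
qed

lemma char_std_normal_euclidean:
  fixes v :: "'a::euclidean_space"
  shows "(CLINT x|lborel. (\<Prod>b\<in>Basis. std_normal_density (x \<bullet> b)) *\<^sub>R iexp (v \<bullet> x)) = exp (- (v \<bullet> v) / 2)"
proof -
  interpret product_sigma_finite "\<lambda>_::'a. lborel :: real measure"
    by (simp add: product_sigma_finite_def lborel.sigma_finite_measure_axioms)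
  define g where "g t x = std_normal_density x *\<^sub>R iexp (t * x)" for t x :: real
  have g_int: "integrable lborel (g t)" for t
  proof -
    have "integrable std_normal_distribution (\<lambda>x. iexp (t * x))"
      by (intro prob_space.integrable_iexp prob_space_normal_density) simp_all
    then show ?thesis by (simp add: integrable_density g_def[abs_def] normal_density_nonneg)
  qed
  have g_char: "integral\<^sup>L lborel (g t) = exp (- t\<^sup>2 / 2)" for t
    using fun_cong[OF char_std_normal_distribution, of t]
    by (simp add: char_def integral_density g_def[abs_def] normal_density_nonneg)
  have "(CLINT x|lborel. (\<Prod>b\<in>Basis. std_normal_density (x \<bullet> b)) *\<^sub>R iexp (v \<bullet> x))
      = (CLINT x|lborel. (\<Prod>b\<in>Basis. g (v \<bullet> b) (x \<bullet> b)))"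
  proof (rule arg_cong2[where f="integral\<^sup>L"], rule refl, rule ext)
    fix x :: 'a
    have "iexp (v \<bullet> x) = (\<Prod>b\<in>Basis. iexp ((v \<bullet> b) * (x \<bullet> b)))"
      by (subst euclidean_inner) (simp add: exp_sum[symmetric] sum_distrib_left)
    then show "(\<Prod>b\<in>Basis. std_normal_density (x \<bullet> b)) *\<^sub>R iexp (v \<bullet> x) = (\<Prod>b\<in>Basis. g (v \<bullet> b) (x \<bullet> b))"
      by (simp add: g_def scaleR_conv_of_real prod.distrib)
  qed
  also have "\<dots> = (CLINT f|(\<Pi>\<^sub>M b\<in>Basis. lborel). (\<Prod>b\<in>(Basis::'a set). g (v \<bullet> b) (f b)))"
    unfolding lborel_eq[where 'a='a]
    by (subst integral_distr) (auto simp: g_def intro!: Bochner_Integration.integral_cong prod.cong)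
  also have "\<dots> = (\<Prod>b\<in>(Basis::'a set). integral\<^sup>L lborel (g (v \<bullet> b)))"
    by (intro product_integral_prod g_int) simp
  also have "\<dots> = exp (\<Sum>b\<in>(Basis::'a set). - (v \<bullet> b)\<^sup>2 / 2)"
    by (simp add: g_char exp_sum)
  also have "(\<Sum>b\<in>(Basis::'a set). - (v \<bullet> b)\<^sup>2 / 2) = - (v \<bullet> v) / 2"
    by (subst euclidean_inner[of v v]) (simp add: power2_eq_square sum_negf sum_divide_distrib)
  finally show ?thesis .
qed

lemma matrix_inv_unique:
  fixes A :: "real^'n^'n"
  assumes "A ** B = mat 1"
  shows "matrix_inv A = B"
proof -
  have BA: "B ** A = mat 1" using assms by (simp add: matrix_left_right_inverse)
  then have "invertible A" using assms by (auto simp: invertible_def)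
  then have "matrix_inv A ** A = mat 1"
    unfolding invertible_def matrix_inv_def by (rule someI2_ex) simp
  then show ?thesis using assms
    by (metis matrix_mul_assoc matrix_mul_lid matrix_mul_rid)
qed

lemma pos_definite_invertible:
  fixes S :: "real^'n^'n"
  assumes "pos_definite S"
  shows "invertible S"
proof -
  obtain A :: "real^'n^'n" where "transpose A ** S ** A = mat 1"
    by (rule pos_definite_orthonormalizer[OF assms])
  then have "det A * det S * det A = 1"
    by (metis det_I det_mul det_transpose)
  then show ?thesis by (auto simp: invertible_det_nz)
qed

lemma matrix_inv_invertible:
  fixes S :: "real^'n^'n"
  assumes "invertible S"
  shows "S ** matrix_inv S = mat 1" "matrix_inv S ** S = mat 1"
  using someI_ex[OF assms[unfolded invertible_def]] by (auto simp: matrix_inv_def)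

text \<open>In the coordinates y = A x the form y \<bullet> S y becomes x \<bullet> x, and the root
  of the determinant of the covariance becomes |det A|, which the change of variables cancels. Total
  mass and characteristic function thus reduce to the standard normal law.\<close>

lemma mv_normal_transform:
  fixes S :: "real^'n^'n"
  assumes S: "pos_definite S"
  obtains A :: "real^'n^'n" where "A ** transpose A = matrix_inv S"
    "mv_normal 0 (matrix_inv S)
       = distr (density lborel (\<lambda>x. \<Prod>b\<in>Basis. std_normal_density (x \<bullet> b))) borel ((*v) A)"
proof -
  obtain A :: "real^'n^'n" where A: "transpose A ** S ** A = mat 1"
    by (rule pos_definite_orthonormalizer[OF S])
  have inv: "matrix_inv S = A ** transpose A"
  proof (rule matrix_inv_unique)
    have "A ** (transpose A ** S) = mat 1"
      using A by (simp add: matrix_left_right_inverse)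
    then have "(A ** transpose A) ** S = mat 1"
      by (simp add: matrix_mul_assoc)
    then show "S ** (A ** transpose A) = mat 1"
      by (simp add: matrix_left_right_inverse)
  qed
  have invinv: "matrix_inv (A ** transpose A) = S"
    using matrix_inv_invertible[OF pos_definite_invertible[OF S]] by (intro matrix_inv_unique) (simp add: inv)
  have dA: "det A \<noteq> 0"
    by (metis A det_I det_mul mult_zero_right zero_neq_one)
  have [measurable]: "(*v) A \<in> borel_measurable borel"
    by (intro borel_measurable_continuous_onI linear_continuous_on) (simp add: matrix_vector_mul_bounded_linear)
  define dens where "dens x = exp (- (1 / 2) * (x \<bullet> (S *v x))) / sqrt ((2 * pi) ^ CARD('n) * (det A)\<^sup>2)" for x
  have [measurable]: "dens \<in> borel_measurable borel"
    unfolding dens_def by (intro borel_measurable_continuous_onI continuous_intros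
        linear_continuous_on matrix_vector_mul_bounded_linear) (simp add: dA)
  have dens_nonneg: "dens x \<ge> 0" for x
    by (simp add: dens_def)
  have key: "\<bar>det A\<bar> * dens (A *v x) = (\<Prod>b\<in>Basis. std_normal_density (x \<bullet> b))" for x
  proof -
    have "(A *v x) \<bullet> (S *v (A *v x)) = x \<bullet> ((transpose A ** S ** A) *v x)"
    proof -
      have "(A *v x) \<bullet> w = x \<bullet> (transpose A *v w)" for w
        by (metis dot_lmul_matrix inner_commute transpose_matrix_vector)
      then show ?thesis by (simp only: matrix_vector_mul_assoc matrix_mul_assoc)
    qed
    also have "\<dots> = x \<bullet> x" by (simp add: A)
    finally have q: "(A *v x) \<bullet> (S *v (A *v x)) = x \<bullet> x" .
    have "(\<Prod>b\<in>Basis. std_normal_density (x \<bullet> b)) =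
        (1 / sqrt (2 * pi)) ^ CARD('n) * exp (\<Sum>b\<in>Basis. - (x \<bullet> b)\<^sup>2 / 2)"
      by (simp add: std_normal_density_def prod.distrib prod_dividef exp_sum power_divide)
    also have "(\<Sum>b\<in>Basis. - (x \<bullet> b)\<^sup>2 / 2) = - (x \<bullet> x) / 2"
      by (subst euclidean_inner[of x x]) (simp add: power2_eq_square sum_negf sum_divide_distrib)
    also have "(1 / sqrt (2 * pi)) ^ CARD('n) * exp (- (x \<bullet> x) / 2)
        = \<bar>det A\<bar> * (exp (- (x \<bullet> x) / 2) / (sqrt (2 * pi) ^ CARD('n) * \<bar>det A\<bar>))"
      using dA by (simp add: power_divide)
    also have "sqrt (2 * pi) ^ CARD('n) * \<bar>det A\<bar> = sqrt ((2 * pi) ^ CARD('n) * (det A)\<^sup>2)"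
      by (simp only: real_sqrt_mult[of "_ ^ CARD('n)"] real_sqrt_abs real_sqrt_power[of "2 * pi"])
    finally show ?thesis
      by (simp add: dens_def q)
  qed
  have "mv_normal 0 (matrix_inv S) = density lborel (\<lambda>x. ennreal (dens x))"
    by (simp add: mv_normal_def inv invinv dens_def det_mul power2_eq_square)
  also have "\<dots> = density (density (distr lborel borel ((*v) A)) (\<lambda>_. ennreal \<bar>det A\<bar>)) (\<lambda>x. ennreal (dens x))"
    using dA by (simp only: lborel_linear_cart[of A, symmetric] invertible_det_nz simp_thms)
  also have "\<dots> = density (distr lborel borel ((*v) A)) (\<lambda>x. ennreal (\<bar>det A\<bar> * dens x))"
    by (subst density_density_eq) (auto simp: ennreal_mult dens_nonneg)
  also have "\<dots> = distr (density lborel (\<lambda>x. ennreal (\<bar>det A\<bar> * dens (A *v x)))) borel ((*v) A)"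
    by (subst density_distr) auto
  finally have "mv_normal 0 (matrix_inv S)
      = distr (density lborel (\<lambda>x. \<Prod>b\<in>Basis. std_normal_density (x \<bullet> b))) borel ((*v) A)"
    by (simp only: key)
  then show thesis by (rule that[OF inv[symmetric]])
qed

lemma prob_space_std_normal_euclidean:
  "prob_space (density lborel (\<lambda>x::'a::euclidean_space. ennreal (\<Prod>b\<in>Basis. std_normal_density (x \<bullet> b))))"
proof (rule prob_spaceI)
  have 1: "(\<integral>\<^sup>+x. ennreal (std_normal_density x) \<partial>lborel) = 1"
    using prob_space.emeasure_space_1[OF prob_space_normal_density[of 1 0]]
    by (simp add: emeasure_density)
  have "emeasure (density lborel (\<lambda>x::'a. ennreal (\<Prod>b\<in>Basis. std_normal_density (x \<bullet> b)))) UNIV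
      = (\<integral>\<^sup>+x. (\<Prod>b\<in>(Basis::'a set). ennreal (std_normal_density (x \<bullet> b))) \<partial>lborel)"
    by (simp add: emeasure_density prod_ennreal normal_density_nonneg)
  also have "\<dots> = 1"
    by (subst nn_integral_lborel_prod) (auto simp: 1)
  finally show "emeasure (density lborel (\<lambda>x::'a. ennreal (\<Prod>b\<in>Basis. std_normal_density (x \<bullet> b))))
     (space (density lborel (\<lambda>x::'a. ennreal (\<Prod>b\<in>Basis. std_normal_density (x \<bullet> b))))) = 1"
    by simp
qed

lemma prob_space_mv_normal:
  fixes S :: "real^'n^'n"
  assumes "pos_definite S"
  shows "prob_space (mv_normal 0 (matrix_inv S))"
proof -
  obtain A :: "real^'n^'n" where "mv_normal 0 (matrix_inv S)
       = distr (density lborel (\<lambda>x. \<Prod>b\<in>Basis. std_normal_density (x \<bullet> b))) borel ((*v) A)"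
    by (rule mv_normal_transform[OF assms])
  then show ?thesis
    by (auto intro!: prob_space.prob_space_distr prob_space_std_normal_euclidean
        borel_measurable_continuous_onI linear_continuous_on matrix_vector_mul_bounded_linear)
qed

lemma char_mv_normal:
  fixes S :: "real^'n^'n"
  assumes "pos_definite S"
  shows "(CLINT y|mv_normal 0 (matrix_inv S). iexp (u \<bullet> y)) = exp (- (u \<bullet> (matrix_inv S *v u)) / 2)"
proof -
  obtain A :: "real^'n^'n" where A: "A ** transpose A = matrix_inv S" and eq: "mv_normal 0 (matrix_inv S)
       = distr (density lborel (\<lambda>x. \<Prod>b\<in>Basis. std_normal_density (x \<bullet> b))) borel ((*v) A)"
    by (rule mv_normal_transform[OF assms])
  have [measurable]: "(*v) A \<in> borel_measurable borel"
    by (intro borel_measurable_continuous_onI linear_continuous_on) (simp add: matrix_vector_mul_bounded_linear)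
  have adj: "u \<bullet> (A *v y) = (transpose A *v u) \<bullet> y" for y
    by (metis dot_lmul_matrix transpose_matrix_vector)
  have "(CLINT y|mv_normal 0 (matrix_inv S). iexp (u \<bullet> y))
     = (CLINT x|lborel. (\<Prod>b\<in>Basis. std_normal_density (x \<bullet> b)) *\<^sub>R iexp ((transpose A *v u) \<bullet> x))"
    unfolding eq by (simp add: integral_distr integral_density prod_nonneg normal_density_nonneg adj)
  also have "\<dots> = exp (- ((transpose A *v u) \<bullet> (transpose A *v u)) / 2)"
    by (rule char_std_normal_euclidean)
  also have "(transpose A *v u) \<bullet> (transpose A *v u) = u \<bullet> (matrix_inv S *v u)"
    by (simp add: A[symmetric] adj[symmetric] matrix_vector_mul_assoc[symmetric] del: transpose_matrix_vector)
  finally show ?thesis .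
qed

section \<open>The law of the observations\<close>

text \<open>Mass of the event bit given the gate; the probability of the gate itself is kept apart
  in a kernel. A closed gate forces the event bit to be False.\<close>

definition obs_prob :: "real \<Rightarrow> bool \<times> bool \<Rightarrow> real" where
  "obs_prob p z = (if fst z then (if snd z then p else 1 - p) else of_bool (\<not> snd z))"

text \<open>
  \<open>\<kappa> x g\<close> is the conditional probability of the gate value \<open>g\<close> after the past \<open>x\<close>.
\<close>

definition path_prob :: "((bool \<times> bool) list \<Rightarrow> bool \<Rightarrow> real) \<Rightarrow> (nat \<Rightarrow> real) \<Rightarrow> (bool \<times> bool) list \<Rightarrow> real"
  where "path_prob \<kappa> q x = (\<Prod>t<length x. \<kappa> (take t x) (fst (x ! t)) * obs_prob (q t) (x ! t))"

lemma path_prob_Nil [simp]: "path_prob \<kappa> q [] = 1"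
  by (simp add: path_prob_def)

lemma path_prob_snoc [simp]:
  "path_prob \<kappa> q (x @ [z]) = path_prob \<kappa> q x * (\<kappa> x (fst z) * obs_prob (q (length x)) z)"
  by (simp add: path_prob_def nth_append)

text \<open>
  Including finitely many future values of \<open>Z\<close> makes the statement inductive: it contains the
  independence of \<open>Z t\<close> from the past.
\<close>

lemma ded_joint_law:
  fixes M :: "'w measure"
  assumes M: "prob_space M"
    and meas: "\<And>t. G t \<in> measurable M (count_space UNIV)" "\<And>t. Y t \<in> measurable M (count_space UNIV)"
    and obs: "ded_observation M q G Y Z" and caus: "ded_causal M \<Phi> G Y Z U"
    and q: "\<And>t. q t \<in> {0..1}"
    and \<Phi>: "\<And>t. case_prod (\<Phi> t) \<in> measurable
              (count_space {x. length x = t} \<Otimes>\<^sub>M restrict_space borel {0..1}) (count_space UNIV)"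
    and \<kappa>: "\<And>x g. \<kappa> x g = measure lborel {u \<in> {0..1}. \<Phi> (length x) x u = g}"
  shows "length x = t \<Longrightarrow>
    measure M {\<omega> \<in> space M. obs G Y t \<omega> = x \<and> (\<forall>s\<in>{t..<t + m}. Z s \<omega> = z s)}
      = path_prob \<kappa> q x * (\<Prod>s\<in>{t..<t + m}. if z s then q s else 1 - q s)"
proof -
  let ?N = "PiM UNIV (\<lambda>_. count_space UNIV) \<Otimes>\<^sub>M count_space UNIV :: ((nat \<Rightarrow> bool) \<times> (bool \<times> bool) list) measure"
  interpret prob_space M by fact
  have Zm [measurable]: "Z t \<in> measurable M (count_space UNIV)"
    and Z_indep: "indep_sets (\<lambda>i. {Z i -` A \<inter> space M | A. A \<in> sets (count_space UNIV)}) UNIV"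
    and Z_distr: "distr M (count_space UNIV) (Z t) = measure_pmf (bernoulli_pmf (q t))"
    and Y_AE: "AE \<omega> in M. Y t \<omega> \<longleftrightarrow> G t \<omega> \<and> Z t \<omega>" for t
    using obs by (auto simp: ded_observation_def indep_vars_def2)
  have U_distr: "distr M borel (U t) = uniform_measure lborel {0..1}"
    and G_AE: "AE \<omega> in M. G t \<omega> = \<Phi> t (obs G Y t \<omega>) (U t \<omega>)"
    and U_m [measurable]: "U t \<in> borel_measurable M"
    and ZO_m: "(\<lambda>\<omega>. (\<lambda>s. Z s \<omega>, obs G Y t \<omega>)) \<in> measurable M ?N"
    and U_indep: "indep_set {U t -` A \<inter> space M | A. A \<in> sets borel}
       {(\<lambda>\<omega>. (\<lambda>s. Z s \<omega>, obs G Y t \<omega>)) -` A \<inter> space M | A. A \<in> sets ?N}" for t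
    using caus by (auto simp: ded_causal_def indep_rv_def)
  have obs_m [measurable]: "obs G Y t \<in> measurable M (count_space UNIV)" for t
    using measurable_compose[OF ZO_m measurable_snd] by simp
  have Z_prob: "prob {\<omega> \<in> space M. Z t \<omega> = b} = (if b then q t else 1 - q t)" for t b
  proof -
    have "prob {\<omega> \<in> space M. Z t \<omega> = b} = measure (distr M (count_space UNIV) (Z t)) {b}"
      by (subst measure_distr) (auto intro!: arg_cong[where f=prob])
    also have "\<dots> = (if b then q t else 1 - q t)"
      unfolding Z_distr using q[of t] by (cases b) (auto simp: measure_pmf_single)
    finally show ?thesis .
  qed
  have U_AE: "AE \<omega> in M. U t \<omega> \<in> {0..1}" for t
  proof -
    have "AE u in distr M borel (U t). u \<in> {0..1}"
      unfolding U_distr by (rule AE_uniform_measureI) auto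
    then show ?thesis by (subst (asm) AE_distr_iff) auto
  qed
  show "length x = t \<Longrightarrow>
    prob {\<omega> \<in> space M. obs G Y t \<omega> = x \<and> (\<forall>s\<in>{t..<t + m}. Z s \<omega> = z s)}
      = path_prob \<kappa> q x * (\<Prod>s\<in>{t..<t + m}. if z s then q s else 1 - q s)"
  proof (induction t arbitrary: x m z)
    case 0
    show ?case
    \<comment> \<open>The product rule for independent events asks for a nonempty index set.\<close>
    proof (cases "m = 0")
      case True
      then show ?thesis using 0 by (simp add: obs_def prob_space)
    next
      case False
      have "prob {\<omega> \<in> space M. \<forall>s\<in>{0..<m}. Z s \<omega> = z s} = prob (\<Inter>s\<in>{0..<m}. {\<omega> \<in> space M. Z s \<omega> = z s})"
        using False by (intro arg_cong[where f=prob]) auto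
      also have "\<dots> = (\<Prod>s\<in>{0..<m}. prob {\<omega> \<in> space M. Z s \<omega> = z s})"
      proof (rule indep_setsD[OF Z_indep])
        have "{\<omega> \<in> space M. Z s \<omega> = z s} = Z s -` {z s} \<inter> space M" for s by auto
        then show "\<forall>s\<in>{0..<m}. {\<omega> \<in> space M. Z s \<omega> = z s} \<in> {Z s -` A \<inter> space M | A. A \<in> sets (count_space UNIV)}"
          by auto
      qed (use False in auto)
      finally show ?thesis using 0 by (simp add: obs_def Z_prob)
    qed
  next
    case (Suc t)
    obtain x' g y where x: "x = x' @ [(g, y)]" and len: "length x' = t"
      using Suc.prems by (metis length_Suc_conv_rev surj_pair)
    let ?I = "{Suc t..<Suc t + m}"
    let ?b = "\<lambda>s. if z s then q s else 1 - q s"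
    \<comment> \<open>Up to a null set, the event for \<open>Suc t\<close> is the intersection of
      \<open>A\<close>, which concerns only \<open>U t\<close>, and \<open>B\<close>, which concerns
      only \<open>Z\<close> and the observations before t. Causality makes these two independent,
      although \<open>Z\<close> and the past need not be.\<close>
    define S where "S = {u \<in> {0..1}. \<Phi> t x' u = g}"
    define A where "A = U t -` S \<inter> space M"
    define C where "C = {p :: (nat \<Rightarrow> bool) \<times> (bool \<times> bool) list. snd p = x' \<and> (y \<longleftrightarrow> g \<and> fst p t) \<and> (\<forall>s\<in>?I. fst p s = z s)}"
    define B where "B = {\<omega> \<in> space M. obs G Y t \<omega> = x' \<and> (y \<longleftrightarrow> g \<and> Z t \<omega>) \<and> (\<forall>s\<in>?I. Z s \<omega> = z s)}"
    have "\<Phi> t x' \<in> measurable (restrict_space borel {0..1}) (count_space UNIV)"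
      using measurable_compose[OF measurable_Pair1' \<Phi>[of t], of x'] len by simp
    from measurable_sets[OF this, of "{g}"] have S: "S \<in> sets borel"
      by (auto simp: S_def sets_restrict_space_iff vimage_def Int_def conj_commute space_restrict_space)
    have C: "C \<in> sets ?N"
    proof -
      have "Measurable.pred ?N
         (\<lambda>p :: (nat \<Rightarrow> bool) \<times> (bool \<times> bool) list. snd p = x' \<and> (y \<longleftrightarrow> g \<and> fst p t) \<and> (\<forall>s\<in>?I. fst p s = z s))"
        by measurable
      then show ?thesis unfolding C_def by (simp add: pred_def space_pair_measure space_PiM)
    qed
    have "B = (\<lambda>\<omega>. (\<lambda>s. Z s \<omega>, obs G Y t \<omega>)) -` C \<inter> space M"
      by (auto simp: B_def C_def)
    then have AB: "prob (A \<inter> B) = prob A * prob B"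
      using S C by (intro indep_setD[OF U_indep[of t]]) (auto simp: A_def)
    have "prob {\<omega> \<in> space M. obs G Y (Suc t) \<omega> = x \<and> (\<forall>s\<in>?I. Z s \<omega> = z s)} = prob (A \<inter> B)"
    proof (rule measure_eq_AE)
      show "AE \<omega> in M. \<omega> \<in> {\<omega> \<in> space M. obs G Y (Suc t) \<omega> = x \<and> (\<forall>s\<in>?I. Z s \<omega> = z s)} \<longleftrightarrow> \<omega> \<in> A \<inter> B"
        using Y_AE[of t] G_AE[of t] U_AE[of t] by eventually_elim (auto simp: A_def B_def S_def x obs_def)
      show "{\<omega> \<in> space M. obs G Y (Suc t) \<omega> = x \<and> (\<forall>s\<in>?I. Z s \<omega> = z s)} \<in> sets M"
        by measurable
      show "A \<inter> B \<in> sets M"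
        unfolding A_def B_def using measurable_sets[OF U_m S] by measurable
    qed
    also note AB
    also have "prob A = \<kappa> x' g"
    proof -
      have "prob A = measure (distr M borel (U t)) S"
        by (simp add: measure_distr S A_def)
      also have "\<dots> = measure lborel S"
      proof -
        have "{0..1} \<inter> S = S" by (auto simp: S_def)
        then show ?thesis using S unfolding U_distr by (subst measure_uniform_measure) auto
      qed
      finally show ?thesis by (simp add: \<kappa> S_def len)
    qed
    also have "prob B = path_prob \<kappa> q x' * (obs_prob (q t) (g, y) * (\<Prod>s\<in>?I. ?b s))"
    proof -
      \<comment> \<open>The induction hypothesis with one more future value also prescribes
        \<open>Z t\<close>; this is where the fresh Bernoulli factor arises.\<close>
      have IH: "prob {\<omega> \<in> space M. obs G Y t \<omega> = x' \<and> Z t \<omega> = c \<and> (\<forall>s\<in>?I. Z s \<omega> = z s)}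
          = path_prob \<kappa> q x' * ((if c then q t else 1 - q t) * (\<Prod>s\<in>?I. ?b s))" for c
      proof -
        have eq: "{t..<t + Suc m} = insert t ?I" by auto
        have "(\<Prod>s\<in>?I. if (z(t := c)) s then q s else 1 - q s) = (\<Prod>s\<in>?I. ?b s)"
          by (intro prod.cong) auto
        moreover have "{\<omega> \<in> space M. obs G Y t \<omega> = x' \<and> (\<forall>s\<in>{t..<t + Suc m}. Z s \<omega> = (z(t := c)) s)}
          = {\<omega> \<in> space M. obs G Y t \<omega> = x' \<and> Z t \<omega> = c \<and> (\<forall>s\<in>?I. Z s \<omega> = z s)}"
          unfolding eq by auto
        ultimately show ?thesis
          using Suc.IH[OF len, of "Suc m" "z(t := c)"] unfolding eq by simp
      qed
      show ?thesis
      proof (cases g)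
        case True
        then have "B = {\<omega> \<in> space M. obs G Y t \<omega> = x' \<and> Z t \<omega> = y \<and> (\<forall>s\<in>?I. Z s \<omega> = z s)}"
          by (auto simp: B_def)
        then show ?thesis using IH[of y] True by (simp add: obs_prob_def)
      next
        case False
        show ?thesis
        proof (cases y)
          case True
          with False have "B = {}" by (auto simp: B_def)
          then show ?thesis using True False by (simp add: obs_prob_def)
        next
          \<comment> \<open>A closed gate hides \<open>Z t\<close>: both of its values lead to the
            same observation, and their weights add up to 1.\<close>
          case y: False
          define R where "R = (\<Prod>s\<in>?I. ?b s)"
          define B1 where "B1 c = {\<omega> \<in> space M. obs G Y t \<omega> = x' \<and> Z t \<omega> = c \<and> (\<forall>s\<in>?I. Z s \<omega> = z s)}" for c
          have IH': "prob (B1 c) = path_prob \<kappa> q x' * ((if c then q t else 1 - q t) * R)" for c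
            unfolding B1_def R_def by (rule IH)
          have "B1 c \<in> sets M" for c
            unfolding B1_def by measurable
          moreover have "B1 True \<inter> B1 False = {}"
            by (auto simp: B1_def)
          ultimately have "prob (B1 True \<union> B1 False) = prob (B1 True) + prob (B1 False)"
            by (intro finite_measure_Union) auto
          moreover have "B = B1 True \<union> B1 False"
            using y False by (auto simp: B_def B1_def)
          ultimately have "prob B = path_prob \<kappa> q x' * (q t * R) + path_prob \<kappa> q x' * ((1 - q t) * R)"
            by (simp only: IH' if_True if_False)
          also have "\<dots> = path_prob \<kappa> q x' * (\<Prod>s\<in>?I. ?b s)"
            unfolding R_def[symmetric] by algebra
          finally show ?thesis using y False by (simp add: obs_prob_def)
        qed
      qed
    qed
    finally show ?case by (simp add: x len mult_ac)
  qed
qed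

text \<open>One kernel serves every \<theta> \<in> \<Theta> because the gating maps are common to
  all parameters; the parameter enters the path probability through \<open>p\<close> alone.\<close>

lemma ded_path_law:
  assumes ded: "ded_process K D \<Theta> p \<gamma> P G Y"
  obtains \<kappa> where "\<And>x. \<kappa> x True + \<kappa> x False = 1" "\<And>x g. \<kappa> x g \<ge> 0"
    "\<And>\<theta> x. \<theta> \<in> \<Theta> \<Longrightarrow> measure (obs_law P G Y \<theta> (length x)) {x} = path_prob \<kappa> (\<lambda>t. p t \<theta>) x"
    "\<And>\<theta> T. \<theta> \<in> \<Theta> \<Longrightarrow> obs G Y T \<in> measurable (P \<theta>) (count_space UNIV)"
proof -
  obtain \<Phi> where \<Phi>: "\<And>t. case_prod (\<Phi> t) \<in> measurable
              (count_space {x. length x = t} \<Otimes>\<^sub>M restrict_space borel {0..1}) (count_space UNIV)"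
    and ZU: "\<And>\<theta>. \<theta> \<in> \<Theta> \<Longrightarrow> \<exists>Z U. ded_observation (P \<theta>) (\<lambda>t. p t \<theta>) G Y Z \<and> ded_causal (P \<theta>) \<Phi> G Y Z U"
    using ded unfolding ded_process_def by blast
  define \<kappa> where "\<kappa> x g = measure lborel {u \<in> {0..1}. \<Phi> (length x) x u = g}" for x g
  have om: "obs G Y T \<in> measurable (P \<theta>) (count_space UNIV)" if "\<theta> \<in> \<Theta>" for \<theta> T
  proof -
    obtain Z U where "ded_causal (P \<theta>) \<Phi> G Y Z U" using ZU[OF \<open>\<theta> \<in> \<Theta>\<close>] by blast
    then have "(\<lambda>\<omega>. (\<lambda>s. Z s \<omega>, obs G Y T \<omega>)) \<in> measurable (P \<theta>) (PiM UNIV (\<lambda>_. count_space UNIV) \<Otimes>\<^sub>M count_space UNIV)"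
      by (auto simp: ded_causal_def indep_rv_def)
    from measurable_compose[OF this measurable_snd] show ?thesis by simp
  qed
  show thesis
  proof (rule that[of \<kappa>])
    fix x :: "(bool \<times> bool) list"
    have "\<Phi> (length x) x \<in> measurable (restrict_space borel {0..1}) (count_space UNIV)"
      using measurable_compose[OF measurable_Pair1' \<Phi>[of "length x"], of x] by simp
    from measurable_sets[OF this, of "{_}"] have S: "{u \<in> {0..1}. \<Phi> (length x) x u = g} \<in> sets borel" for g
      by (auto simp: sets_restrict_space_iff vimage_def Int_def conj_commute space_restrict_space)
    have fin: "emeasure lborel {u \<in> {0..1}. \<Phi> (length x) x u = g} \<noteq> \<infinity>" for g
    proof -
      have "emeasure lborel {u \<in> {0..1}. \<Phi> (length x) x u = g} \<le> emeasure lborel {0..1::real}"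
        by (rule emeasure_mono) auto
      then show ?thesis by (auto simp: top_unique)
    qed
    have "\<kappa> x True + \<kappa> x False = measure lborel ({u \<in> {0..1}. \<Phi> (length x) x u = True} \<union> {u \<in> {0..1}. \<Phi> (length x) x u = False})"
      unfolding \<kappa>_def by (subst measure_Union) (use S[of True] S[of False] fin[of True] fin[of False] in auto)
    also have "{u \<in> {0..1}. \<Phi> (length x) x u = True} \<union> {u \<in> {0..1}. \<Phi> (length x) x u = False} = {0..1}"
      by auto
    finally show "\<kappa> x True + \<kappa> x False = 1" by simp
  next
    fix \<theta> :: "real^'a" and x :: "(bool \<times> bool) list" assume \<theta>: "\<theta> \<in> \<Theta>"
    obtain Z U where "ded_observation (P \<theta>) (\<lambda>t. p t \<theta>) G Y Z" "ded_causal (P \<theta>) \<Phi> G Y Z U"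
      using ZU[OF \<theta>] by blast
    from ded_joint_law[OF _ _ _ this _ \<Phi> \<kappa>_def, of x "length x" 0] ded \<theta>
    have "measure (P \<theta>) {\<omega> \<in> space (P \<theta>). obs G Y (length x) \<omega> = x} = path_prob \<kappa> (\<lambda>t. p t \<theta>) x"
      unfolding ded_process_def by simp
    moreover have "obs G Y (length x) -` {x} \<inter> space (P \<theta>) = {\<omega> \<in> space (P \<theta>). obs G Y (length x) \<omega> = x}"
      by auto
    ultimately show "measure (obs_law P G Y \<theta> (length x)) {x} = path_prob \<kappa> (\<lambda>t. p t \<theta>) x"
      unfolding obs_law_def by (subst measure_distr) (use om[OF \<theta>] in auto)
  qed (simp_all add: \<kappa>_def om)
qed

section \<open>Sums, moments and likelihood ratios over finite paths\<close>

lemma finite_obs_lists [simp]: "finite {x :: (bool \<times> bool) list. length x = T}"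
  using finite_lists_length_eq[of "UNIV :: (bool \<times> bool) set" T] by simp

lemma sum_obs_snoc:
  fixes f :: "(bool \<times> bool) list \<Rightarrow> 'a::comm_monoid_add"
  shows "(\<Sum>x | length x = Suc T. f x) = (\<Sum>x | length x = T. \<Sum>g\<in>UNIV. \<Sum>y\<in>UNIV. f (x @ [(g, y)]))"
proof -
  have "(\<Sum>x | length x = Suc T. f x) = (\<Sum>p\<in>{x. length x = T} \<times> UNIV. f (fst p @ [snd p]))"
    by (rule sum.reindex_bij_witness[where i="\<lambda>p. fst p @ [snd p]" and j="\<lambda>x. (butlast x, last x)"])
      (auto simp: length_Suc_conv_rev)
  also have "\<dots> = (\<Sum>x | length x = T. \<Sum>z\<in>UNIV. f (x @ [z]))"
    by (simp add: sum.cartesian_product case_prod_beta)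
  also have "\<dots> = (\<Sum>x | length x = T. \<Sum>g\<in>UNIV. \<Sum>y\<in>UNIV. f (x @ [(g, y)]))"
    unfolding UNIV_Times_UNIV[symmetric] sum.cartesian_product by (simp add: case_prod_beta)
  finally show ?thesis .
qed

text \<open>A finitely supported law on lists, which turns every expectation into a finite sum over
  paths. That the masses add up to one is \<open>sum_path_prob\<close>, for kernels as in
  \<open>path_kernel\<close>.\<close>

definition path_law :: "((bool \<times> bool) list \<Rightarrow> bool \<Rightarrow> real) \<Rightarrow> (nat \<Rightarrow> real) \<Rightarrow> nat \<Rightarrow> (bool \<times> bool) list pmf"
  where "path_law \<kappa> q T = embed_pmf (\<lambda>x. if length x = T then path_prob \<kappa> q x else 0)"

locale path_kernel =
  fixes \<kappa> :: "(bool \<times> bool) list \<Rightarrow> bool \<Rightarrow> real"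
  assumes kernel_sum: "\<kappa> x True + \<kappa> x False = 1" and kernel_nonneg: "\<kappa> x g \<ge> 0"
begin

lemma path_prob_nonneg:
  assumes "\<And>t. q t \<in> {0..1}"
  shows "path_prob \<kappa> q x \<ge> 0"
  unfolding path_prob_def using assms
  by (intro prod_nonneg ballI mult_nonneg_nonneg kernel_nonneg) (auto simp: obs_prob_def)

text \<open>Factors with conditional mean one, given the past and the current gate, form a
  multiplicative martingale: averaging out the last observation removes the last factor. The case
  \<open>v\<close> = 1 normalises the path law; complex factors give the exponential
  martingale.\<close>

lemma sum_path_prob_prod:
  fixes v :: "nat \<Rightarrow> bool \<times> bool \<Rightarrow> 'a::real_normed_field"
  assumes "\<And>t g. t < T \<Longrightarrow> (\<Sum>y\<in>UNIV. of_real (obs_prob (q t) (g, y)) * v t (g, y)) = 1"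
  shows "(\<Sum>x | length x = T. of_real (path_prob \<kappa> q x) * (\<Prod>t<T. v t (x ! t))) = 1"
  using assms
proof (induction T)
  case (Suc T)
  have "(\<Sum>g\<in>UNIV. \<Sum>y\<in>UNIV. of_real (path_prob \<kappa> q (x @ [(g, y)])) * (\<Prod>t<Suc T. v t ((x @ [(g, y)]) ! t)))
      = of_real (path_prob \<kappa> q x) * (\<Prod>t<T. v t (x ! t))" (is "?L = ?c * ?p") if x: "length x = T" for x
  proof -
    have "(\<Prod>t<Suc T. v t ((x @ [z]) ! t)) = ?p * v T z" for z
      using x by (simp add: nth_append)
    then have "?L = (\<Sum>g\<in>UNIV. ?c * ?p * of_real (\<kappa> x g) * (\<Sum>y\<in>UNIV. of_real (obs_prob (q T) (g, y)) * v T (g, y)))"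
      using x by (simp only: path_prob_snoc sum_distrib_left) (simp add: mult_ac)
    also have "\<dots> = ?c * ?p * of_real (\<kappa> x True + \<kappa> x False)"
      using Suc.prems[of T] by (simp add: UNIV_bool ring_distribs)
    finally show ?thesis by (simp add: kernel_sum)
  qed
  then show ?case using Suc by (simp add: sum_obs_snoc)
qed simp

lemma sum_path_prob: "(\<Sum>x | length x = T. path_prob \<kappa> q x) = 1"
  using sum_path_prob_prod[where v="\<lambda>_ _. 1::real" and q=q and T=T]
  by (simp add: obs_prob_def UNIV_bool)

context
  fixes q :: "nat \<Rightarrow> real"
  assumes q: "\<And>t. q t \<in> {0..1}"
begin

lemma pmf_path_law: "pmf (path_law \<kappa> q T) x = (if length x = T then path_prob \<kappa> q x else 0)"
  unfolding path_law_def
proof (rule pmf_embed_pmf)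
  have "(\<integral>\<^sup>+x. ennreal (if length x = T then path_prob \<kappa> q x else 0) \<partial>count_space UNIV)
      = (\<Sum>x | length x = T. ennreal (if length x = T then path_prob \<kappa> q x else 0))"
    by (rule nn_integral_count_space') auto
  also have "\<dots> = ennreal (\<Sum>x | length x = T. path_prob \<kappa> q x)"
    using q by (subst sum_ennreal[symmetric]) (auto intro: path_prob_nonneg)
  finally show "(\<integral>\<^sup>+x. ennreal (if length x = T then path_prob \<kappa> q x else 0) \<partial>count_space UNIV) = 1"
    by (simp add: sum_path_prob)
qed (use q in \<open>auto intro: path_prob_nonneg\<close>)

lemma set_path_law: "x \<in> set_pmf (path_law \<kappa> q T) \<longleftrightarrow> length x = T \<and> path_prob \<kappa> q x \<noteq> 0"
  by (simp add: set_pmf_iff pmf_path_law)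

lemma finite_set_path_law: "finite (set_pmf (path_law \<kappa> q T))"
  by (rule finite_subset[OF _ finite_obs_lists[of T]]) (auto simp: set_path_law)

lemma integrable_path_law:
  fixes f :: "_ \<Rightarrow> 'b::{banach, second_countable_topology}"
  shows "integrable (measure_pmf (path_law \<kappa> q T)) f"
  by (rule integrable_measure_pmf_finite[OF finite_set_path_law])

lemma expectation_path_law:
  fixes f :: "_ \<Rightarrow> 'b::{banach, second_countable_topology}"
  shows "measure_pmf.expectation (path_law \<kappa> q T) f = (\<Sum>x | length x = T. path_prob \<kappa> q x *\<^sub>R f x)"
proof -
  have "measure_pmf.expectation (path_law \<kappa> q T) f = (\<Sum>x | length x = T. pmf (path_law \<kappa> q T) x *\<^sub>R f x)"
    by (rule integral_measure_pmf) (auto simp: set_path_law)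
  then show ?thesis by (simp add: pmf_path_law)
qed

lemma prob_path_law:
  "measure_pmf.prob (path_law \<kappa> q T) A = (\<Sum>x\<in>{x. length x = T} \<inter> A. path_prob \<kappa> q x)"
proof -
  have "measure_pmf.prob (path_law \<kappa> q T) A = measure_pmf.expectation (path_law \<kappa> q T) (indicator A)"
    by simp
  also have "\<dots> = (\<Sum>x | length x = T. path_prob \<kappa> q x *\<^sub>R indicator A x)"
    by (rule expectation_path_law)
  also have "\<dots> = (\<Sum>x\<in>{x. length x = T} \<inter> A. path_prob \<kappa> q x)"
    by (rule sum.mono_neutral_cong_right) (auto simp: indicator_def)
  finally show ?thesis .
qed

text \<open>The hypothesis is the mean-one condition for an open gate; a closed gate contributes exp
  0 = 1 by itself.\<close>

lemma exponential_martingale: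
  fixes \<alpha> \<beta> :: "nat \<Rightarrow> complex"
  assumes "\<And>t. t < T \<Longrightarrow> q t * exp (\<alpha> t) + (1 - q t) * exp (\<beta> t) = 1"
  shows "measure_pmf.expectation (path_law \<kappa> q T)
     (\<lambda>x. exp (\<Sum>t<T. of_bool (fst (x ! t)) * (if snd (x ! t) then \<alpha> t else \<beta> t))) = 1"
proof -
  have "(\<Sum>y\<in>UNIV. of_real (obs_prob (q t) (g, y)) * exp (of_bool g * (if y then \<alpha> t else \<beta> t))) = 1"
    if "t < T" for t g
    using assms[OF that] by (cases g) (simp_all add: UNIV_bool obs_prob_def add.commute)
  then show ?thesis
    using sum_path_prob_prod[where T=T and q=q and v="\<lambda>t z. exp (of_bool (fst z) * (if snd z then \<alpha> t else \<beta> t))"]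
    by (simp only: expectation_path_law exp_sum finite_lessThan scaleR_conv_of_real fst_conv snd_conv)
qed

text \<open>Given the past and the gate, each increment has mean zero, so the cross terms vanish and
  the second moments add. One step contributes at most
  \<open>\<kappa> x True * (q T * (1 - q T)) * (a T)\<^sup>2\<close>, averaged over the
  past.\<close>

lemma martingale_second_moment:
  "measure_pmf.expectation (path_law \<kappa> q T)
     (\<lambda>x. (\<Sum>t<T. a t * of_bool (fst (x ! t)) * (of_bool (snd (x ! t)) - q t))\<^sup>2) \<le> (\<Sum>t<T. (a t)\<^sup>2)"
proof -
  have "(\<Sum>x | length x = T. path_prob \<kappa> q x *
      (\<Sum>t<T. a t * of_bool (fst (x ! t)) * (of_bool (snd (x ! t)) - q t))\<^sup>2) \<le> (\<Sum>t<T. (a t)\<^sup>2)"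
  proof (induction T)
    case (Suc T)
    let ?M = "\<lambda>x. \<Sum>t<T. a t * of_bool (fst (x ! t)) * (of_bool (snd (x ! t)) - q t)"
    have step: "(\<Sum>g\<in>UNIV. \<Sum>y\<in>UNIV. path_prob \<kappa> q (x @ [(g, y)]) *
        (\<Sum>t<Suc T. a t * of_bool (fst ((x @ [(g, y)]) ! t)) * (of_bool (snd ((x @ [(g, y)]) ! t)) - q t))\<^sup>2)
      \<le> path_prob \<kappa> q x * (?M x)\<^sup>2 + path_prob \<kappa> q x * (a T)\<^sup>2" (is "?L \<le> _") if x: "length x = T" for x
    proof -
      let ?c = "path_prob \<kappa> q x"
      have M: "(\<Sum>t<Suc T. a t * of_bool (fst ((x @ [z]) ! t)) * (of_bool (snd ((x @ [z]) ! t)) - q t))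
          = ?M x + a T * of_bool (fst z) * (of_bool (snd z) - q T)" for z
        using x by (simp add: nth_append)
      have "?L = ?c * (\<kappa> x True * q T * (?M x + a T * (1 - q T))\<^sup>2
          + \<kappa> x True * (1 - q T) * (?M x - a T * q T)\<^sup>2 + \<kappa> x False * (?M x)\<^sup>2)"
        unfolding M path_prob_snoc using x by (simp add: UNIV_bool obs_prob_def algebra_simps)
      also have "\<dots> = ?c * ((\<kappa> x True + \<kappa> x False) * (?M x)\<^sup>2 + \<kappa> x True * (q T * (1 - q T)) * (a T)\<^sup>2)"
        by (simp add: power2_eq_square algebra_simps)
      also have "\<dots> \<le> ?c * ((?M x)\<^sup>2 + (a T)\<^sup>2)"
      proof (intro mult_left_mono)
        have "\<kappa> x True \<le> 1" using kernel_sum[of x] kernel_nonneg[of x False] by linarith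
        moreover have "q T * (1 - q T) \<le> 1" "0 \<le> q T * (1 - q T)"
          using q[of T] by (auto intro: mult_le_one)
        ultimately have "\<kappa> x True * (q T * (1 - q T)) \<le> 1"
          by (simp add: mult_le_one)
        then have "\<kappa> x True * (q T * (1 - q T)) * (a T)\<^sup>2 \<le> 1 * (a T)\<^sup>2"
          by (intro mult_right_mono) auto
        then show "(\<kappa> x True + \<kappa> x False) * (?M x)\<^sup>2 + \<kappa> x True * (q T * (1 - q T)) * (a T)\<^sup>2 \<le> (?M x)\<^sup>2 + (a T)\<^sup>2"
          by (simp add: kernel_sum)
      qed (use q in \<open>auto intro: path_prob_nonneg\<close>)
      finally show ?thesis by (simp add: ring_distribs)
    qed
    have "(\<Sum>x | length x = Suc T. path_prob \<kappa> q x *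
        (\<Sum>t<Suc T. a t * of_bool (fst (x ! t)) * (of_bool (snd (x ! t)) - q t))\<^sup>2)
      \<le> (\<Sum>x | length x = T. path_prob \<kappa> q x * (?M x)\<^sup>2 + path_prob \<kappa> q x * (a T)\<^sup>2)"
      unfolding sum_obs_snoc by (rule sum_mono) (rule step, simp)
    also have "\<dots> = (\<Sum>x | length x = T. path_prob \<kappa> q x * (?M x)\<^sup>2) + (a T)\<^sup>2"
      by (simp add: sum.distrib sum_distrib_right[symmetric] sum_path_prob)
    also have "\<dots> \<le> (\<Sum>t<Suc T. (a t)\<^sup>2)" using Suc by simp
    finally show ?case .
  qed simp
  then show ?thesis by (simp add: expectation_path_law)
qed

end

text \<open>The kernel is common to both laws, so an open gate multiplies the sum by q1^2 / q0 + (1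
  - q1)^2 / (1 - q0), which is 1 plus the chi-square divergence of the two Bernoulli laws; a closed
  gate multiplies it by 1.\<close>

lemma sum_likelihood_ratio:
  assumes q1: "\<And>t. q1 t \<in> {0..1}" and q0: "\<And>t. 0 < q0 t \<and> q0 t < 1"
    and s: "\<And>t. (q1 t - q0 t)\<^sup>2 / (q0 t * (1 - q0 t)) \<le> s"
  shows "(\<Sum>x | length x = T. (path_prob \<kappa> q1 x)\<^sup>2 / path_prob \<kappa> q0 x) \<le> (1 + s) ^ T"
proof (induction T)
  case (Suc T)
  have "s \<ge> 0" using s[of 0] q0[of 0] by (meson divide_nonneg_pos mult_pos_pos diff_gt_0_iff_gt order_trans zero_le_power2)
  have step: "(\<Sum>g\<in>UNIV. \<Sum>y\<in>UNIV. (path_prob \<kappa> q1 (x @ [(g, y)]))\<^sup>2 / path_prob \<kappa> q0 (x @ [(g, y)]))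
      \<le> (path_prob \<kappa> q1 x)\<^sup>2 / path_prob \<kappa> q0 x * (1 + s)" (is "?L \<le> ?c * _") if x: "length x = T" for x
  proof -
    have "(q1 T)\<^sup>2 / q0 T + (1 - q1 T)\<^sup>2 / (1 - q0 T) = 1 + (q1 T - q0 T)\<^sup>2 / (q0 T * (1 - q0 T))"
      using q0[of T] by (simp add: field_simps power2_eq_square)
    then have le: "(q1 T)\<^sup>2 / q0 T + (1 - q1 T)\<^sup>2 / (1 - q0 T) \<le> 1 + s"
      using s[of T] by simp
    \<comment> \<open>True also for a kernel value of 0, since 0 / 0 = 0; impossible paths
      contribute nothing.\<close>
    have k: "(\<kappa> x g)\<^sup>2 / \<kappa> x g = \<kappa> x g" for g by (simp add: power2_eq_square)
    have "?L = (\<Sum>g\<in>UNIV. \<Sum>y\<in>UNIV. ?c * ((\<kappa> x g)\<^sup>2 / \<kappa> x g * ((obs_prob (q1 T) (g, y))\<^sup>2 / obs_prob (q0 T) (g, y))))"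
      using x by (simp add: power_mult_distrib)
    also have "\<dots> = ?c * (\<kappa> x True * ((q1 T)\<^sup>2 / q0 T + (1 - q1 T)\<^sup>2 / (1 - q0 T)) + \<kappa> x False)"
      unfolding k by (simp add: UNIV_bool obs_prob_def algebra_simps)
    also have "\<dots> \<le> ?c * (\<kappa> x True * (1 + s) + \<kappa> x False * (1 + s))"
    proof (rule mult_left_mono[OF add_mono[OF mult_left_mono[OF le kernel_nonneg]]])
      show "\<kappa> x False \<le> \<kappa> x False * (1 + s)" using \<open>s \<ge> 0\<close> kernel_nonneg[of x False] by (simp add: ring_distribs)
      show "?c \<ge> 0" using q0 less_imp_le by (intro divide_nonneg_nonneg path_prob_nonneg) auto
    qed
    also have "\<dots> = ?c * (1 + s)"
      using kernel_sum[of x] by (simp add: distrib_right[symmetric])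
    finally show ?thesis .
  qed
  have "(\<Sum>x | length x = Suc T. (path_prob \<kappa> q1 x)\<^sup>2 / path_prob \<kappa> q0 x)
    \<le> (\<Sum>x | length x = T. (path_prob \<kappa> q1 x)\<^sup>2 / path_prob \<kappa> q0 x * (1 + s))"
    unfolding sum_obs_snoc by (rule sum_mono) (rule step, simp)
  also have "\<dots> \<le> (1 + s) ^ T * (1 + s)"
    unfolding sum_distrib_right[symmetric] using Suc \<open>s \<ge> 0\<close> by (intro mult_right_mono) auto
  finally show ?case by (simp add: mult.commute)
qed simp

text \<open>Cauchy-Schwarz on \<open>A\<close>, with each path probability P1 under
  \<open>q1\<close> written as (P1 / sqrt P0) * sqrt P0, where P0 is the one under
  \<open>q0\<close>.\<close>

lemma path_law_contiguity:
  assumes q1: "\<And>t. q1 t \<in> {0..1}" and q0: "\<And>t. 0 < q0 t \<and> q0 t < 1"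
    and s: "\<And>t. (q1 t - q0 t)\<^sup>2 / (q0 t * (1 - q0 t)) \<le> s"
  shows "(measure_pmf.prob (path_law \<kappa> q1 T) A)\<^sup>2 \<le> (1 + s) ^ T * measure_pmf.prob (path_law \<kappa> q0 T) A"
proof -
  have q0': "q0 t \<in> {0..1}" for t using q0[of t] by auto
  let ?A = "{x. length x = T} \<inter> A"
  \<comment> \<open>As \<open>q0\<close> lies strictly between 0 and 1, a path of probability zero
    owes this to the kernel or to an event behind a closed gate, and both are shared with
    \<open>q1\<close>.\<close>
  have zero: "path_prob \<kappa> q1 x = 0" if z: "path_prob \<kappa> q0 x = 0" for x
  proof -
    obtain t where "t < length x" "\<kappa> (take t x) (fst (x ! t)) * obs_prob (q0 t) (x ! t) = 0"
      using z unfolding path_prob_def prod_zero_iff[OF finite_lessThan] by blast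
    then have "\<kappa> (take t x) (fst (x ! t)) * obs_prob (q1 t) (x ! t) = 0"
      using q0[of t] by (auto simp: obs_prob_def split: if_splits)
    then show ?thesis using \<open>t < length x\<close> by (auto simp: path_prob_def)
  qed
  have nn: "path_prob \<kappa> q0 x \<ge> 0" for x by (rule path_prob_nonneg[OF q0'])
  have "(measure_pmf.prob (path_law \<kappa> q1 T) A)\<^sup>2
      = (\<Sum>x\<in>?A. (path_prob \<kappa> q1 x / sqrt (path_prob \<kappa> q0 x)) * sqrt (path_prob \<kappa> q0 x))\<^sup>2"
    unfolding prob_path_law[OF q1] using zero by (intro arg_cong[where f="\<lambda>u. u\<^sup>2"] sum.cong) auto
  also have "\<dots> \<le> (\<Sum>x\<in>?A. (path_prob \<kappa> q1 x / sqrt (path_prob \<kappa> q0 x))\<^sup>2) * (\<Sum>x\<in>?A. (sqrt (path_prob \<kappa> q0 x))\<^sup>2)"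
    by (rule Cauchy_Schwarz_ineq_sum)
  also have "\<dots> = (\<Sum>x\<in>?A. (path_prob \<kappa> q1 x)\<^sup>2 / path_prob \<kappa> q0 x) * measure_pmf.prob (path_law \<kappa> q0 T) A"
    by (simp add: prob_path_law[OF q0'] power_divide nn)
  also have "\<dots> \<le> (1 + s) ^ T * measure_pmf.prob (path_law \<kappa> q0 T) A"
  proof (rule mult_right_mono)
    have "(\<Sum>x\<in>?A. (path_prob \<kappa> q1 x)\<^sup>2 / path_prob \<kappa> q0 x) \<le> (\<Sum>x | length x = T. (path_prob \<kappa> q1 x)\<^sup>2 / path_prob \<kappa> q0 x)"
      by (rule sum_mono2) (auto intro!: divide_nonneg_nonneg nn)
    also have "\<dots> \<le> (1 + s) ^ T" by (rule sum_likelihood_ratio[OF q1 q0 s])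
    finally show "(\<Sum>x\<in>?A. (path_prob \<kappa> q1 x)\<^sup>2 / path_prob \<kappa> q0 x) \<le> (1 + s) ^ T" .
  qed simp
  finally show ?thesis .
qed

end

section \<open>Limit theorems for the counts\<close>

lemma prob_tendsto_zero_mono:
  assumes "(\<lambda>n. measure_pmf.prob (Q n) (A n)) \<longlonglongrightarrow> 0"
    and "\<forall>\<^sub>F n in sequentially. B n \<inter> set_pmf (Q n) \<subseteq> A n"
  shows "(\<lambda>n. measure_pmf.prob (Q n) (B n)) \<longlonglongrightarrow> 0"
proof (rule tendsto_sandwich[OF _ _ tendsto_const assms(1)])
  show "\<forall>\<^sub>F n in sequentially. measure_pmf.prob (Q n) (B n) \<le> measure_pmf.prob (Q n) (A n)"
    using assms(2)
  proof eventually_elim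
    case (elim n)
    have "measure_pmf.prob (Q n) (B n) = measure_pmf.prob (Q n) (B n \<inter> set_pmf (Q n))"
      by (simp add: measure_Int_set_pmf)
    also have "\<dots> \<le> measure_pmf.prob (Q n) (A n)"
      using elim by (intro measure_pmf.finite_measure_mono) auto
    finally show ?case .
  qed
qed auto

lemma prob_tendsto_zero_Un:
  assumes "(\<lambda>n. measure_pmf.prob (Q n) (A n)) \<longlonglongrightarrow> 0" "(\<lambda>n. measure_pmf.prob (Q n) (B n)) \<longlonglongrightarrow> 0"
  shows "(\<lambda>n. measure_pmf.prob (Q n) (A n \<union> B n)) \<longlonglongrightarrow> 0"
proof (rule tendsto_sandwich[OF _ _ tendsto_const])
  show "(\<lambda>n. measure_pmf.prob (Q n) (A n) + measure_pmf.prob (Q n) (B n)) \<longlonglongrightarrow> 0"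
    using tendsto_add[OF assms] by simp
qed (auto intro!: always_eventually measure_Un_le)

lemma prob_tendsto_zero_UN:
  assumes "finite I" "\<And>i. i \<in> I \<Longrightarrow> (\<lambda>n. measure_pmf.prob (Q n) (A n i)) \<longlonglongrightarrow> 0"
  shows "(\<lambda>n. measure_pmf.prob (Q n) (\<Union>i\<in>I. A n i)) \<longlonglongrightarrow> 0"
  using assms by (induction I rule: finite_induct) (auto intro: prob_tendsto_zero_Un)

text \<open>Bounded convergence in probability for laws that change with \<open>n\<close>: values
  above e / 3 cost at most \<open>C'\<close> times their vanishing probability.\<close>

lemma expectation_tendsto_zero:
  fixes f :: "nat \<Rightarrow> 'a \<Rightarrow> 'b::{banach, second_countable_topology}"
  assumes bnd: "\<forall>\<^sub>F n in sequentially. \<forall>x\<in>set_pmf (Q n). norm (f n x) \<le> C"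
    and small: "\<And>e. e > 0 \<Longrightarrow> (\<lambda>n. measure_pmf.prob (Q n) {x. norm (f n x) > e}) \<longlonglongrightarrow> 0"
  shows "(\<lambda>n. measure_pmf.expectation (Q n) (f n)) \<longlonglongrightarrow> 0"
proof (rule tendstoI)
  fix e :: real assume "e > 0"
  define C' where "C' = max C 1"
  have "C' > 0" by (simp add: C'_def)
  have "\<forall>\<^sub>F n in sequentially. measure_pmf.prob (Q n) {x. norm (f n x) > e / 3} < e / (3 * C')"
    using small[of "e / 3"] \<open>e > 0\<close> \<open>C' > 0\<close> by (intro order_tendstoD(2)[where y=0]) auto
  with bnd show "\<forall>\<^sub>F n in sequentially. dist (measure_pmf.expectation (Q n) (f n)) 0 < e"
  proof eventually_elim
    case (elim n)
    let ?A = "{x. norm (f n x) > e / 3}"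
    have int: "integrable (measure_pmf (Q n)) (\<lambda>x. norm (f n x))"
      using elim(1) by (intro measure_pmf.integrable_const_bound[where B=C]) (auto simp: AE_measure_pmf_iff)
    have ind: "integrable (measure_pmf (Q n)) (\<lambda>x. C' * indicator ?A x)"
      by (intro measure_pmf.integrable_const_bound[where B="\<bar>C'\<bar>"]) (auto simp: indicator_def)
    have "norm (measure_pmf.expectation (Q n) (f n)) \<le> measure_pmf.expectation (Q n) (\<lambda>x. norm (f n x))"
      by (rule integral_norm_bound)
    also have "\<dots> \<le> measure_pmf.expectation (Q n) (\<lambda>x. e / 3 + C' * indicator ?A x)"
    proof (rule integral_mono_AE[OF int])
      show "integrable (measure_pmf (Q n)) (\<lambda>x. e / 3 + C' * indicator ?A x)"
        by (intro measure_pmf.integrable_const_bound[where B="\<bar>e / 3\<bar> + \<bar>C'\<bar>"]) (auto simp: indicator_def)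
      show "AE x in measure_pmf (Q n). norm (f n x) \<le> e / 3 + C' * indicator ?A x"
        using elim(1) \<open>e > 0\<close> by (auto simp: AE_measure_pmf_iff indicator_def C'_def)
    qed
    also have "\<dots> = e / 3 + C' * measure_pmf.prob (Q n) ?A"
      using ind by (simp add: Bochner_Integration.integral_add)
    also have "C' * measure_pmf.prob (Q n) ?A \<le> C' * (e / (3 * C'))"
      using elim(2) \<open>C' > 0\<close> by (intro mult_left_mono) auto
    also have "e / 3 + C' * (e / (3 * C')) < e"
      using \<open>C' > 0\<close> \<open>e > 0\<close> by (simp add: field_simps)
    finally show ?case by simp
  qed
qed

lemma prob_gt_le_second_moment:
  fixes X :: "'a \<Rightarrow> real"
  assumes "integrable (measure_pmf Q) (\<lambda>x. (X x)\<^sup>2)" "measure_pmf.expectation Q (\<lambda>x. (X x)\<^sup>2) \<le> B" "R > 0"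
  shows "measure_pmf.prob Q {x. \<bar>X x\<bar> > R} \<le> B / R\<^sup>2"
proof -
  have "R\<^sup>2 * measure_pmf.prob Q {x. \<bar>X x\<bar> > R} = measure_pmf.expectation Q (\<lambda>x. R\<^sup>2 * indicator {x. \<bar>X x\<bar> > R} x)"
    by simp
  also have "\<dots> \<le> measure_pmf.expectation Q (\<lambda>x. (X x)\<^sup>2)"
  proof (rule integral_mono[OF _ assms(1)])
    show "integrable (measure_pmf Q) (\<lambda>x. R\<^sup>2 * indicator {x. \<bar>X x\<bar> > R} x)"
      by (intro measure_pmf.integrable_const_bound[where B="R\<^sup>2"]) (auto simp: indicator_def)
    show "R\<^sup>2 * indicator {x. \<bar>X x\<bar> > R} x \<le> (X x)\<^sup>2" for x
      using \<open>R > 0\<close> abs_le_square_iff[of R "X x"] by (auto simp: indicator_def)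
  qed
  also have "\<dots> \<le> B" by fact
  finally show ?thesis using \<open>R > 0\<close> by (simp add: field_simps)
qed

section \<open>Counts per phase and expansions of characteristic functions\<close>

definition gate_count :: "nat \<Rightarrow> nat \<Rightarrow> (bool \<times> bool) list \<Rightarrow> real" where
  "gate_count K r x = (\<Sum>t<length x. of_bool (t mod K = r) * of_bool (fst (x ! t)))"

text \<open>An event counts only when its gate is open, so that \<open>sum_paths_eq_counts\<close>
  holds for every list; on paths of positive probability this is the plain number of events of the
  phase.\<close>

definition event_count :: "nat \<Rightarrow> nat \<Rightarrow> (bool \<times> bool) list \<Rightarrow> real" where
  "event_count K r x = (\<Sum>t<length x. of_bool (t mod K = r) * (of_bool (fst (x ! t)) * of_bool (snd (x ! t))))"

lemma gate_count_bounds: "0 \<le> gate_count K r x" "gate_count K r x \<le> length x"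
  using sum_mono[of "{..<length x}" "\<lambda>t. of_bool (t mod K = r) * of_bool (fst (x ! t))" "\<lambda>_. 1::real"]
  unfolding gate_count_def by (auto intro!: sum_nonneg)

lemma sum_phases:
  fixes f :: "nat \<Rightarrow> nat \<Rightarrow> 'a::comm_ring_1"
  assumes "K \<ge> (1::nat)"
  shows "(\<Sum>t<T. f (t mod K) t) = (\<Sum>r<K. \<Sum>t<T. of_bool (t mod K = r) * f r t)"
proof -
  have "(\<Sum>r<K. of_bool (t mod K = r) * f r t) = f (t mod K) t" for t
  proof -
    have "(\<Sum>r<K. of_bool (t mod K = r) * f r t) = (\<Sum>r<K. if t mod K = r then f r t else 0)"
      by (intro sum.cong) auto
    also have "\<dots> = f (t mod K) t" using assms by (simp add: sum.delta')
    finally show ?thesis .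
  qed
  then show ?thesis by (subst sum.swap) simp
qed

text \<open>The counts are sufficient statistics. The coefficients range over a general field
  because they are logarithms of probabilities in the likelihood and complex exponents in the
  exponential martingale.\<close>

lemma sum_paths_eq_counts:
  fixes \<alpha> \<beta> :: "nat \<Rightarrow> 'a::real_normed_field"
  assumes "K \<ge> 1"
  shows "(\<Sum>t<length x. of_bool (fst (x ! t)) * (if snd (x ! t) then \<alpha> (t mod K) else \<beta> (t mod K)))
    = (\<Sum>r<K. \<alpha> r * of_real (event_count K r x) + \<beta> r * of_real (gate_count K r x - event_count K r x))"
proof -
  have "(\<Sum>t<length x. of_bool (t mod K = r) * (of_bool (fst (x ! t)) * (if snd (x ! t) then \<alpha> r else \<beta> r)))
      = \<alpha> r * of_real (event_count K r x) + \<beta> r * of_real (gate_count K r x - event_count K r x)" for r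
    unfolding gate_count_def event_count_def sum_subtractf[symmetric] of_real_sum sum_distrib_left sum.distrib[symmetric]
    by (intro sum.cong) auto
  then show ?thesis
    by (simp only: sum_phases[OF assms, where f="\<lambda>r t. of_bool (fst (x ! t)) * (if snd (x ! t) then \<alpha> r else \<beta> r)"])
qed

text \<open>Ln has derivative 1 at 1. Caratheodory's slope function turns this into an exact
  identity \<open>Ln z = g z * (z - 1)\<close>, so no error term has to be estimated.\<close>

lemma tendsto_Ln_scaled:
  fixes \<psi> :: "nat \<Rightarrow> complex"
  assumes "(\<lambda>n. of_nat n * (\<psi> n - 1)) \<longlonglongrightarrow> c"
  shows "\<psi> \<longlonglongrightarrow> 1" "(\<lambda>n. of_nat n * Ln (\<psi> n)) \<longlonglongrightarrow> c"
proof -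
  have "(\<lambda>n. of_nat n * (\<psi> n - 1) * inverse (of_nat n)) \<longlonglongrightarrow> c * 0"
    by (intro tendsto_mult assms lim_inverse_n)
  moreover have "\<forall>\<^sub>F n in sequentially. of_nat n * (\<psi> n - 1) * inverse (of_nat n) = \<psi> n - 1"
    using eventually_gt_at_top[of 0] by eventually_elim simp
  ultimately have "(\<lambda>n. \<psi> n - 1) \<longlonglongrightarrow> 0"
    by (auto intro: Lim_transform_eventually)
  then show lim1: "\<psi> \<longlonglongrightarrow> 1" by (simp add: LIM_zero_iff)
  have "(Ln has_field_derivative inverse 1) (at 1)" by (rule has_field_derivative_Ln) simp
  then obtain g where g: "\<And>z. Ln z - Ln 1 = g z * (z - 1)" "isCont g 1" "g 1 = 1"
    unfolding CARAT_DERIV by auto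
  have "(\<lambda>n. g (\<psi> n) * (of_nat n * (\<psi> n - 1))) \<longlonglongrightarrow> g 1 * c"
    by (intro tendsto_mult assms isCont_tendsto_compose[OF g(2)] lim1)
  moreover have "g z * (of_nat n * (z - 1)) = of_nat n * Ln z" for z n
    using g(1)[of z] by simp
  ultimately show "(\<lambda>n. of_nat n * Ln (\<psi> n)) \<longlonglongrightarrow> c" using g(3) by simp
qed

text \<open>Second-order Taylor expansion: the linear terms cancel because the Bernoulli variable is
  centred, the quadratic ones add up to its variance q (1 - q), and n times the cubic remainder is
  at most |a|^3 / sqrt n.\<close>

lemma bernoulli_char_expansion:
  fixes q a :: "nat \<Rightarrow> real"
  assumes q: "q \<longlonglongrightarrow> q'" and a: "a \<longlonglongrightarrow> a'" and q01: "\<And>n. q n \<in> {0..1}"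
  defines "s n \<equiv> a n / sqrt (real n)"
  shows "(\<lambda>n. of_nat n * (q n * iexp (s n * (1 - q n)) + (1 - q n) * iexp (- (s n * q n)) - 1))
    \<longlonglongrightarrow> complex_of_real (- (q' * (1 - q') * a'\<^sup>2 / 2))"
proof -
  define rem where "rem y = iexp y - (1 + \<i> * y - y\<^sup>2 / 2)" for y :: real
  have rem: "cmod (rem y) \<le> \<bar>y\<bar> ^ 3 / 6" for y
    using iexp_approx1[of y 2] by (simp add: rem_def eval_nat_numeral algebra_simps)
  define E where "E n = of_nat n * (q n * rem (s n * (1 - q n)) + (1 - q n) * rem (- (s n * q n)))" for n
  have eq: "of_nat n * (q n * iexp (s n * (1 - q n)) + (1 - q n) * iexp (- (s n * q n)) - 1)
      = complex_of_real (- (q n * (1 - q n) * (real n * (s n)\<^sup>2) / 2)) + E n" for n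
    by (simp add: E_def rem_def power2_eq_square field_simps)
  have ns: "\<forall>\<^sub>F n in sequentially. real n * (s n)\<^sup>2 = (a n)\<^sup>2"
    using eventually_gt_at_top[of 0] by eventually_elim (simp add: s_def power_divide)
  have E0: "E \<longlonglongrightarrow> 0"
  proof (rule Lim_null_comparison)
    show "(\<lambda>n. \<bar>a n\<bar> ^ 3 * inverse (sqrt (real n))) \<longlonglongrightarrow> 0"
    proof -
      have "(\<lambda>n. \<bar>a n\<bar> ^ 3 * inverse (sqrt (real n))) \<longlonglongrightarrow> \<bar>a'\<bar> ^ 3 * 0"
        by (intro tendsto_intros a tendsto_inverse_0_at_top filterlim_compose[OF sqrt_at_top filterlim_real_sequentially])
      then show ?thesis by simp
    qed
    show "\<forall>\<^sub>F n in sequentially. norm (E n) \<le> \<bar>a n\<bar> ^ 3 * inverse (sqrt (real n))"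
      using eventually_gt_at_top[of 0]
    proof eventually_elim
      case (elim n)
      have b: "cmod (rem (s n * c)) \<le> \<bar>s n\<bar> ^ 3" if "\<bar>c\<bar> \<le> 1" for c
      proof -
        have "\<bar>s n * c\<bar> ^ 3 \<le> \<bar>s n\<bar> ^ 3"
          using that by (intro power_mono) (auto simp: abs_mult mult_left_le)
        then show ?thesis using rem[of "s n * c"] zero_le_power_abs[of "s n" 3] by linarith
      qed
      have "cmod (q n * rem (s n * (1 - q n)) + (1 - q n) * rem (- (s n * q n)))
          \<le> q n * cmod (rem (s n * (1 - q n))) + (1 - q n) * cmod (rem (s n * (- q n)))"
        using q01[of n] norm_of_real[of "1 - q n", where 'a=complex]
        by (intro order_trans[OF norm_triangle_ineq]) (simp add: norm_mult)
      also have "\<dots> \<le> q n * \<bar>s n\<bar> ^ 3 + (1 - q n) * \<bar>s n\<bar> ^ 3"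
        using q01[of n] by (intro add_mono mult_left_mono b) auto
      also have "\<dots> = \<bar>s n\<bar> ^ 3" by (simp add: algebra_simps)
      finally have "norm (E n) \<le> real n * \<bar>s n\<bar> ^ 3"
        by (simp add: E_def norm_mult mult_left_mono)
      also have "\<dots> = \<bar>a n\<bar> ^ 3 * inverse (sqrt (real n))"
      proof -
        have "sqrt (real n) ^ 3 = real n * sqrt (real n)" by (simp add: eval_nat_numeral)
        then show ?thesis using elim by (simp add: s_def power_divide abs_divide field_simps)
      qed
      finally show ?case .
    qed
  qed
  have "(\<lambda>n. complex_of_real (- (q n * (1 - q n) * (a n)\<^sup>2 / 2)) + E n) \<longlonglongrightarrow> complex_of_real (- (q' * (1 - q') * a'\<^sup>2 / 2)) + 0"
    by (intro tendsto_intros q a E0) simp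
  moreover have "\<forall>\<^sub>F n in sequentially. complex_of_real (- (q n * (1 - q n) * (a n)\<^sup>2 / 2)) + E n
      = of_nat n * (q n * iexp (s n * (1 - q n)) + (1 - q n) * iexp (- (s n * q n)) - 1)"
    using ns by eventually_elim (simp only: eq)
  ultimately show ?thesis
    by (auto intro: Lim_transform_eventually)
qed

section \<open>Limit theorems with event probabilities that vary with the sample size\<close>

context path_kernel
begin

context
  fixes K :: nat and q :: "nat \<Rightarrow> nat \<Rightarrow> real"
  assumes K: "K \<ge> 1" and q01: "\<And>n r. q n r \<in> {0..1}"
begin

text \<open>A triangular array: \<open>n\<close> is both the number of observations and the index of
  the event probabilities, which covers the moving local parameters.\<close>

abbreviation phase_law :: "nat \<Rightarrow> (bool \<times> bool) list pmf" where
  "phase_law n \<equiv> path_law \<kappa> (\<lambda>t. q n (t mod K)) n"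

lemma phase_law_length: "x \<in> set_pmf (phase_law n) \<Longrightarrow> length x = n"
  using q01 by (simp add: set_path_law)

lemma integrable_phase_law:
  fixes f :: "_ \<Rightarrow> 'b::{banach, second_countable_topology}"
  shows "integrable (measure_pmf (phase_law n)) f"
  using q01 by (intro integrable_path_law) auto

lemma centred_count_second_moment:
  "measure_pmf.expectation (phase_law n)
     (\<lambda>x. ((event_count K r x - q n r * gate_count K r x) / sqrt n)\<^sup>2) \<le> 1"
proof -
  define a where "a t = of_bool (t mod K = r) / sqrt n" for t
  have "measure_pmf.expectation (phase_law n)
     (\<lambda>x. ((event_count K r x - q n r * gate_count K r x) / sqrt n)\<^sup>2)
    = measure_pmf.expectation (phase_law n)
     (\<lambda>x. (\<Sum>t<n. a t * of_bool (fst (x ! t)) * (of_bool (snd (x ! t)) - q n (t mod K)))\<^sup>2)"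
  proof (rule integral_cong_AE)
    show "AE x in measure_pmf (phase_law n). ((event_count K r x - q n r * gate_count K r x) / sqrt n)\<^sup>2
      = (\<Sum>t<n. a t * of_bool (fst (x ! t)) * (of_bool (snd (x ! t)) - q n (t mod K)))\<^sup>2"
    proof (rule AE_pmfI)
      fix x assume "x \<in> set_pmf (phase_law n)"
      then have n: "n = length x" by (simp add: phase_law_length)
      have "(event_count K r x - q n r * gate_count K r x) / sqrt n
        = (\<Sum>t<n. a t * of_bool (fst (x ! t)) * (of_bool (snd (x ! t)) - q n (t mod K)))"
        unfolding n event_count_def gate_count_def a_def sum_distrib_left sum_subtractf[symmetric] sum_divide_distrib
        by (intro sum.cong) (auto simp: diff_divide_distrib)
      then show "((event_count K r x - q n r * gate_count K r x) / sqrt n)\<^sup>2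
        = (\<Sum>t<n. a t * of_bool (fst (x ! t)) * (of_bool (snd (x ! t)) - q n (t mod K)))\<^sup>2"
        by simp
    qed
  qed auto
  also have "\<dots> \<le> (\<Sum>t<n. (a t)\<^sup>2)"
    using q01 by (intro martingale_second_moment) auto
  also have "\<dots> \<le> (\<Sum>t<n. 1 / real n)"
    by (rule sum_mono) (simp add: a_def power_divide)
  also have "\<dots> \<le> 1" by simp
  finally show ?thesis .
qed

lemma prob_centred_count_gt:
  assumes "R > 0"
  shows "measure_pmf.prob (phase_law n)
     {x. \<bar>(event_count K r x - q n r * gate_count K r x) / sqrt n\<bar> > R} \<le> 1 / R\<^sup>2"
  by (rule prob_gt_le_second_moment[OF integrable_phase_law centred_count_second_moment assms])

lemma event_count_law_of_large_numbers:
  assumes "e > 0"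
  shows "(\<lambda>n. measure_pmf.prob (phase_law n)
     {x. \<bar>event_count K r x / n - q n r * (gate_count K r x / n)\<bar> > e}) \<longlonglongrightarrow> 0"
proof (rule tendsto_sandwich[OF _ _ tendsto_const])
  show "(\<lambda>n. 1 / e\<^sup>2 * inverse (real n)) \<longlonglongrightarrow> 0"
    using tendsto_mult[OF tendsto_const[of "1 / e\<^sup>2"] lim_inverse_n[where 'a=real]] by simp
  show "\<forall>\<^sub>F n in sequentially. measure_pmf.prob (phase_law n)
     {x. \<bar>event_count K r x / n - q n r * (gate_count K r x / n)\<bar> > e} \<le> 1 / e\<^sup>2 * inverse (real n)"
    using eventually_gt_at_top[of 0]
  proof eventually_elim
    case (elim n)
    have "e < \<bar>event_count K r x / n - q n r * (gate_count K r x / n)\<bar> \<longleftrightarrow>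
      e * sqrt n < \<bar>(event_count K r x - q n r * gate_count K r x) / sqrt n\<bar>" for x
    proof -
      have "(event_count K r x - q n r * gate_count K r x) / sqrt n
        = (event_count K r x / n - q n r * (gate_count K r x / n)) * sqrt n"
      proof -
        have "(E - c * G) / w = (E / (w * w) - c * (G / (w * w))) * w" if "w > 0" for E G c w :: real
          using that by (simp add: field_simps)
        from this[of "sqrt n"] show ?thesis using elim by simp
      qed
      then show ?thesis using elim by (simp add: abs_mult)
    qed
    then show ?case
      using prob_centred_count_gt[of "e * sqrt n" n r] elim assms by (simp add: power_mult_distrib field_simps)
  qed
qed simp

text \<open>
  Dividing \<open>exp (i u \<cdot> score)\<close> by the product of the conditional characteristic functions
  gives expectation exactly one; the product converges because the gating frequencies do.
\<close>

lemma score_char_tendsto: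
  fixes a :: "nat \<Rightarrow> nat \<Rightarrow> real"
  assumes q: "\<And>r. r < K \<Longrightarrow> (\<lambda>n. q n r) \<longlonglongrightarrow> q' r" and a: "\<And>r. r < K \<Longrightarrow> (\<lambda>n. a n r) \<longlonglongrightarrow> a' r"
    and freq: "\<And>r e. r < K \<Longrightarrow> e > 0 \<Longrightarrow>
      (\<lambda>n. measure_pmf.prob (phase_law n) {x. \<bar>gate_count K r x / n - \<nu> r\<bar> > e}) \<longlonglongrightarrow> 0"
  shows "(\<lambda>n. measure_pmf.expectation (phase_law n)
      (\<lambda>x. iexp (\<Sum>r<K. a n r * ((event_count K r x - q n r * gate_count K r x) / sqrt n))))
    \<longlonglongrightarrow> exp (- (\<Sum>r<K. \<nu> r * (q' r * (1 - q' r) * (a' r)\<^sup>2)) / 2)"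
proof -
  define s where "s n r = a n r / sqrt (real n)" for n r
  define \<psi> where "\<psi> r n = q n r * iexp (s n r * (1 - q n r)) + (1 - q n r) * iexp (- (s n r * q n r))" for r n
  \<comment> \<open>\<open>exp (\<rho> n r)\<close> divides by \<open>\<psi> r n\<close>, the
    characteristic function of one open-gate step of phase \<open>r\<close>; the total correction
    \<open>R\<close> is therefore linear in the gate counts.\<close>
  define \<rho> where "\<rho> n r = - Ln (\<psi> r n)" for n r
  define \<tau> where "\<tau> r = q' r * (1 - q' r) * (a' r)\<^sup>2 / 2" for r
  define \<sigma> where "\<sigma> = (\<Sum>r<K. \<nu> r * \<tau> r)"
  define u where "u n x = (\<Sum>r<K. a n r * ((event_count K r x - q n r * gate_count K r x) / sqrt n))" for n x
  define R where "R n x = (\<Sum>r<K. \<rho> n r * gate_count K r x)" for n x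
  have \<psi>_lim: "(\<lambda>n. of_nat n * (\<psi> r n - 1)) \<longlonglongrightarrow> complex_of_real (- \<tau> r)" if "r < K" for r
    unfolding \<psi>_def s_def \<tau>_def using bernoulli_char_expansion[OF q[OF that] a[OF that] q01] by simp
  have \<psi>_nz: "\<forall>\<^sub>F n in sequentially. \<forall>r<K. \<psi> r n \<noteq> 0"
  proof -
    have "\<forall>\<^sub>F n in sequentially. \<psi> r n \<noteq> 0" if "r < K" for r
      by (rule tendsto_imp_eventually_ne[OF tendsto_Ln_scaled(1)[OF \<psi>_lim[OF that]]]) simp
    then have "\<forall>\<^sub>F n in sequentially. \<forall>r\<in>{..<K}. \<psi> r n \<noteq> 0"
      by (intro eventually_ball_finite) auto
    then show ?thesis by (simp add: Ball_def)
  qed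
  have \<rho>_lim: "(\<lambda>n. of_nat n * \<rho> n r) \<longlonglongrightarrow> complex_of_real (\<tau> r)" if "r < K" for r
    using tendsto_minus[OF tendsto_Ln_scaled(2)[OF \<psi>_lim[OF that]]] by (simp add: \<rho>_def)
  have martingale: "measure_pmf.expectation (phase_law n) (\<lambda>x. exp (\<i> * u n x + R n x)) = 1"
    if nz: "\<forall>r<K. \<psi> r n \<noteq> 0" for n
  proof -
    define \<alpha> where "\<alpha> r = \<i> * complex_of_real (s n r * (1 - q n r)) + \<rho> n r" for r
    define \<beta> where "\<beta> r = \<i> * complex_of_real (- (s n r * q n r)) + \<rho> n r" for r
    have one: "q n r * exp (\<alpha> r) + (1 - q n r) * exp (\<beta> r) = 1" if "r < K" for r
    proof -
      have "exp (\<rho> n r) = inverse (\<psi> r n)" using nz that by (simp add: \<rho>_def exp_minus)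
      moreover have "q n r * exp (\<alpha> r) + (1 - q n r) * exp (\<beta> r) = \<psi> r n * exp (\<rho> n r)"
        by (simp only: \<alpha>_def \<beta>_def \<psi>_def exp_add) (simp only: ring_distribs mult.assoc)
      ultimately show ?thesis using nz that by simp
    qed
    have "measure_pmf.expectation (phase_law n) (\<lambda>x. exp (\<i> * u n x + R n x))
      = measure_pmf.expectation (phase_law n)
         (\<lambda>x. exp (\<Sum>t<n. of_bool (fst (x ! t)) * (if snd (x ! t) then \<alpha> (t mod K) else \<beta> (t mod K))))"
    proof (rule integral_cong_AE)
      show "AE x in measure_pmf (phase_law n). exp (\<i> * u n x + R n x)
        = exp (\<Sum>t<n. of_bool (fst (x ! t)) * (if snd (x ! t) then \<alpha> (t mod K) else \<beta> (t mod K)))"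
      proof (rule AE_pmfI)
        fix x assume "x \<in> set_pmf (phase_law n)"
        then have n: "n = length x" by (simp add: phase_law_length)
        have "\<i> * u n x + R n x = (\<Sum>r<K. \<alpha> r * event_count K r x + \<beta> r * (gate_count K r x - event_count K r x))"
          unfolding u_def R_def of_real_sum sum_distrib_left sum.distrib[symmetric]
          by (intro sum.cong) (auto simp: \<alpha>_def \<beta>_def s_def algebra_simps diff_divide_distrib)
        then show "exp (\<i> * u n x + R n x)
          = exp (\<Sum>t<n. of_bool (fst (x ! t)) * (if snd (x ! t) then \<alpha> (t mod K) else \<beta> (t mod K)))"
          using sum_paths_eq_counts[OF K, of x \<alpha> \<beta>] unfolding n by simp
      qed
    qed auto
    also have "\<dots> = 1"
      using q01 one K by (intro exponential_martingale) auto
    finally show ?thesis .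
  qed
  \<comment> \<open>By the identity \<open>martingale\<close>, the expectation of \<open>f n\<close>
    is that of \<open>iexp (u n x)\<close> minus exp (- \<sigma>), while its modulus involves the
    gate counts alone.\<close>
  define f where "f n x = iexp (u n x) * (1 - exp (R n x - \<sigma>))" for n x
  have norm_f: "norm (f n x) = norm (1 - exp (R n x - \<sigma>))" for n x
    by (simp add: f_def norm_mult)
  have "\<forall>\<^sub>F n in sequentially. norm (of_nat n * \<rho> n r) < \<tau> r + 1" if "r < K" for r
  proof -
    have "(\<lambda>n. norm (of_nat n * \<rho> n r)) \<longlonglongrightarrow> norm (complex_of_real (\<tau> r))"
      by (intro tendsto_norm \<rho>_lim that)
    moreover have "norm (complex_of_real (\<tau> r)) < \<tau> r + 1"
    proof -
      have "q' r \<in> {0..1}"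
        using closed_sequentially[of "{0..1}", OF _ _ q[OF that]] q01 by auto
      then have "\<tau> r \<ge> 0" by (simp add: \<tau>_def)
      then show ?thesis by simp
    qed
    ultimately show ?thesis by (rule order_tendstoD(2))
  qed
  then have "\<forall>\<^sub>F n in sequentially. \<forall>r\<in>{..<K}. norm (of_nat n * \<rho> n r) < \<tau> r + 1"
    by (intro eventually_ball_finite) auto
  then have \<rho>_bnd: "\<forall>\<^sub>F n in sequentially. \<forall>r<K. norm (of_nat n * \<rho> n r) \<le> \<tau> r + 1"
    by (rule eventually_mono) (auto intro: less_imp_le)
  \<comment> \<open>Gate counts are at most n, so \<open>R n x\<close> has a deterministic bound;
    bounded convergence then applies to \<open>f\<close>.\<close>
  define B where "B = (\<Sum>r<K. \<tau> r + 1)"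
  have R_bnd: "norm (R n x) \<le> B" if "\<forall>r<K. norm (of_nat n * \<rho> n r) \<le> \<tau> r + 1" "length x = n" "n > 0" for n x
    unfolding R_def B_def
  proof (rule sum_norm_le)
    fix r assume "r \<in> {..<K}"
    have "norm (\<rho> n r * gate_count K r x) = norm (\<rho> n r) * gate_count K r x"
      using gate_count_bounds(1)[of K r x] by (simp add: norm_mult)
    also have "\<dots> \<le> norm (\<rho> n r) * n"
      using gate_count_bounds(2)[of K r x] that by (intro mult_left_mono) auto
    also have "\<dots> \<le> \<tau> r + 1" using that \<open>r \<in> {..<K}\<close> by (auto simp: norm_mult mult.commute)
    finally show "norm (\<rho> n r * gate_count K r x) \<le> \<tau> r + 1" .
  qed
  have lim0: "(\<lambda>n. measure_pmf.expectation (phase_law n) (f n)) \<longlonglongrightarrow> 0"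
  proof (rule expectation_tendsto_zero)
    show "\<forall>\<^sub>F n in sequentially. \<forall>x\<in>set_pmf (phase_law n). norm (f n x) \<le> 1 + exp (B + \<bar>\<sigma>\<bar>)"
      using \<rho>_bnd eventually_gt_at_top[of 0]
    proof eventually_elim
      case (elim n)
      show ?case
      proof
        fix x assume "x \<in> set_pmf (phase_law n)"
        then have "norm (R n x) \<le> B" using R_bnd[OF elim(1)] elim(2) by (simp add: phase_law_length)
        then have "norm (R n x - \<sigma>) \<le> B + \<bar>\<sigma>\<bar>"
          by (intro order_trans[OF norm_triangle_ineq4]) simp
        have "norm (f n x) \<le> 1 + norm (exp (R n x - \<sigma>))"
          unfolding norm_f by (rule order_trans[OF norm_triangle_ineq4]) simp
        also have "\<dots> \<le> 1 + exp (norm (R n x - \<sigma>))" using norm_exp[of "R n x - \<sigma>"] by simp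
        also have "\<dots> \<le> 1 + exp (B + \<bar>\<sigma>\<bar>)" using \<open>norm (R n x - \<sigma>) \<le> _\<close> by simp
        finally show "norm (f n x) \<le> 1 + exp (B + \<bar>\<sigma>\<bar>)" .
      qed
    qed
    fix e :: real assume "e > 0"
    have "isCont (\<lambda>z::complex. 1 - exp z) 0" by (intro continuous_intros)
    then obtain d where d: "d > 0" "\<And>z::complex. norm z < d \<Longrightarrow> norm (1 - exp z) < e"
      using \<open>e > 0\<close> unfolding continuous_at_eps_delta by (auto simp: dist_norm)
    \<comment> \<open>Half of \<open>d\<close> is reserved for the frequency errors, whose weights
      add up to \<open>B\<close>, and half for the deviation of n * \<rho> from \<tau>.\<close>
    define \<eta> where "\<eta> = d / (2 * (B + 1))"
    have "\<tau> r \<ge> 0" if "r < K" for r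
    proof -
      have "q' r \<in> {0..1}"
        using closed_sequentially[of "{0..1}", OF _ _ q[OF that]] q01 by auto
      then show "\<tau> r \<ge> 0" by (simp add: \<tau>_def)
    qed
    then have "B \<ge> 0" unfolding B_def by (intro sum_nonneg) (simp add: add_nonneg_nonneg)
    then have "\<eta> > 0" "B * \<eta> < d / 2" using d by (auto simp: \<eta>_def field_simps)
    have "(\<lambda>n. \<Sum>r<K. norm (of_nat n * \<rho> n r - \<tau> r) * \<bar>\<nu> r\<bar>) \<longlonglongrightarrow> (\<Sum>r<K. norm (complex_of_real (\<tau> r) - \<tau> r) * \<bar>\<nu> r\<bar>)"
      by (intro tendsto_intros \<rho>_lim) auto
    then have small: "\<forall>\<^sub>F n in sequentially. (\<Sum>r<K. norm (of_nat n * \<rho> n r - \<tau> r) * \<bar>\<nu> r\<bar>) < d / 2"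
      using d by (intro order_tendstoD(2)[where y=0]) auto
    show "(\<lambda>n. measure_pmf.prob (phase_law n) {x. norm (f n x) > e}) \<longlonglongrightarrow> 0"
    proof (rule prob_tendsto_zero_mono)
      show "(\<lambda>n. measure_pmf.prob (phase_law n) (\<Union>r\<in>{..<K}. {x. \<bar>gate_count K r x / n - \<nu> r\<bar> > \<eta>})) \<longlonglongrightarrow> 0"
        using freq \<open>\<eta> > 0\<close> by (intro prob_tendsto_zero_UN) auto
      show "\<forall>\<^sub>F n in sequentially. {x. norm (f n x) > e} \<inter> set_pmf (phase_law n)
         \<subseteq> (\<Union>r\<in>{..<K}. {x. \<bar>gate_count K r x / n - \<nu> r\<bar> > \<eta>})"
        using \<rho>_bnd small eventually_gt_at_top[of 0]
      proof eventually_elim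
        case (elim n)
        show ?case
        proof (rule subsetI, rule ccontr)
          fix x assume x: "x \<in> {x. norm (f n x) > e} \<inter> set_pmf (phase_law n)"
            and "x \<notin> (\<Union>r\<in>{..<K}. {x. \<bar>gate_count K r x / n - \<nu> r\<bar> > \<eta>})"
          then have near: "\<bar>gate_count K r x / n - \<nu> r\<bar> \<le> \<eta>" if "r < K" for r
            using that by (auto simp: not_less)
          have "R n x - \<sigma> = (\<Sum>r<K. of_nat n * \<rho> n r * (gate_count K r x / n - \<nu> r) + (of_nat n * \<rho> n r - \<tau> r) * \<nu> r)"
            unfolding R_def \<sigma>_def of_real_sum sum_subtractf[symmetric] using elim(3)
            by (intro sum.cong) (auto simp: field_simps)
          also have "norm \<dots> \<le> (\<Sum>r<K. (\<tau> r + 1) * \<eta> + norm (of_nat n * \<rho> n r - \<tau> r) * \<bar>\<nu> r\<bar>)"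
          proof (rule sum_norm_le)
            fix r assume r: "r \<in> {..<K}"
            have "norm (of_nat n * \<rho> n r * complex_of_real (gate_count K r x / n - \<nu> r)) \<le> (\<tau> r + 1) * \<eta>"
              unfolding norm_mult[of "of_nat n * \<rho> n r"] norm_of_real
              using elim(1) near r \<open>\<eta> > 0\<close> by (intro mult_mono) (auto intro: order_trans[OF norm_ge_zero])
            then show "norm (of_nat n * \<rho> n r * complex_of_real (gate_count K r x / n - \<nu> r) + (of_nat n * \<rho> n r - \<tau> r) * \<nu> r)
               \<le> (\<tau> r + 1) * \<eta> + norm (of_nat n * \<rho> n r - \<tau> r) * \<bar>\<nu> r\<bar>"
              by (intro order_trans[OF norm_triangle_ineq] add_mono) (auto simp: norm_mult)
          qed
          also have "\<dots> = B * \<eta> + (\<Sum>r<K. norm (of_nat n * \<rho> n r - \<tau> r) * \<bar>\<nu> r\<bar>)"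
            unfolding B_def sum_distrib_right by (rule sum.distrib)
          also have "\<dots> < d" using \<open>B * \<eta> < d / 2\<close> elim(2) by linarith
          finally have "norm (f n x) < e" unfolding norm_f by (rule d(2))
          then show False using x by simp
        qed
      qed
    qed
  qed
  have "\<forall>\<^sub>F n in sequentially. measure_pmf.expectation (phase_law n) (f n) + exp (- complex_of_real \<sigma>)
      = measure_pmf.expectation (phase_law n) (\<lambda>x. iexp (u n x))"
    using \<psi>_nz
  proof eventually_elim
    case (elim n)
    have "f n x = iexp (u n x) - exp (- complex_of_real \<sigma>) * exp (\<i> * u n x + R n x)" for x
      by (simp add: f_def right_diff_distrib exp_add exp_diff exp_minus field_simps)
    then have feq: "f n = (\<lambda>x. iexp (u n x) - exp (- complex_of_real \<sigma>) * exp (\<i> * u n x + R n x))"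
      by (rule ext)
    have "measure_pmf.expectation (phase_law n) (f n)
      = measure_pmf.expectation (phase_law n) (\<lambda>x. iexp (u n x)) - exp (- complex_of_real \<sigma>) * 1"
      unfolding martingale[OF elim, symmetric]
      by (simp only: feq Bochner_Integration.integral_diff[OF integrable_phase_law integrable_phase_law] integral_mult_right_zero)
    then show ?case by simp
  qed
  moreover have "(\<lambda>n. measure_pmf.expectation (phase_law n) (f n) + exp (- complex_of_real \<sigma>)) \<longlonglongrightarrow> 0 + exp (- complex_of_real \<sigma>)"
    by (intro tendsto_intros lim0)
  moreover have "\<sigma> = (\<Sum>r<K. \<nu> r * (q' r * (1 - q' r) * (a' r)\<^sup>2)) / 2"
    by (simp add: \<sigma>_def \<tau>_def sum_divide_distrib)
  ultimately show ?thesis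
    unfolding u_def by (auto intro: Lim_transform_eventually simp: exp_of_real[symmetric])
qed

end
end

section \<open>Consistency\<close>

text \<open>Each outcome obeys a ln b - a ln a \<le> b - a, which is ln x \<le> x - 1 at x = b / a;
  over the two outcomes the right-hand sides add up to zero. Strictness holds because ln x = x - 1
  only at x = 1.\<close>

lemma bernoulli_cross_entropy:
  fixes p q :: real
  assumes p: "0 < p" "p < 1" and q: "0 < q" "q < 1"
  shows "p * ln q + (1 - p) * ln (1 - q) \<le> p * ln p + (1 - p) * ln (1 - p)" (is ?le)
    and "p \<noteq> q \<Longrightarrow> p * ln q + (1 - p) * ln (1 - q) < p * ln p + (1 - p) * ln (1 - p)"
proof -
  have le: "a * ln b - a * ln a \<le> b - a" if "0 < a" "0 < b" for a b :: real
  proof -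
    have "a * (ln b - ln a) = a * ln (b / a)" using that by (simp add: ln_div)
    also have "\<dots> \<le> a * (b / a - 1)" using that by (intro mult_left_mono ln_le_minus_one) auto
    finally show ?thesis using that by (simp add: right_diff_distrib)
  qed
  have less: "a * ln b - a * ln a < b - a" if "0 < a" "0 < b" "a \<noteq> b" for a b :: real
  proof -
    have "ln (b / a) \<noteq> b / a - 1" using ln_eq_minus_one[of "b / a"] that by auto
    then have "ln (b / a) < b / a - 1" using ln_le_minus_one[of "b / a"] that by simp
    then have "a * ln (b / a) < a * (b / a - 1)" using that by simp
    then show ?thesis using that by (simp add: ln_div right_diff_distrib)
  qed
  show ?le using le[of p q] le[of "1 - p" "1 - q"] p q by linarith
  show "p \<noteq> q \<Longrightarrow> p * ln q + (1 - p) * ln (1 - q) < p * ln p + (1 - p) * ln (1 - p)"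
    using less[of p q] le[of "1 - p" "1 - q"] p q by linarith
qed

text \<open>All zeros of the path probability sit in the first factor, which does not contain
  \<open>q\<close>. Both the common support of the laws and the comparison of likelihoods rest on
  this factorisation.\<close>

lemma path_prob_eq_exp:
  assumes K: "K \<ge> 1" and q: "\<And>r. 0 < q r \<and> q r < 1"
  shows "path_prob \<kappa> (\<lambda>t. q (t mod K)) x =
    (\<Prod>t<length x. \<kappa> (take t x) (fst (x ! t)) * of_bool (snd (x ! t) \<longrightarrow> fst (x ! t)))
    * exp (\<Sum>r<K. event_count K r x * ln (q r) + (gate_count K r x - event_count K r x) * ln (1 - q r))"
proof -
  have "obs_prob (q r) z = of_bool (snd z \<longrightarrow> fst z) * exp (of_bool (fst z) * (if snd z then ln (q r) else ln (1 - q r)))" for r z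
    using q[of r] by (auto simp: obs_prob_def)
  then have "path_prob \<kappa> (\<lambda>t. q (t mod K)) x =
    (\<Prod>t<length x. \<kappa> (take t x) (fst (x ! t)) * of_bool (snd (x ! t) \<longrightarrow> fst (x ! t)))
    * exp (\<Sum>t<length x. of_bool (fst (x ! t)) * (if snd (x ! t) then ln (q (t mod K)) else ln (1 - q (t mod K))))"
    unfolding path_prob_def exp_sum[OF finite_lessThan] prod.distrib[symmetric]
    by (intro prod.cong) (simp_all only: mult.assoc)
  then show ?thesis
    using sum_paths_eq_counts[OF K, where 'a=real, of x "\<lambda>r. ln (q r)" "\<lambda>r. ln (1 - q r)"] by (simp add: mult.commute)
qed

text \<open>
  \<open>pq r \<theta>\<close> is the event probability of phase \<open>r\<close>, replaced by \<open>1/2\<close> outside \<open>\<Theta>\<close>, where nothing is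
  assumed; \<open>D r \<theta>\<close> stands for the gradient of \<open>lam r\<close>, and \<open>\<nu> r\<close> for \<open>\<gamma>\<^sub>r(\<theta>\<^sub>0) / K\<close>.
\<close>

locale ded_mle = path_kernel \<kappa> for \<kappa> +
  fixes K :: nat and \<Theta> :: "(real^'d) set" and lam :: "nat \<Rightarrow> real^'d \<Rightarrow> real"
    and D :: "nat \<Rightarrow> real^'d \<Rightarrow> real^'d" and \<nu> :: "nat \<Rightarrow> real" and \<theta>\<^sub>0 :: "real^'d"
    and est :: "nat \<Rightarrow> (bool \<times> bool) list \<Rightarrow> real^'d" and I\<^sub>0 :: "real^'d^'d" and lmin lmax :: real
    and pq :: "nat \<Rightarrow> real^'d \<Rightarrow> real" and Law :: "real^'d \<Rightarrow> nat \<Rightarrow> (bool \<times> bool) list pmf"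
  assumes pq_def: "pq = (\<lambda>r \<theta>. if r < K \<and> \<theta> \<in> \<Theta> then 1 - exp (- lam r \<theta>) else 1 / 2)"
    and Law_def: "Law = (\<lambda>\<theta> n. path_law \<kappa> (\<lambda>t. pq (t mod K) \<theta>) n)"
    and K: "K \<ge> 1"
    and interior: "\<theta>\<^sub>0 \<in> interior \<Theta>"
    and compact: "compact \<Theta>"
    and lmin: "0 < lmin"
    and lam_bounds: "\<And>r \<theta>. r < K \<Longrightarrow> \<theta> \<in> \<Theta> \<Longrightarrow> lmin \<le> lam r \<theta> \<and> lam r \<theta> \<le> lmax"
    and lam_cont: "\<And>r. r < K \<Longrightarrow> continuous_on \<Theta> (lam r)"
    and lam_deriv: "\<And>r \<theta>. r < K \<Longrightarrow> \<theta> \<in> interior \<Theta> \<Longrightarrow> (lam r has_derivative (\<lambda>v. D r \<theta> \<bullet> v)) (at \<theta>)"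
    and D_cont: "\<And>r. r < K \<Longrightarrow> continuous_on (interior \<Theta>) (D r)"
    and identifiable: "\<And>\<theta>. \<theta> \<in> \<Theta> \<Longrightarrow> (\<And>r. r < K \<Longrightarrow> \<nu> r > 0 \<Longrightarrow> lam r \<theta> = lam r \<theta>\<^sub>0) \<Longrightarrow> \<theta> = \<theta>\<^sub>0"
    and \<nu>: "\<And>r. r < K \<Longrightarrow> \<nu> r \<in> {0..1}"
    and freq\<^sub>0: "\<And>r e. r < K \<Longrightarrow> e > 0 \<Longrightarrow>
      (\<lambda>n. measure_pmf.prob (Law \<theta>\<^sub>0 n) {x. \<bar>gate_count K r x / n - \<nu> r\<bar> > e}) \<longlonglongrightarrow> 0"
    and mle: "\<And>n x \<theta>. x \<in> set_pmf (Law \<theta>\<^sub>0 n) \<Longrightarrow> \<theta> \<in> \<Theta> \<Longrightarrow> est n x \<in> \<Theta> \<and>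
      path_prob \<kappa> (\<lambda>t. pq (t mod K) \<theta>) x \<le> path_prob \<kappa> (\<lambda>t. pq (t mod K) (est n x)) x"
    and I\<^sub>0: "\<And>v. I\<^sub>0 *v v = (\<Sum>r<K. (\<nu> r * ((1 - pq r \<theta>\<^sub>0) / pq r \<theta>\<^sub>0) * (D r \<theta>\<^sub>0 \<bullet> v)) *\<^sub>R D r \<theta>\<^sub>0)"
    and I\<^sub>0_pos: "pos_definite I\<^sub>0"
begin

lemma \<theta>\<^sub>0_in: "\<theta>\<^sub>0 \<in> \<Theta>"
  using interior interior_subset by blast

lemma pq_bounds: "0 < pq r \<theta>" "pq r \<theta> < 1"
proof -
  have "0 < lam r \<theta>" if "r < K" "\<theta> \<in> \<Theta>" using lam_bounds[OF that] lmin by linarith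
  then show "0 < pq r \<theta>" "pq r \<theta> < 1" by (auto simp: pq_def)
qed

lemma pq_in: "pq r \<theta> \<in> {0..1}"
  using pq_bounds[of r \<theta>] by auto

definition log_lik_sum :: "(bool \<times> bool) list \<Rightarrow> real^'d \<Rightarrow> real" where
  "log_lik_sum x \<theta> = (\<Sum>r<K. event_count K r x * ln (pq r \<theta>)
     + (gate_count K r x - event_count K r x) * ln (1 - pq r \<theta>))"

lemma path_prob_pq:
  "path_prob \<kappa> (\<lambda>t. pq (t mod K) \<theta>) x =
    (\<Prod>t<length x. \<kappa> (take t x) (fst (x ! t)) * of_bool (snd (x ! t) \<longrightarrow> fst (x ! t))) * exp (log_lik_sum x \<theta>)"
  unfolding log_lik_sum_def using pq_bounds by (intro path_prob_eq_exp K) auto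

lemma mem_Law: "x \<in> set_pmf (Law \<theta> n) \<longleftrightarrow> length x = n \<and> path_prob \<kappa> (\<lambda>t. pq (t mod K) \<theta>) x \<noteq> 0"
  unfolding Law_def by (rule set_path_law) (rule pq_in)

text \<open>The exponential factor never vanishes, so all parameters share one support; outside
  \<Theta> the value 1/2 of \<open>pq\<close> ensures this.\<close>

lemma set_Law: "set_pmf (Law \<theta> n) = set_pmf (Law \<theta>\<^sub>0 n)"
  by (auto simp: mem_Law path_prob_pq)

lemma Law_length: "x \<in> set_pmf (Law \<theta> n) \<Longrightarrow> length x = n"
  by (simp add: mem_Law)

lemma est_maximises:
  assumes x: "x \<in> set_pmf (Law \<theta> n)" and "\<theta>' \<in> \<Theta>"
  shows "est n x \<in> \<Theta>" "log_lik_sum x \<theta>' \<le> log_lik_sum x (est n x)"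
proof -
  have x0: "x \<in> set_pmf (Law \<theta>\<^sub>0 n)" using x set_Law by blast
  show "est n x \<in> \<Theta>" using mle[OF x0 assms(2)] by simp
  define c where "c = (\<Prod>t<length x. \<kappa> (take t x) (fst (x ! t)) * of_bool (snd (x ! t) \<longrightarrow> fst (x ! t)))"
  have "c \<noteq> 0" using x0 by (simp add: mem_Law path_prob_pq c_def)
  moreover have "c \<ge> 0" unfolding c_def by (intro prod_nonneg) (simp add: kernel_nonneg)
  ultimately have "c > 0" by simp
  moreover have "c * exp (log_lik_sum x \<theta>') \<le> c * exp (log_lik_sum x (est n x))"
    using mle[OF x0 assms(2)] unfolding path_prob_pq c_def by simp
  ultimately show "log_lik_sum x \<theta>' \<le> log_lik_sum x (est n x)" by simp
qed

text \<open>The limit in probability of \<open>log_lik_sum x \<theta> / n\<close> under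
  \<open>\<theta>\<^sub>0\<close>.\<close>

definition limit_lik :: "real^'d \<Rightarrow> real" where
  "limit_lik \<theta> = (\<Sum>r<K. \<nu> r * (pq r \<theta>\<^sub>0 * ln (pq r \<theta>) + (1 - pq r \<theta>\<^sub>0) * ln (1 - pq r \<theta>)))"

lemma pq_cont: "r < K \<Longrightarrow> continuous_on \<Theta> (pq r)"
  unfolding pq_def
  by (rule continuous_on_eq[of _ "\<lambda>\<theta>. 1 - exp (- lam r \<theta>)"]) (auto intro!: continuous_intros lam_cont)

lemma limit_lik_cont: "continuous_on \<Theta> limit_lik"
proof -
  have "pq r \<theta> \<noteq> 0" "1 - pq r \<theta> \<noteq> 0" for r \<theta>
    using pq_bounds[of r \<theta>] by auto
  then show ?thesis unfolding limit_lik_def by (auto intro!: continuous_intros pq_cont)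
qed

text \<open>Gibbs' inequality holds in every phase and is strict in a phase of positive frequency in
  which the two intensities differ; identifiability provides such a phase.\<close>

lemma limit_lik_less:
  assumes "\<theta> \<in> \<Theta>" "\<theta> \<noteq> \<theta>\<^sub>0"
  shows "limit_lik \<theta> < limit_lik \<theta>\<^sub>0"
proof -
  obtain r where r: "r < K" "\<nu> r > 0" "lam r \<theta> \<noteq> lam r \<theta>\<^sub>0"
    using identifiable[OF assms(1)] assms(2) by blast
  then have "pq r \<theta>\<^sub>0 \<noteq> pq r \<theta>" using assms \<theta>\<^sub>0_in by (auto simp: pq_def)
  show ?thesis unfolding limit_lik_def
  proof (rule sum_strict_mono_ex1)
    show "\<forall>s\<in>{..<K}. \<nu> s * (pq s \<theta>\<^sub>0 * ln (pq s \<theta>) + (1 - pq s \<theta>\<^sub>0) * ln (1 - pq s \<theta>))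
      \<le> \<nu> s * (pq s \<theta>\<^sub>0 * ln (pq s \<theta>\<^sub>0) + (1 - pq s \<theta>\<^sub>0) * ln (1 - pq s \<theta>\<^sub>0))"
      using \<nu> pq_bounds by (auto intro!: mult_left_mono bernoulli_cross_entropy(1))
    show "\<exists>s\<in>{..<K}. \<nu> s * (pq s \<theta>\<^sub>0 * ln (pq s \<theta>) + (1 - pq s \<theta>\<^sub>0) * ln (1 - pq s \<theta>))
      < \<nu> s * (pq s \<theta>\<^sub>0 * ln (pq s \<theta>\<^sub>0) + (1 - pq s \<theta>\<^sub>0) * ln (1 - pq s \<theta>\<^sub>0))"
      using r \<open>pq r \<theta>\<^sub>0 \<noteq> pq r \<theta>\<close> pq_bounds
      by (intro bexI[of _ r] mult_strict_left_mono bernoulli_cross_entropy(2)) auto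
  qed simp
qed

text \<open>The lower bound on the intensities keeps \<open>pq\<close> away from 0, the upper one
  keeps it away from 1.\<close>

lemma ln_pq_bounded:
  obtains C where "C > 0"
    "\<And>r \<theta>. r < K \<Longrightarrow> \<theta> \<in> \<Theta> \<Longrightarrow> \<bar>ln (pq r \<theta>)\<bar> \<le> C \<and> \<bar>ln (1 - pq r \<theta>)\<bar> \<le> C"
proof
  show "max 1 (max (- ln (1 - exp (- lmin))) lmax) > 0" by simp
  fix r \<theta> assume r: "r < K" "\<theta> \<in> \<Theta>"
  have "1 - exp (- lmin) \<le> pq r \<theta>" using lam_bounds[OF r] r by (simp add: pq_def)
  then have "ln (1 - exp (- lmin)) \<le> ln (pq r \<theta>)"
    using lmin by (subst ln_le_cancel_iff) (auto simp: pq_bounds)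
  moreover have "ln (pq r \<theta>) \<le> 0" using pq_bounds[of r \<theta>] by simp
  moreover have "ln (1 - pq r \<theta>) = - lam r \<theta>" using r by (simp add: pq_def)
  ultimately show "\<bar>ln (pq r \<theta>)\<bar> \<le> max 1 (max (- ln (1 - exp (- lmin))) lmax) \<and>
      \<bar>ln (1 - pq r \<theta>)\<bar> \<le> max 1 (max (- ln (1 - exp (- lmin))) lmax)"
    using lam_bounds[OF r] lmin by auto
qed

text \<open>Paths enter the likelihood through finitely many counts with bounded coefficients, so
  closeness of the counts to their limits makes the normalised likelihood uniformly close to
  \<open>limit_lik\<close>. Compactness gives a gap \<open>g\<close> between the maximum and the
  values outside a ball.\<close>

lemma est_consistent:
  assumes "e > 0"
  shows "(\<lambda>n. measure_pmf.prob (Law \<theta>\<^sub>0 n) {x. dist (est n x) \<theta>\<^sub>0 > e}) \<longlonglongrightarrow> 0"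
proof -
  obtain C where C: "C > 0" "\<And>r \<theta>. r < K \<Longrightarrow> \<theta> \<in> \<Theta> \<Longrightarrow> \<bar>ln (pq r \<theta>)\<bar> \<le> C \<and> \<bar>ln (1 - pq r \<theta>)\<bar> \<le> C"
    by (rule ln_pq_bounded) blast
  have "compact (\<Theta> - ball \<theta>\<^sub>0 e)" using compact by (simp add: compact_diff)
  obtain g where g: "g > 0" "\<And>\<theta>. \<theta> \<in> \<Theta> - ball \<theta>\<^sub>0 e \<Longrightarrow> limit_lik \<theta> \<le> limit_lik \<theta>\<^sub>0 - g"
  proof (cases "\<Theta> - ball \<theta>\<^sub>0 e = {}")
    case True
    show ?thesis by (rule that[of 1]) (use True in \<open>simp, blast\<close>)
  next
    case False
    obtain \<theta>\<^sub>1 where "\<theta>\<^sub>1 \<in> \<Theta> - ball \<theta>\<^sub>0 e" "\<forall>\<theta>\<in>\<Theta> - ball \<theta>\<^sub>0 e. limit_lik \<theta> \<le> limit_lik \<theta>\<^sub>1"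
      using continuous_attains_sup[OF \<open>compact (\<Theta> - ball \<theta>\<^sub>0 e)\<close> False continuous_on_subset[OF limit_lik_cont]] by auto
    moreover from this have "limit_lik \<theta>\<^sub>1 < limit_lik \<theta>\<^sub>0" using \<open>e > 0\<close> by (intro limit_lik_less) auto
    ultimately show ?thesis by (intro that[of "limit_lik \<theta>\<^sub>0 - limit_lik \<theta>\<^sub>1"]) auto
  qed
  \<comment> \<open>In each phase the events err by 2 * \<eta> and the non-events by 3 * \<eta>,
    both times \<open>C\<close>. Over all phases this makes g / 4, and twice that stays below the
    gap.\<close>
  define \<eta> where "\<eta> = g / (20 * K * C)"
  have "\<eta> > 0" using g C K by (simp add: \<eta>_def)
  have \<eta>: "2 * (real K * (5 * \<eta> * C)) < g" using g C K by (simp add: \<eta>_def field_simps)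
  define Bad where "Bad n = (\<Union>r\<in>{..<K}. {x. \<bar>gate_count K r x / n - \<nu> r\<bar> > \<eta>})
        \<union> (\<Union>r\<in>{..<K}. {x. \<bar>event_count K r x / n - pq r \<theta>\<^sub>0 * (gate_count K r x / n)\<bar> > \<eta>})" for n :: nat
  show ?thesis
  proof (rule prob_tendsto_zero_mono)
    show "(\<lambda>n. measure_pmf.prob (Law \<theta>\<^sub>0 n) (Bad n)) \<longlonglongrightarrow> 0"
      unfolding Law_def Bad_def
      using freq\<^sub>0[unfolded Law_def] event_count_law_of_large_numbers[OF K, of "\<lambda>_ r. pq r \<theta>\<^sub>0"] pq_in \<open>\<eta> > 0\<close>
      by (intro prob_tendsto_zero_Un prob_tendsto_zero_UN) auto
    show "\<forall>\<^sub>F n in sequentially. {x. dist (est n x) \<theta>\<^sub>0 > e} \<inter> set_pmf (Law \<theta>\<^sub>0 n) \<subseteq>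
       Bad n"
      using eventually_gt_at_top[of 0]
    proof eventually_elim
      case (elim n)
      show ?case
      proof (rule subsetI, rule ccontr)
        fix x assume x: "x \<in> {x. dist (est n x) \<theta>\<^sub>0 > e} \<inter> set_pmf (Law \<theta>\<^sub>0 n)"
          and "x \<notin> Bad n"
        then have near: "\<bar>gate_count K r x / n - \<nu> r\<bar> \<le> \<eta>"
          "\<bar>event_count K r x / n - pq r \<theta>\<^sub>0 * (gate_count K r x / n)\<bar> \<le> \<eta>" if "r < K" for r
          using that by (auto simp: Bad_def not_less)
        have unif: "\<bar>log_lik_sum x \<theta> / n - limit_lik \<theta>\<bar> \<le> real K * (5 * \<eta> * C)" if "\<theta> \<in> \<Theta>" for \<theta>
        proof -
          have "log_lik_sum x \<theta> / n - limit_lik \<theta> = (\<Sum>r<K. (event_count K r x / n - \<nu> r * pq r \<theta>\<^sub>0) * ln (pq r \<theta>)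
              + ((gate_count K r x - event_count K r x) / n - \<nu> r * (1 - pq r \<theta>\<^sub>0)) * ln (1 - pq r \<theta>))"
            unfolding log_lik_sum_def limit_lik_def sum_divide_distrib sum_subtractf[symmetric]
            by (intro sum.cong) (auto simp: algebra_simps add_divide_distrib diff_divide_distrib)
          also have "\<bar>\<dots>\<bar> \<le> (\<Sum>r<K. 5 * \<eta> * C)"
          proof (rule order_trans[OF sum_abs sum_mono])
            fix r assume "r \<in> {..<K}"
            then have r: "r < K" by simp
            have "\<bar>pq r \<theta>\<^sub>0 * (gate_count K r x / n - \<nu> r)\<bar> \<le> 1 * \<eta>"
              unfolding abs_mult using pq_bounds[of r \<theta>\<^sub>0] near(1)[OF r] by (intro mult_mono) auto
            then have s1: "\<bar>event_count K r x / n - \<nu> r * pq r \<theta>\<^sub>0\<bar> \<le> 2 * \<eta>"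
              using near(2)[OF r] by (simp add: algebra_simps)
            then have s2: "\<bar>(gate_count K r x - event_count K r x) / n - \<nu> r * (1 - pq r \<theta>\<^sub>0)\<bar> \<le> 3 * \<eta>"
              using near(1)[OF r] by (simp add: algebra_simps diff_divide_distrib)
            have "\<bar>(event_count K r x / n - \<nu> r * pq r \<theta>\<^sub>0) * ln (pq r \<theta>)\<bar> \<le> 2 * \<eta> * C"
              unfolding abs_mult using s1 C r that \<open>\<eta> > 0\<close> by (intro mult_mono) auto
            moreover have "\<bar>((gate_count K r x - event_count K r x) / n - \<nu> r * (1 - pq r \<theta>\<^sub>0)) * ln (1 - pq r \<theta>)\<bar> \<le> 3 * \<eta> * C"
              unfolding abs_mult using s2 C r that \<open>\<eta> > 0\<close> by (intro mult_mono) auto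
            ultimately show "\<bar>(event_count K r x / n - \<nu> r * pq r \<theta>\<^sub>0) * ln (pq r \<theta>)
              + ((gate_count K r x - event_count K r x) / n - \<nu> r * (1 - pq r \<theta>\<^sub>0)) * ln (1 - pq r \<theta>)\<bar> \<le> 5 * \<eta> * C"
              by linarith
          qed
          finally show ?thesis by simp
        qed
        have "est n x \<in> \<Theta>" and le: "log_lik_sum x \<theta>\<^sub>0 \<le> log_lik_sum x (est n x)"
          using est_maximises[OF _ \<theta>\<^sub>0_in] x by blast+
        then have "limit_lik (est n x) \<le> limit_lik \<theta>\<^sub>0 - g"
          using x by (intro g) (auto simp: dist_commute)
        moreover have "log_lik_sum x \<theta>\<^sub>0 / n \<le> log_lik_sum x (est n x) / n"
          using le by (simp add: divide_right_mono)
        moreover have "\<not> (a \<le> b \<and> \<bar>a - l\<bar> \<le> E \<and> \<bar>b - l'\<bar> \<le> E \<and> l' \<le> l - g \<and> 2 * E < g)" for a b l l' E :: real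
          by linarith
        ultimately show False
          using unif[OF \<theta>\<^sub>0_in] unif[OF \<open>est n x \<in> \<Theta>\<close>] \<eta> by blast
      qed
    qed
  qed
qed

subsection \<open>The score equation\<close>

text \<open>For a phase and a parameter in the interior of \<Theta>, the gradient of the log-odds ln
  (p / (1 - p)): \<open>pq_grad\<close> divided by p (1 - p).\<close>

definition score_dir :: "nat \<Rightarrow> real^'d \<Rightarrow> real^'d" where
  "score_dir r \<theta> = (1 / pq r \<theta>) *\<^sub>R D r \<theta>"

definition pq_grad :: "nat \<Rightarrow> real^'d \<Rightarrow> real^'d" where
  "pq_grad r \<theta> = (1 - pq r \<theta>) *\<^sub>R D r \<theta>"

lemma pq_deriv:
  assumes r: "r < K" and \<theta>: "\<theta> \<in> interior \<Theta>"
  shows "(pq r has_derivative (\<lambda>v. pq_grad r \<theta> \<bullet> v)) (at \<theta>)"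
proof -
  have in\<Theta>: "\<theta>' \<in> \<Theta>" if "\<theta>' \<in> interior \<Theta>" for \<theta>'
    using that interior_subset by blast
  have "((\<lambda>\<theta>. 1 - exp (- lam r \<theta>)) has_derivative (\<lambda>v. exp (- lam r \<theta>) * (D r \<theta> \<bullet> v))) (at \<theta>)"
    by (auto intro!: derivative_eq_intros lam_deriv[OF r \<theta>])
  then have "(pq r has_derivative (\<lambda>v. exp (- lam r \<theta>) * (D r \<theta> \<bullet> v))) (at \<theta>)"
    by (rule has_derivative_transform_within_open[OF _ open_interior \<theta>]) (simp add: pq_def r in\<Theta>)
  moreover have "exp (- lam r \<theta>) * (D r \<theta> \<bullet> v) = pq_grad r \<theta> \<bullet> v" for v
    unfolding pq_grad_def using r in\<Theta>[OF \<theta>] by (simp add: pq_def)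
  ultimately show ?thesis by (simp only:)
qed

lemma continuous_at_grads:
  assumes "r < K"
  shows "isCont (score_dir r) \<theta>\<^sub>0" "isCont (pq_grad r) \<theta>\<^sub>0"
proof -
  have 1: "isCont (D r) \<theta>\<^sub>0"
    using D_cont[OF assms] interior by (simp add: continuous_on_eq_continuous_at)
  have 2: "isCont (pq r) \<theta>\<^sub>0"
    using has_derivative_continuous[OF pq_deriv[OF assms interior]] .
  show "isCont (score_dir r) \<theta>\<^sub>0" "isCont (pq_grad r) \<theta>\<^sub>0"
    unfolding score_dir_def pq_grad_def using pq_bounds[of r \<theta>\<^sub>0]
    by (auto intro!: continuous_intros 1 2)
qed

text \<open>Continuity of the gradient at \<open>\<theta>\<^sub>0\<close> makes \<open>pq r\<close>
  strictly differentiable there, by the mean value inequality for \<open>pq r\<close> minus its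
  linear part. Both points are free because the estimate and the local parameter move at
  once.\<close>

lemma strict_differentiability:
  assumes "\<eta> > 0"
  obtains \<rho> where "\<rho> > 0" "ball \<theta>\<^sub>0 \<rho> \<subseteq> interior \<Theta>"
    "\<And>r \<theta>. r < K \<Longrightarrow> \<theta> \<in> ball \<theta>\<^sub>0 \<rho> \<Longrightarrow> norm (score_dir r \<theta> - score_dir r \<theta>\<^sub>0) \<le> \<eta>"
    "\<And>r \<theta> \<theta>'. r < K \<Longrightarrow> \<theta> \<in> ball \<theta>\<^sub>0 \<rho> \<Longrightarrow> \<theta>' \<in> ball \<theta>\<^sub>0 \<rho> \<Longrightarrow>
       \<bar>pq r \<theta> - pq r \<theta>' - pq_grad r \<theta>\<^sub>0 \<bullet> (\<theta> - \<theta>')\<bar> \<le> \<eta> * norm (\<theta> - \<theta>')"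
proof -
  have ev: "\<forall>\<^sub>F \<theta> in nhds \<theta>\<^sub>0. norm (f \<theta> - f \<theta>\<^sub>0) < \<eta>" if "isCont f \<theta>\<^sub>0" for f :: "real^'d \<Rightarrow> real^'d"
    using that assms unfolding isCont_def tendsto_at_iff_tendsto_nhds by (simp add: tendsto_iff dist_norm)
  have "\<forall>\<^sub>F \<theta> in nhds \<theta>\<^sub>0. \<theta> \<in> interior \<Theta> \<and>
      (\<forall>r\<in>{..<K}. norm (score_dir r \<theta> - score_dir r \<theta>\<^sub>0) < \<eta> \<and> norm (pq_grad r \<theta> - pq_grad r \<theta>\<^sub>0) < \<eta>)"
    using interior
    by (intro eventually_conj eventually_ball_finite ballI ev continuous_at_grads eventually_nhds_in_open) auto
  then obtain \<rho> where \<rho>: "\<rho> > 0" and near: "\<And>\<theta>. \<theta> \<in> ball \<theta>\<^sub>0 \<rho> \<Longrightarrow> \<theta> \<in> interior \<Theta> \<and>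
      (\<forall>r\<in>{..<K}. norm (score_dir r \<theta> - score_dir r \<theta>\<^sub>0) < \<eta> \<and> norm (pq_grad r \<theta> - pq_grad r \<theta>\<^sub>0) < \<eta>)"
    unfolding eventually_nhds_metric by (auto simp: dist_commute)
  show thesis
  proof (rule that[OF \<rho>])
    show "ball \<theta>\<^sub>0 \<rho> \<subseteq> interior \<Theta>" using near by blast
    fix r \<theta> assume r: "r < K" and \<theta>: "\<theta> \<in> ball \<theta>\<^sub>0 \<rho>"
    then show "norm (score_dir r \<theta> - score_dir r \<theta>\<^sub>0) \<le> \<eta>" using near[OF \<theta>] by (auto intro: less_imp_le)
    fix \<theta>' assume \<theta>': "\<theta>' \<in> ball \<theta>\<^sub>0 \<rho>"
    let ?f = "\<lambda>\<theta>. pq r \<theta> - pq_grad r \<theta>\<^sub>0 \<bullet> \<theta>"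
    have "norm (?f \<theta> - ?f \<theta>') \<le> \<eta> * norm (\<theta> - \<theta>')"
    proof (rule differentiable_bound[OF convex_ball _ _ \<theta> \<theta>'])
      fix \<zeta> assume \<zeta>: "\<zeta> \<in> ball \<theta>\<^sub>0 \<rho>"
      have "(?f has_derivative (\<lambda>v. pq_grad r \<zeta> \<bullet> v - pq_grad r \<theta>\<^sub>0 \<bullet> v)) (at \<zeta>)"
        using near[OF \<zeta>] by (auto intro!: derivative_intros pq_deriv r)
      then show "(?f has_derivative (\<lambda>v. (pq_grad r \<zeta> - pq_grad r \<theta>\<^sub>0) \<bullet> v)) (at \<zeta> within ball \<theta>\<^sub>0 \<rho>)"
        by (simp add: inner_diff_left has_derivative_at_withinI)
      show "onorm (\<lambda>v. (pq_grad r \<zeta> - pq_grad r \<theta>\<^sub>0) \<bullet> v) \<le> \<eta>"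
      proof (rule onorm_bound)
        fix v
        have "norm ((pq_grad r \<zeta> - pq_grad r \<theta>\<^sub>0) \<bullet> v) \<le> norm (pq_grad r \<zeta> - pq_grad r \<theta>\<^sub>0) * norm v"
          by (simp add: Cauchy_Schwarz_ineq2)
        also have "\<dots> \<le> \<eta> * norm v" using near[OF \<zeta>] r by (intro mult_right_mono) (auto intro: less_imp_le)
        finally show "norm ((pq_grad r \<zeta> - pq_grad r \<theta>\<^sub>0) \<bullet> v) \<le> \<eta> * norm v" .
      qed (use assms in simp)
    qed
    then show "\<bar>pq r \<theta> - pq r \<theta>' - pq_grad r \<theta>\<^sub>0 \<bullet> (\<theta> - \<theta>')\<bar> \<le> \<eta> * norm (\<theta> - \<theta>')"
      by (simp add: inner_diff_right algebra_simps)
  qed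
qed

text \<open>An interior maximiser is a critical point. The event and non-event parts of the
  derivative combine as S (1 - p) / p - (N - S) = (S - p N) / p, which produces the centred
  counts.\<close>

lemma score_equation:
  assumes x: "x \<in> set_pmf (Law \<theta> n)" and int: "est n x \<in> interior \<Theta>"
  shows "(\<Sum>r<K. (event_count K r x - pq r (est n x) * gate_count K r x) *\<^sub>R score_dir r (est n x)) = 0"
proof -
  let ?\<theta> = "est n x"
  let ?w = "\<Sum>r<K. (event_count K r x - pq r ?\<theta> * gate_count K r x) *\<^sub>R score_dir r ?\<theta>"
  have "(log_lik_sum x has_derivative (\<lambda>v. \<Sum>r<K. event_count K r x * (inverse (pq r ?\<theta>) * (pq_grad r ?\<theta> \<bullet> v))
      + (gate_count K r x - event_count K r x) * (inverse (1 - pq r ?\<theta>) * - (pq_grad r ?\<theta> \<bullet> v)))) (at ?\<theta>)"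
    unfolding log_lik_sum_def[abs_def] using pq_bounds
    by (auto intro!: derivative_eq_intros pq_deriv int simp: divide_inverse algebra_simps)
  moreover have "log_lik_sum x y \<le> log_lik_sum x ?\<theta>" if "y \<in> interior \<Theta>" for y
    using est_maximises(2)[OF x] that interior_subset by blast
  ultimately have zero: "(\<lambda>v. \<Sum>r<K. event_count K r x * (inverse (pq r ?\<theta>) * (pq_grad r ?\<theta> \<bullet> v))
      + (gate_count K r x - event_count K r x) * (inverse (1 - pq r ?\<theta>) * - (pq_grad r ?\<theta> \<bullet> v))) = (\<lambda>v. 0)"
    using int by (intro differential_zero_maxmin[OF int open_interior]) auto
  have "event_count K r x * (inverse (pq r ?\<theta>) * (pq_grad r ?\<theta> \<bullet> v))
      + (gate_count K r x - event_count K r x) * (inverse (1 - pq r ?\<theta>) * - (pq_grad r ?\<theta> \<bullet> v))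
    = ((event_count K r x - pq r ?\<theta> * gate_count K r x) *\<^sub>R score_dir r ?\<theta>) \<bullet> v" for r v
  proof -
    have "S * (inverse p * ((1 - p) * d)) + (N - S) * (inverse (1 - p) * - ((1 - p) * d)) = (S - p * N) * (1 / p * d)"
      if "0 < p" "p < 1" for S N p d :: real
      using that by (simp add: field_simps)
    from this[OF pq_bounds] show ?thesis by (simp add: pq_grad_def score_dir_def)
  qed
  with zero have w0: "?w \<bullet> v = 0" for v
    by (simp add: inner_sum_left fun_eq_iff)
  from w0[of ?w] show ?thesis by (simp only: inner_eq_zero_iff)
qed

subsection \<open>Local parameters\<close>

context
  fixes h :: "real^'d"
begin

definition local_param :: "nat \<Rightarrow> real^'d" where
  "local_param n = \<theta>\<^sub>0 + (1 / sqrt (real n)) *\<^sub>R h"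

lemma local_param_tendsto: "local_param \<longlonglongrightarrow> \<theta>\<^sub>0"
proof -
  have "(\<lambda>n. \<theta>\<^sub>0 + inverse (sqrt (real n)) *\<^sub>R h) \<longlonglongrightarrow> \<theta>\<^sub>0 + 0 *\<^sub>R h"
    by (intro tendsto_intros tendsto_inverse_0_at_top filterlim_compose[OF sqrt_at_top filterlim_real_sequentially])
  then show ?thesis by (simp add: local_param_def[abs_def] divide_inverse)
qed

lemma eventually_local_param_ball: "\<rho> > 0 \<Longrightarrow> \<forall>\<^sub>F n in sequentially. local_param n \<in> ball \<theta>\<^sub>0 \<rho>"
  using tendstoD[OF local_param_tendsto] by (simp add: dist_commute)

text \<open>The local parameter is at distance |h| / sqrt n from \<open>\<theta>\<^sub>0\<close>,
  and the increments of \<open>pq r\<close> from there are linearly bounded, so their squares are of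
  order 1 / n. Indices from K on have the constant value 1/2 and contribute 0.\<close>

lemma pq_local_param_bound:
  obtains B where "B \<ge> 0"
    "\<forall>\<^sub>F n in sequentially. \<forall>r. (pq r (local_param n) - pq r \<theta>\<^sub>0)\<^sup>2 / (pq r \<theta>\<^sub>0 * (1 - pq r \<theta>\<^sub>0)) \<le> B / n"
proof -
  obtain \<rho> where \<rho>: "\<rho> > 0" and diff: "\<And>r \<theta> \<theta>'. r < K \<Longrightarrow> \<theta> \<in> ball \<theta>\<^sub>0 \<rho> \<Longrightarrow> \<theta>' \<in> ball \<theta>\<^sub>0 \<rho> \<Longrightarrow>
       \<bar>pq r \<theta> - pq r \<theta>' - pq_grad r \<theta>\<^sub>0 \<bullet> (\<theta> - \<theta>')\<bar> \<le> 1 * norm (\<theta> - \<theta>')"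
    by (rule strict_differentiability[of 1]) auto
  define B where "B r = ((norm (pq_grad r \<theta>\<^sub>0) + 1) * norm h)\<^sup>2 / (pq r \<theta>\<^sub>0 * (1 - pq r \<theta>\<^sub>0))" for r
  have B0: "B r \<ge> 0" for r using pq_bounds[of r \<theta>\<^sub>0] by (simp add: B_def)
  show thesis
  proof (rule that[of "sum B {..<K}"])
    show "sum B {..<K} \<ge> 0" using B0 by (simp add: sum_nonneg)
    show "\<forall>\<^sub>F n in sequentially. \<forall>r. (pq r (local_param n) - pq r \<theta>\<^sub>0)\<^sup>2 / (pq r \<theta>\<^sub>0 * (1 - pq r \<theta>\<^sub>0)) \<le> sum B {..<K} / n"
      using eventually_local_param_ball[OF \<rho>] eventually_gt_at_top[of 0]
    proof eventually_elim
      case (elim n)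
      show ?case
      proof
        fix r
        show "(pq r (local_param n) - pq r \<theta>\<^sub>0)\<^sup>2 / (pq r \<theta>\<^sub>0 * (1 - pq r \<theta>\<^sub>0)) \<le> sum B {..<K} / n"
        proof (cases "r < K")
          case False
          then show ?thesis using B0 by (simp add: pq_def sum_nonneg)
        next
          case True
          have dn: "norm (local_param n - \<theta>\<^sub>0) = norm h / sqrt n"
            by (simp add: local_param_def)
          have "\<bar>pq_grad r \<theta>\<^sub>0 \<bullet> (local_param n - \<theta>\<^sub>0)\<bar> \<le> norm (pq_grad r \<theta>\<^sub>0) * norm (local_param n - \<theta>\<^sub>0)"
            by (rule Cauchy_Schwarz_ineq2)
          then have "\<bar>pq r (local_param n) - pq r \<theta>\<^sub>0\<bar> \<le> (norm (pq_grad r \<theta>\<^sub>0) + 1) * norm (local_param n - \<theta>\<^sub>0)"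
            using diff[OF True elim(1), of \<theta>\<^sub>0] \<rho> by (simp add: distrib_right)
          then have "(pq r (local_param n) - pq r \<theta>\<^sub>0)\<^sup>2 \<le> ((norm (pq_grad r \<theta>\<^sub>0) + 1) * norm h / sqrt n)\<^sup>2"
            unfolding dn by (intro abs_le_square_iff[THEN iffD1]) simp
          also have "\<dots> = ((norm (pq_grad r \<theta>\<^sub>0) + 1) * norm h)\<^sup>2 / n"
            by (simp add: power_divide)
          finally have "(pq r (local_param n) - pq r \<theta>\<^sub>0)\<^sup>2 / (pq r \<theta>\<^sub>0 * (1 - pq r \<theta>\<^sub>0))
              \<le> ((norm (pq_grad r \<theta>\<^sub>0) + 1) * norm h)\<^sup>2 / n / (pq r \<theta>\<^sub>0 * (1 - pq r \<theta>\<^sub>0))"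
            using pq_bounds[of r \<theta>\<^sub>0] by (intro divide_right_mono) auto
          also have "\<dots> = B r / n"
            by (simp only: B_def divide_divide_eq_left mult.commute)
          also have "\<dots> \<le> sum B {..<K} / n"
            using True B0 by (intro divide_right_mono member_le_sum) auto
          finally show ?thesis .
        qed
      qed
    qed
  qed
qed

text \<open>By \<open>path_law_contiguity\<close> with s = B / n, the squared probability is at most
  (1 + B / n)^n \<le> exp B times the one under \<open>\<theta>\<^sub>0\<close>. Gating frequencies
  and consistency are carried over to the local parameters in this way.\<close>

lemma contiguity:
  assumes "(\<lambda>n. measure_pmf.prob (Law \<theta>\<^sub>0 n) (A n)) \<longlonglongrightarrow> 0"
  shows "(\<lambda>n. measure_pmf.prob (Law (local_param n) n) (A n)) \<longlonglongrightarrow> 0"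
proof -
  obtain B where B: "B \<ge> 0" "\<forall>\<^sub>F n in sequentially. \<forall>r.
      (pq r (local_param n) - pq r \<theta>\<^sub>0)\<^sup>2 / (pq r \<theta>\<^sub>0 * (1 - pq r \<theta>\<^sub>0)) \<le> B / n"
    by (rule pq_local_param_bound)
  show ?thesis
  proof (rule tendsto_sandwich[OF _ _ tendsto_const])
    have "(\<lambda>n. sqrt (exp B * measure_pmf.prob (Law \<theta>\<^sub>0 n) (A n))) \<longlonglongrightarrow> sqrt (exp B * 0)"
      by (intro tendsto_intros assms)
    then show "(\<lambda>n. sqrt (exp B * measure_pmf.prob (Law \<theta>\<^sub>0 n) (A n))) \<longlonglongrightarrow> 0" by simp
    show "\<forall>\<^sub>F n in sequentially. measure_pmf.prob (Law (local_param n) n) (A n)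
        \<le> sqrt (exp B * measure_pmf.prob (Law \<theta>\<^sub>0 n) (A n))"
      using B(2) eventually_gt_at_top[of 0]
    proof eventually_elim
      case (elim n)
      have "(measure_pmf.prob (Law (local_param n) n) (A n))\<^sup>2 \<le> (1 + B / n) ^ n * measure_pmf.prob (Law \<theta>\<^sub>0 n) (A n)"
        unfolding Law_def using elim pq_bounds pq_in by (intro path_law_contiguity) auto
      also have "(1 + B / n) ^ n \<le> exp (B / n) ^ n"
        using B(1) by (intro power_mono) auto
      also have "exp (B / n) ^ n = exp B"
        using elim(2) by (simp add: exp_of_nat_mult[symmetric])
      finally have "(measure_pmf.prob (Law (local_param n) n) (A n))\<^sup>2 \<le> exp B * measure_pmf.prob (Law \<theta>\<^sub>0 n) (A n)"
        by (simp add: mult_right_mono)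
      then show ?case by (rule real_le_rsqrt)
    qed
  qed simp
qed

definition centred_count :: "nat \<Rightarrow> nat \<Rightarrow> (bool \<times> bool) list \<Rightarrow> real" where
  "centred_count n r x = (event_count K r x - pq r (local_param n) * gate_count K r x) / sqrt n"

text \<open>The gradient of the log-likelihood at the local parameter, divided by sqrt n, once that
  parameter lies in the interior of \<Theta>.\<close>

definition score :: "nat \<Rightarrow> (bool \<times> bool) list \<Rightarrow> real^'d" where
  "score n x = (\<Sum>r<K. centred_count n r x *\<^sub>R score_dir r (local_param n))"

text \<open>Projected on \<open>u\<close>, the score is the weighted sum of centred counts in
  \<open>score_char_tendsto\<close>. The limiting variance is the Fisher form because p (1 - p) (d /
  p)^2 = (1 - p) / p * d^2.\<close>

lemma score_char:
  "(\<lambda>n. measure_pmf.expectation (Law (local_param n) n) (\<lambda>x. iexp (u \<bullet> score n x)))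
    \<longlonglongrightarrow> exp (- (u \<bullet> (I\<^sub>0 *v u)) / 2)"
proof -
  have pq_lim: "(\<lambda>n. pq r (local_param n)) \<longlonglongrightarrow> pq r \<theta>\<^sub>0" if "r < K" for r
    by (rule isCont_tendsto_compose[OF has_derivative_continuous[OF pq_deriv[OF that interior]] local_param_tendsto])
  have dir_lim: "(\<lambda>n. u \<bullet> score_dir r (local_param n)) \<longlonglongrightarrow> u \<bullet> score_dir r \<theta>\<^sub>0" if "r < K" for r
    by (intro tendsto_intros isCont_tendsto_compose[OF continuous_at_grads(1)[OF that] local_param_tendsto])
  have "(\<lambda>n. measure_pmf.expectation (Law (local_param n) n) (\<lambda>x. iexp (\<Sum>r<K. (u \<bullet> score_dir r (local_param n)) *
        ((event_count K r x - pq r (local_param n) * gate_count K r x) / sqrt n))))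
    \<longlonglongrightarrow> exp (- (\<Sum>r<K. \<nu> r * (pq r \<theta>\<^sub>0 * (1 - pq r \<theta>\<^sub>0) * (u \<bullet> score_dir r \<theta>\<^sub>0)\<^sup>2)) / 2)"
    unfolding Law_def
    by (rule score_char_tendsto[OF K pq_in pq_lim dir_lim contiguity[OF freq\<^sub>0, unfolded Law_def]])
  moreover have "(\<Sum>r<K. (u \<bullet> score_dir r (local_param n)) *
        ((event_count K r x - pq r (local_param n) * gate_count K r x) / sqrt n)) = u \<bullet> score n x" for n x
    by (simp add: score_def centred_count_def inner_sum_right mult.commute)
  moreover have "(\<Sum>r<K. \<nu> r * (pq r \<theta>\<^sub>0 * (1 - pq r \<theta>\<^sub>0) * (u \<bullet> score_dir r \<theta>\<^sub>0)\<^sup>2)) = u \<bullet> (I\<^sub>0 *v u)"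
    unfolding I\<^sub>0 inner_sum_right
  proof (rule sum.cong[OF refl])
    fix r
    have "p * (1 - p) * (1 / p * d)\<^sup>2 = (1 - p) / p * d * d" if "p > 0" for p d :: real
      using that by (simp add: field_simps power2_eq_square)
    from this[OF pq_bounds(1)]
    show "\<nu> r * (pq r \<theta>\<^sub>0 * (1 - pq r \<theta>\<^sub>0) * (u \<bullet> score_dir r \<theta>\<^sub>0)\<^sup>2)
      = u \<bullet> (\<nu> r * ((1 - pq r \<theta>\<^sub>0) / pq r \<theta>\<^sub>0) * (D r \<theta>\<^sub>0 \<bullet> u)) *\<^sub>R D r \<theta>\<^sub>0"
      by (simp add: score_dir_def inner_commute[of "D r \<theta>\<^sub>0" u] mult.assoc)
  qed
  ultimately show ?thesis by (simp only:)
qed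

definition error :: "nat \<Rightarrow> (bool \<times> bool) list \<Rightarrow> real^'d" where
  "error n x = sqrt n *\<^sub>R (est n x - local_param n)"

text \<open>An exact identity, obtained by adding the score equation at the estimate, divided by
  sqrt n, as a zero. Recentring its counts at the local parameter splits off the gate frequency
  times the rescaled change of \<open>pq\<close>, to be matched with the information term. What
  remains are changes of \<open>score_dir\<close> and the linearisation error.\<close>

lemma score_expansion:
  assumes x: "x \<in> set_pmf (Law \<theta> n)" and n: "n > 0" and int: "est n x \<in> interior \<Theta>"
  shows "I\<^sub>0 *v error n x - score n x =
    (\<Sum>r<K. centred_count n r x *\<^sub>R (score_dir r (est n x) - score_dir r (local_param n))
      + ((\<nu> r * (pq_grad r \<theta>\<^sub>0 \<bullet> error n x)) *\<^sub>R score_dir r \<theta>\<^sub>0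
         - (gate_count K r x / n * (sqrt n * (pq r (est n x) - pq r (local_param n)))) *\<^sub>R score_dir r (est n x)))"
proof -
  let ?g = "\<lambda>r. (gate_count K r x / n * (sqrt n * (pq r (est n x) - pq r (local_param n)))) *\<^sub>R score_dir r (est n x)"
  have "0 = (1 / sqrt n) *\<^sub>R (\<Sum>r<K. (event_count K r x - pq r (est n x) * gate_count K r x) *\<^sub>R score_dir r (est n x))"
    using score_equation[OF x int] by simp
  also have "\<dots> = (\<Sum>r<K. centred_count n r x *\<^sub>R score_dir r (est n x)
      - ?g r)"
    unfolding scaleR_sum_right scaleR_left_diff_distrib[symmetric] scaleR_scaleR
  proof (rule sum.cong[OF refl], rule arg_cong[where f="\<lambda>c. c *\<^sub>R _"])
    fix r
    have "1 / w * (S - p * N) = (S - p' * N) / w - N / (w * w) * (w * (p - p'))" if "w > 0" for w S N p p' :: real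
      using that by (simp add: field_simps)
    from this[of "sqrt n"] n
    show "1 / sqrt n * (event_count K r x - pq r (est n x) * gate_count K r x) = centred_count n r x
      - gate_count K r x / n * (sqrt n * (pq r (est n x) - pq r (local_param n)))"
      by (simp add: centred_count_def)
  qed
  finally have zero: "(\<Sum>r<K. centred_count n r x *\<^sub>R score_dir r (est n x)
      - ?g r) = 0"
    by simp
  \<comment> \<open>The weight (1 - p) / p is split so that each phase pairs the gradient of
    \<open>pq\<close> with the gradient of the log-odds.\<close>
  have "I\<^sub>0 *v v = (\<Sum>r<K. (\<nu> r * (pq_grad r \<theta>\<^sub>0 \<bullet> v)) *\<^sub>R score_dir r \<theta>\<^sub>0)" for v
    unfolding I\<^sub>0 by (intro sum.cong) (simp_all add: pq_grad_def score_dir_def)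
  then have "I\<^sub>0 *v error n x - score n x = (\<Sum>r<K. (\<nu> r * (pq_grad r \<theta>\<^sub>0 \<bullet> error n x)) *\<^sub>R score_dir r \<theta>\<^sub>0
      - centred_count n r x *\<^sub>R score_dir r (local_param n)
      + (centred_count n r x *\<^sub>R score_dir r (est n x)
      - ?g r))"
    unfolding sum.distrib[of _ "\<lambda>r. centred_count n r x *\<^sub>R score_dir r (est n x) - _ r"] zero
    by (simp add: score_def sum_subtractf)
  also have "\<dots> = (\<Sum>r<K. centred_count n r x *\<^sub>R (score_dir r (est n x) - score_dir r (local_param n))
      + ((\<nu> r * (pq_grad r \<theta>\<^sub>0 \<bullet> error n x)) *\<^sub>R score_dir r \<theta>\<^sub>0
         - ?g r))"
    by (intro sum.cong refl) (simp only: scaleR_right_diff_distrib, simp)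
  finally show ?thesis .
qed

end
end

section \<open>Asymptotic normality\<close>

text \<open>The limit frequency, the linear part and the direction are exchanged for their actual
  values one at a time, at costs \<eta> B^2, \<eta> B and \<eta> B times the norm of
  \<open>y\<close>. The 1 in \<open>norm g + 1 \<le> B\<close> pays for |d| \<le> B * norm
  y.\<close>

lemma remainder_bound:
  fixes g s s\<^sub>0 y :: "'a::real_inner"
  assumes "\<bar>\<nu> - m\<bar> \<le> \<eta>" "0 \<le> m" "m \<le> 1" "norm g + 1 \<le> B" "norm s\<^sub>0 \<le> B" "norm (s - s\<^sub>0) \<le> \<eta>"
    "\<bar>d - g \<bullet> y\<bar> \<le> \<eta> * norm y" "\<eta> \<le> 1"
  shows "norm ((\<nu> * (g \<bullet> y)) *\<^sub>R s\<^sub>0 - (m * d) *\<^sub>R s) \<le> \<eta> * (B\<^sup>2 + 2 * B) * norm y"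
proof -
  have \<eta>: "\<eta> \<ge> 0" and B: "B \<ge> 0"
    using assms(1,5) norm_ge_zero[of s\<^sub>0] by linarith+
  have gy: "\<bar>g \<bullet> y\<bar> \<le> norm g * norm y" by (rule Cauchy_Schwarz_ineq2)
  also have gB: "\<dots> \<le> B * norm y" using assms(4) by (intro mult_right_mono) auto
  finally have gyB: "\<bar>g \<bullet> y\<bar> \<le> B * norm y" .
  have "\<eta> * norm y \<le> 1 * norm y" using assms(8) by (intro mult_right_mono) auto
  then have "\<bar>d\<bar> \<le> norm g * norm y + 1 * norm y" using assms(7) gy by linarith
  also have "\<dots> \<le> B * norm y" using assms(4) by (simp only: distrib_right[symmetric]) (intro mult_right_mono, auto)
  finally have dB: "\<bar>d\<bar> \<le> B * norm y" .
  have "(\<nu> * (g \<bullet> y)) *\<^sub>R s\<^sub>0 - (m * d) *\<^sub>R s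
      = ((\<nu> - m) * (g \<bullet> y)) *\<^sub>R s\<^sub>0 + (m * (g \<bullet> y - d)) *\<^sub>R s\<^sub>0 + (m * d) *\<^sub>R (s\<^sub>0 - s)"
    by (simp add: algebra_simps)
  also have "norm \<dots> \<le> norm (((\<nu> - m) * (g \<bullet> y)) *\<^sub>R s\<^sub>0) + norm ((m * (g \<bullet> y - d)) *\<^sub>R s\<^sub>0) + norm ((m * d) *\<^sub>R (s\<^sub>0 - s))"
    by (intro order_trans[OF norm_triangle_ineq] add_mono norm_triangle_ineq order_refl)
  also have "\<dots> \<le> (\<eta> * (B * norm y)) * B + (1 * (\<eta> * norm y)) * B + (1 * (B * norm y)) * \<eta>"
  proof (intro add_mono)
    show "norm (((\<nu> - m) * (g \<bullet> y)) *\<^sub>R s\<^sub>0) \<le> (\<eta> * (B * norm y)) * B"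
      unfolding norm_scaleR abs_mult using assms gyB \<eta> B by (intro mult_mono) auto
    show "norm ((m * (g \<bullet> y - d)) *\<^sub>R s\<^sub>0) \<le> (1 * (\<eta> * norm y)) * B"
      unfolding norm_scaleR abs_mult using assms \<eta> B by (intro mult_mono) (auto simp: abs_minus_commute)
    show "norm ((m * d) *\<^sub>R (s\<^sub>0 - s)) \<le> (1 * (B * norm y)) * \<eta>"
      unfolding norm_scaleR abs_mult using assms dB \<eta> B by (intro mult_mono) (auto simp: norm_minus_commute)
  qed
  also have "\<dots> = \<eta> * (B\<^sup>2 + 2 * B) * norm y" by (simp add: power2_eq_square algebra_simps)
  finally show ?thesis .
qed

lemma iexp_lipschitz: "cmod (iexp a - iexp b) \<le> \<bar>a - b\<bar>"
proof -
  have "iexp a - iexp b = iexp b * (iexp (a - b) - 1)"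
    by (simp add: right_diff_distrib exp_add[symmetric])
  moreover have "cmod (iexp (a - b) - 1) \<le> \<bar>a - b\<bar>"
    using iexp_approx1[of "a - b" 0] by simp
  ultimately show ?thesis by (simp add: norm_mult)
qed

section \<open>Linearisation of the estimator on a likely event\<close>

context ded_mle
begin

lemma I\<^sub>0_inverse: "matrix_inv I\<^sub>0 *v (I\<^sub>0 *v v) = v"
  using matrix_inv_invertible(2)[OF pos_definite_invertible[OF I\<^sub>0_pos]]
  by (simp add: matrix_vector_mul_assoc)

abbreviation local_law :: "real^'d \<Rightarrow> nat \<Rightarrow> (bool \<times> bool) list pmf" where
  "local_law h n \<equiv> Law (local_param h n) n"

abbreviation lin_error :: "real^'d \<Rightarrow> nat \<Rightarrow> (bool \<times> bool) list \<Rightarrow> real^'d" where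
  "lin_error h n x \<equiv> error h n x - matrix_inv I\<^sub>0 *v score h n x"

text \<open>The centred counts are only stochastically bounded, so \<open>R\<close> stays fixed;
  gate frequencies and estimator converge, so \<eta> and \<rho> may be as small as desired.\<close>

definition good_event :: "real^'d \<Rightarrow> nat \<Rightarrow> real \<Rightarrow> real \<Rightarrow> real \<Rightarrow> (bool \<times> bool) list set" where
  "good_event h n R \<eta> \<rho> = {x. (\<forall>r<K. \<bar>centred_count h n r x\<bar> \<le> R \<and> \<bar>gate_count K r x / n - \<nu> r\<bar> \<le> \<eta>)
     \<and> est n x \<in> ball \<theta>\<^sub>0 \<rho>}"

text \<open>\<open>L\<close> is chosen before \<eta>, which makes \<eta> * L arbitrarily small; the
  radius \<rho> is chosen after \<eta>.\<close>

abbreviation linearises :: "real^'d \<Rightarrow> real \<Rightarrow> real \<Rightarrow> real \<Rightarrow> bool" where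
  "linearises h R L \<eta> \<equiv> \<exists>\<rho>>0. \<forall>\<^sub>F n in sequentially. \<forall>x\<in>set_pmf (local_law h n) \<inter> good_event h n R \<eta> \<rho>.
     norm (error h n x) \<le> L \<and> norm (lin_error h n x) \<le> \<eta> * L"

text \<open>The remainder is at most \<eta> * (S + C * |Y|) for the rescaled error Y, on which no
  bound is known beforehand. Inverting \<open>I\<^sub>0\<close> gives |Y| \<le>
  \<open>L\<^sub>1\<close> / 2 + |Y| / 2 for small \<eta>, hence a bound on Y, and then a bound of
  order \<eta> on the linearisation error.\<close>

lemma error_bounds:
  assumes "R > 0"
  obtains L \<eta>\<^sub>0 where "L > 0" "\<eta>\<^sub>0 > 0"
    "\<And>\<eta>. 0 < \<eta> \<Longrightarrow> \<eta> \<le> \<eta>\<^sub>0 \<Longrightarrow> linearises h R L \<eta>"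
proof -
  obtain M where M: "M > 0" "\<And>w. norm (matrix_inv I\<^sub>0 *v w) \<le> M * norm w"
    using bounded_linear.pos_bounded[OF matrix_vector_mul_bounded_linear[of "matrix_inv I\<^sub>0"]] by (auto simp: mult.commute)
  define B where "B = 1 + (\<Sum>r<K. norm (score_dir r \<theta>\<^sub>0)) + (\<Sum>r<K. norm (pq_grad r \<theta>\<^sub>0))"
  have B: "norm (score_dir r \<theta>\<^sub>0) + 1 \<le> B" "norm (pq_grad r \<theta>\<^sub>0) + 1 \<le> B" if "r < K" for r
  proof -
    have "norm (score_dir r \<theta>\<^sub>0) \<le> (\<Sum>r<K. norm (score_dir r \<theta>\<^sub>0))"
      "norm (pq_grad r \<theta>\<^sub>0) \<le> (\<Sum>r<K. norm (pq_grad r \<theta>\<^sub>0))"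
      using that by (auto intro!: member_le_sum)
    moreover have "0 \<le> (\<Sum>r<K. norm (score_dir r \<theta>\<^sub>0))" "0 \<le> (\<Sum>r<K. norm (pq_grad r \<theta>\<^sub>0))"
      by (auto intro!: sum_nonneg)
    ultimately show "norm (score_dir r \<theta>\<^sub>0) + 1 \<le> B" "norm (pq_grad r \<theta>\<^sub>0) + 1 \<le> B"
      unfolding B_def by linarith+
  qed
  have "B \<ge> 1" unfolding B_def by (auto intro!: add_nonneg_nonneg sum_nonneg)
  \<comment> \<open>\<open>C\<close> and, below, \<open>S\<close> collect over the phases the
    linearisation error and the change of directions, with the factor \<eta> taken out. The score is
    bounded by K * (R * B) and the inverse information by \<open>M\<close>.\<close>
  define C where "C = K * (B\<^sup>2 + 2 * B)"
  have "C > 0" using K \<open>B \<ge> 1\<close> by (simp add: C_def add_pos_pos)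
  define S where "S = K * (2 * R)"
  have "S > 0" using K assms by (simp add: S_def)
  define L\<^sub>1 where "L\<^sub>1 = 2 * M * (K * (R * B) + S)"
  have "L\<^sub>1 > 0" using K assms M \<open>B \<ge> 1\<close> \<open>S > 0\<close> by (simp add: L\<^sub>1_def add_pos_pos)
  define L where "L = L\<^sub>1 + M * (S + C * L\<^sub>1)"
  have "L > 0" using M \<open>L\<^sub>1 > 0\<close> \<open>C > 0\<close> \<open>S > 0\<close> by (simp add: L_def add_pos_pos)
  \<comment> \<open>Makes M * C * \<eta> at most 1/2, so that the error on the right-hand side can
    be absorbed on the left.\<close>
  define \<eta>\<^sub>0 where "\<eta>\<^sub>0 = min 1 (1 / (2 * M * C))"
  have "\<eta>\<^sub>0 > 0" using M \<open>C > 0\<close> by (simp add: \<eta>\<^sub>0_def)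
  show thesis
  proof (rule that[OF \<open>L > 0\<close> \<open>\<eta>\<^sub>0 > 0\<close>])
    fix \<eta> :: real assume \<eta>: "0 < \<eta>" "\<eta> \<le> \<eta>\<^sub>0"
    then have "\<eta> \<le> 1" by (simp add: \<eta>\<^sub>0_def)
    have "\<eta> \<le> 1 / (2 * M * C)" using \<eta> by (simp add: \<eta>\<^sub>0_def)
    then have \<eta>_small: "2 * (M * (C * \<eta>)) \<le> 1" using M \<open>C > 0\<close> by (simp add: field_simps)
    obtain \<rho> where \<rho>: "\<rho> > 0" "ball \<theta>\<^sub>0 \<rho> \<subseteq> interior \<Theta>"
      and dir: "\<And>r \<theta>. r < K \<Longrightarrow> \<theta> \<in> ball \<theta>\<^sub>0 \<rho> \<Longrightarrow> norm (score_dir r \<theta> - score_dir r \<theta>\<^sub>0) \<le> \<eta>"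
      and diff: "\<And>r \<theta> \<theta>'. r < K \<Longrightarrow> \<theta> \<in> ball \<theta>\<^sub>0 \<rho> \<Longrightarrow> \<theta>' \<in> ball \<theta>\<^sub>0 \<rho> \<Longrightarrow>
       \<bar>pq r \<theta> - pq r \<theta>' - pq_grad r \<theta>\<^sub>0 \<bullet> (\<theta> - \<theta>')\<bar> \<le> \<eta> * norm (\<theta> - \<theta>')"
      using \<eta>(1) by (rule strict_differentiability) blast
    have "\<forall>\<^sub>F n in sequentially. \<forall>x\<in>set_pmf (local_law h n) \<inter> good_event h n R \<eta> \<rho>.
         norm (error h n x) \<le> L \<and> norm (lin_error h n x) \<le> \<eta> * L"
      using eventually_local_param_ball[OF \<rho>(1), of h] eventually_gt_at_top[of 0]
    proof eventually_elim
      case (elim n)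
      show ?case
      proof
        fix x assume "x \<in> set_pmf (local_law h n) \<inter> good_event h n R \<eta> \<rho>"
        then have x: "x \<in> set_pmf (local_law h n)" and est: "est n x \<in> ball \<theta>\<^sub>0 \<rho>"
          and cc: "\<And>r. r < K \<Longrightarrow> \<bar>centred_count h n r x\<bar> \<le> R"
          and fr: "\<And>r. r < K \<Longrightarrow> \<bar>gate_count K r x / n - \<nu> r\<bar> \<le> \<eta>"
          by (auto simp: good_event_def)
        let ?Y = "error h n x"
        have gate: "0 \<le> gate_count K r x / n" "gate_count K r x / n \<le> 1" for r
          using gate_count_bounds[of K r x] Law_length[OF x] elim(2) by auto
        have "norm (I\<^sub>0 *v ?Y - score h n x) \<le> (\<Sum>r<K. 2 * R * \<eta> + \<eta> * (B\<^sup>2 + 2 * B) * norm ?Y)"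
          unfolding score_expansion[OF x elim(2) subsetD[OF \<rho>(2) est]]
        proof (rule sum_norm_le, rule order_trans[OF norm_triangle_ineq], rule add_mono)
          fix r assume "r \<in> {..<K}"
          then have r: "r < K" by simp
          have "norm (score_dir r (est n x) - score_dir r (local_param h n)) \<le> 2 * \<eta>"
            using norm_triangle_ineq4[of "score_dir r (est n x) - score_dir r \<theta>\<^sub>0" "score_dir r (local_param h n) - score_dir r \<theta>\<^sub>0"]
              dir[OF r est] dir[OF r elim(1)] by simp
          then have "norm (centred_count h n r x *\<^sub>R (score_dir r (est n x) - score_dir r (local_param h n))) \<le> R * (2 * \<eta>)"
            unfolding norm_scaleR using cc[OF r] assms by (intro mult_mono) auto
          then show "norm (centred_count h n r x *\<^sub>R (score_dir r (est n x) - score_dir r (local_param h n))) \<le> 2 * R * \<eta>"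
            by (simp add: mult_ac)
          show "norm ((\<nu> r * (pq_grad r \<theta>\<^sub>0 \<bullet> ?Y)) *\<^sub>R score_dir r \<theta>\<^sub>0 -
              (gate_count K r x / n * (sqrt n * (pq r (est n x) - pq r (local_param h n)))) *\<^sub>R score_dir r (est n x))
            \<le> \<eta> * (B\<^sup>2 + 2 * B) * norm ?Y"
          proof (rule remainder_bound[OF _ gate B(2)[OF r] _ dir[OF r est] _ \<open>\<eta> \<le> 1\<close>])
            show "\<bar>\<nu> r - gate_count K r x / n\<bar> \<le> \<eta>" using fr[OF r] by linarith
            show "norm (score_dir r \<theta>\<^sub>0) \<le> B" using B(1)[OF r] by simp
            have "sqrt n * (pq r (est n x) - pq r (local_param h n)) - pq_grad r \<theta>\<^sub>0 \<bullet> ?Y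
              = sqrt n * (pq r (est n x) - pq r (local_param h n) - pq_grad r \<theta>\<^sub>0 \<bullet> (est n x - local_param h n))"
              by (simp add: error_def right_diff_distrib)
            then have "\<bar>sqrt n * (pq r (est n x) - pq r (local_param h n)) - pq_grad r \<theta>\<^sub>0 \<bullet> ?Y\<bar>
              \<le> sqrt n * (\<eta> * norm (est n x - local_param h n))"
              using diff[OF r est elim(1)] by (simp add: abs_mult mult_left_mono)
            then show "\<bar>sqrt n * (pq r (est n x) - pq r (local_param h n)) - pq_grad r \<theta>\<^sub>0 \<bullet> ?Y\<bar> \<le> \<eta> * norm ?Y"
              by (simp add: error_def mult_ac)
          qed
        qed
        also have "\<dots> = \<eta> * (S + C * norm ?Y)" by (simp add: S_def C_def algebra_simps)
        finally have rem: "norm (I\<^sub>0 *v ?Y - score h n x) \<le> \<eta> * (S + C * norm ?Y)" .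
        have "norm (score h n x) \<le> (\<Sum>r<K. R * B)"
          unfolding score_def
        proof (rule sum_norm_le)
          fix r assume "r \<in> {..<K}"
          then have r: "r < K" by simp
          have "norm (score_dir r (local_param h n)) \<le> B"
            using norm_triangle_ineq2[of "score_dir r (local_param h n)" "score_dir r \<theta>\<^sub>0"] dir[OF r elim(1)] B(1)[OF r] \<open>\<eta> \<le> 1\<close> by linarith
          then show "norm (centred_count h n r x *\<^sub>R score_dir r (local_param h n)) \<le> R * B"
            unfolding norm_scaleR using cc[OF r] assms by (intro mult_mono) auto
        qed
        then have sc: "norm (score h n x) \<le> K * (R * B)" by simp
        have "norm ?Y \<le> M * norm (I\<^sub>0 *v ?Y)" using M(2)[of "I\<^sub>0 *v ?Y"] by (simp add: I\<^sub>0_inverse)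
        also have "norm (I\<^sub>0 *v ?Y) \<le> norm (I\<^sub>0 *v ?Y - score h n x) + norm (score h n x)"
          using norm_triangle_ineq[of "I\<^sub>0 *v ?Y - score h n x" "score h n x"] by simp
        also have "\<dots> \<le> (1 * S + \<eta> * C * norm ?Y) + K * (R * B)"
        proof (rule add_mono[OF order_trans[OF rem] sc])
          have "\<eta> * S \<le> 1 * S" using \<open>\<eta> \<le> 1\<close> \<open>S > 0\<close> by (intro mult_right_mono) auto
          then show "\<eta> * (S + C * norm ?Y) \<le> 1 * S + \<eta> * C * norm ?Y" by (simp add: distrib_left)
        qed
        finally have "norm ?Y \<le> M * (1 * S + \<eta> * C * norm ?Y + K * (R * B))"
          using M(1) by simp
        also have "\<dots> = L\<^sub>1 / 2 + (M * (C * \<eta>)) * norm ?Y" by (simp add: L\<^sub>1_def algebra_simps)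
        also have "\<dots> \<le> L\<^sub>1 / 2 + 1 / 2 * norm ?Y"
          using \<eta>_small by (intro add_left_mono mult_right_mono) auto
        finally have Y: "norm ?Y \<le> L\<^sub>1" by simp
        have "?Y - matrix_inv I\<^sub>0 *v score h n x = matrix_inv I\<^sub>0 *v (I\<^sub>0 *v ?Y - score h n x)"
          by (simp add: matrix_vector_mult_diff_distrib I\<^sub>0_inverse)
        then have "norm (?Y - matrix_inv I\<^sub>0 *v score h n x) \<le> M * (\<eta> * (S + C * norm ?Y))"
          using M(2)[of "I\<^sub>0 *v ?Y - score h n x"] rem M(1) by (simp add: order_trans mult_left_mono)
        also have "\<dots> \<le> M * (\<eta> * (S + C * L\<^sub>1))"
          using M(1) \<eta>(1) \<open>C > 0\<close> Y by (intro mult_left_mono add_left_mono) auto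
        also have "\<dots> = \<eta> * (M * (S + C * L\<^sub>1))" by (simp add: mult_ac)
        also have "\<dots> \<le> \<eta> * L" using \<eta>(1) \<open>L\<^sub>1 > 0\<close> by (intro mult_left_mono) (auto simp: L_def)
        finally have close: "norm (?Y - matrix_inv I\<^sub>0 *v score h n x) \<le> \<eta> * L" .
        have "L\<^sub>1 \<le> L" using M(1) \<open>S > 0\<close> \<open>C > 0\<close> \<open>L\<^sub>1 > 0\<close> by (simp add: L_def add_nonneg_nonneg)
        then show "norm ?Y \<le> L \<and> norm (?Y - matrix_inv I\<^sub>0 *v score h n x) \<le> \<eta> * L"
          using Y close by linarith
      qed
    qed
    then show "linearises h R L \<eta>"
      using \<rho>(1) by blast
  qed
qed

text \<open>Chebyshev controls the centred counts with an \<open>R\<close> chosen before \<eta> and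
  \<rho>. The other two conditions fail with vanishing probability, by contiguity.\<close>

lemma good_event_likely:
  assumes "e > 0"
  obtains R where "R > 0" "\<And>\<eta> \<rho>. \<eta> > 0 \<Longrightarrow> \<rho> > 0 \<Longrightarrow>
    \<forall>\<^sub>F n in sequentially. measure_pmf.prob (local_law h n) (- good_event h n R \<eta> \<rho>) \<le> e"
proof -
  \<comment> \<open>As R \<ge> 1, the chain 2 * K / e \<le> R \<le> R^2 gives K / R^2 \<le> e / 2,
    which is the Chebyshev bound summed over the phases.\<close>
  define R where "R = 1 + 2 * K / e"
  have "R \<ge> 1" using assms by (simp add: R_def)
  have "2 * K / e \<le> R" by (simp add: R_def)
  also have "R \<le> R\<^sup>2" using \<open>R \<ge> 1\<close> by (simp add: power2_eq_square)
  finally have R: "K * (1 / R\<^sup>2) \<le> e / 2" using assms \<open>R \<ge> 1\<close> by (simp add: field_simps)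
  show thesis
  proof (rule that[of R])
    show "R > 0" using \<open>R \<ge> 1\<close> by simp
    fix \<eta> \<rho> :: real assume "\<eta> > 0" "\<rho> > 0"
    let ?Q = "\<lambda>n. local_law h n"
    define A where "A n = (\<Union>r\<in>{..<K}. {x. \<bar>centred_count h n r x\<bar> > R})" for n
    \<comment> \<open>With half of \<rho>, the failure of the strict inequality still gives
      membership in the open ball of radius \<rho>.\<close>
    define B where "B n = (\<Union>r\<in>{..<K}. {x. \<bar>gate_count K r x / n - \<nu> r\<bar> > \<eta>}) \<union> {x. dist (est n x) \<theta>\<^sub>0 > \<rho> / 2}" for n
    have A: "measure_pmf.prob (?Q n) (A n) \<le> e / 2" for n
    proof -
      have "measure_pmf.prob (?Q n) (A n) \<le> (\<Sum>r<K. measure_pmf.prob (?Q n) {x. \<bar>centred_count h n r x\<bar> > R})"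
        unfolding A_def by (rule measure_pmf.finite_measure_subadditive_finite) auto
      also have "\<dots> \<le> (\<Sum>r<K. 1 / R\<^sup>2)"
      proof (rule sum_mono)
        fix r
        show "measure_pmf.prob (?Q n) {x. \<bar>centred_count h n r x\<bar> > R} \<le> 1 / R\<^sup>2"
          unfolding Law_def centred_count_def
          using prob_centred_count_gt[OF K, of "\<lambda>n r. pq r (local_param h n)"] pq_in \<open>R \<ge> 1\<close> by simp
      qed
      also have "\<dots> \<le> e / 2" using R by simp
      finally show ?thesis .
    qed
    have "(\<lambda>n. measure_pmf.prob (?Q n) (B n)) \<longlonglongrightarrow> 0"
      unfolding B_def using \<open>\<eta> > 0\<close> \<open>\<rho> > 0\<close>
      by (intro prob_tendsto_zero_Un prob_tendsto_zero_UN contiguity freq\<^sub>0 est_consistent) auto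
    then have "\<forall>\<^sub>F n in sequentially. measure_pmf.prob (?Q n) (B n) < e / 2"
      using assms by (intro order_tendstoD(2)[where y=0]) auto
    then show "\<forall>\<^sub>F n in sequentially. measure_pmf.prob (?Q n) (- good_event h n R \<eta> \<rho>) \<le> e"
    proof eventually_elim
      case (elim n)
      have "- good_event h n R \<eta> \<rho> \<subseteq> A n \<union> B n"
        using \<open>\<rho> > 0\<close> by (auto simp: good_event_def A_def B_def dist_commute not_le)
      then have "measure_pmf.prob (?Q n) (- good_event h n R \<eta> \<rho>) \<le> measure_pmf.prob (?Q n) (A n \<union> B n)"
        by (intro measure_pmf.finite_measure_mono) auto
      also have "\<dots> \<le> measure_pmf.prob (?Q n) (A n) + measure_pmf.prob (?Q n) (B n)"
        by (intro measure_Un_le) auto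
      finally show ?case using A[of n] elim by linarith
    qed
  qed
qed

lemma prob_le_if_good:
  assumes "\<And>x. x \<in> set_pmf Q \<inter> G \<Longrightarrow> x \<notin> A"
  shows "measure_pmf.prob Q A \<le> measure_pmf.prob Q (- G)"
proof -
  have "measure_pmf.prob Q A = measure_pmf.prob Q (A \<inter> set_pmf Q)"
    by (simp add: measure_Int_set_pmf)
  also have "\<dots> \<le> measure_pmf.prob Q (- G)"
    using assms by (intro measure_pmf.finite_measure_mono) auto
  finally show ?thesis .
qed

lemma error_tight:
  assumes "e > 0"
  shows "\<exists>R>0. \<forall>\<^sub>F n in sequentially. measure_pmf.prob (local_law h n) {x. norm (error h n x) > R} \<le> e"
proof -
  obtain R where R: "R > 0" and good: "\<And>\<eta> \<rho>. \<eta> > 0 \<Longrightarrow> \<rho> > 0 \<Longrightarrow>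
    \<forall>\<^sub>F n in sequentially. measure_pmf.prob (local_law h n) (- good_event h n R \<eta> \<rho>) \<le> e"
    by (rule good_event_likely[OF assms, of h]) blast
  obtain L \<eta>\<^sub>0 where L: "L > 0" "\<eta>\<^sub>0 > 0"
    and bnd: "\<And>\<eta>. 0 < \<eta> \<Longrightarrow> \<eta> \<le> \<eta>\<^sub>0 \<Longrightarrow> linearises h R L \<eta>"
    by (rule error_bounds[OF R, of h]) blast
  obtain \<rho> where \<rho>: "\<rho> > 0" and ev: "\<forall>\<^sub>F n in sequentially.
       \<forall>x\<in>set_pmf (local_law h n) \<inter> good_event h n R \<eta>\<^sub>0 \<rho>.
         norm (error h n x) \<le> L \<and> norm (lin_error h n x) \<le> \<eta>\<^sub>0 * L"
    using bnd[OF L(2)] by auto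
  have "\<forall>\<^sub>F n in sequentially. measure_pmf.prob (local_law h n) {x. norm (error h n x) > L} \<le> e"
    using ev good[OF L(2) \<rho>]
  proof eventually_elim
    case (elim n)
    show ?case
      by (rule order_trans[OF prob_le_if_good elim(2)]) (use elim(1) in \<open>auto simp: not_less\<close>)
  qed
  with L show ?thesis by blast
qed

lemma error_close_to_score:
  assumes "\<delta> > 0"
  shows "(\<lambda>n. measure_pmf.prob (local_law h n)
     {x. norm (lin_error h n x) > \<delta>}) \<longlonglongrightarrow> 0"
proof (rule tendstoI)
  fix e :: real assume "e > 0"
  obtain R where R: "R > 0" and good: "\<And>\<eta> \<rho>. \<eta> > 0 \<Longrightarrow> \<rho> > 0 \<Longrightarrow>
    \<forall>\<^sub>F n in sequentially. measure_pmf.prob (local_law h n) (- good_event h n R \<eta> \<rho>) \<le> e / 2"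
    by (rule good_event_likely[of "e / 2" h]) (use \<open>e > 0\<close> in auto)
  obtain L \<eta>\<^sub>0 where L: "L > 0" "\<eta>\<^sub>0 > 0"
    and bnd: "\<And>\<eta>. 0 < \<eta> \<Longrightarrow> \<eta> \<le> \<eta>\<^sub>0 \<Longrightarrow> linearises h R L \<eta>"
    by (rule error_bounds[OF R, of h]) blast
  define \<eta> where "\<eta> = min \<eta>\<^sub>0 (\<delta> / L)"
  have \<eta>: "\<eta> > 0" "\<eta> \<le> \<eta>\<^sub>0" "\<eta> * L \<le> \<delta>"
  proof -
    show "\<eta> > 0" "\<eta> \<le> \<eta>\<^sub>0" using L assms by (auto simp: \<eta>_def)
    have "\<eta> \<le> \<delta> / L" by (simp add: \<eta>_def)
    then show "\<eta> * L \<le> \<delta>" using L by (simp add: field_simps)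
  qed
  obtain \<rho> where \<rho>: "\<rho> > 0" and ev: "\<forall>\<^sub>F n in sequentially.
       \<forall>x\<in>set_pmf (local_law h n) \<inter> good_event h n R \<eta> \<rho>.
         norm (error h n x) \<le> L \<and> norm (lin_error h n x) \<le> \<eta> * L"
    using bnd[OF \<eta>(1,2)] by auto
  show "\<forall>\<^sub>F n in sequentially. dist (measure_pmf.prob (local_law h n)
     {x. norm (lin_error h n x) > \<delta>}) 0 < e"
    using ev good[OF \<eta>(1) \<rho>]
  proof eventually_elim
    case (elim n)
    have "measure_pmf.prob (local_law h n) {x. norm (lin_error h n x) > \<delta>} \<le> e / 2"
    proof (rule order_trans[OF prob_le_if_good elim(2)])
      fix x assume "x \<in> set_pmf (local_law h n) \<inter> good_event h n R \<eta> \<rho>"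
      then have "norm (lin_error h n x) \<le> \<delta>"
        using elim(1) \<eta>(3) by (blast intro: order_trans)
      then show "x \<notin> {x. norm (lin_error h n x) > \<delta>}" by simp
    qed
    then show ?case using \<open>e > 0\<close> by simp
  qed
qed

text \<open>Slutsky's argument: \<open>iexp\<close> is 1-Lipschitz, so the error may be replaced by
  its linear approximation. Moving the inverse information onto \<open>u\<close> gives a vector
  \<open>v\<close> at which the Fisher form equals that of the inverse information at
  \<open>u\<close>.\<close>

lemma error_char:
  "(\<lambda>n. measure_pmf.expectation (local_law h n) (\<lambda>x. iexp (u \<bullet> error h n x)))
    \<longlonglongrightarrow> exp (- (u \<bullet> (matrix_inv I\<^sub>0 *v u)) / 2)"
proof -
  let ?Q = "\<lambda>n. local_law h n"
  define v where "v = transpose (matrix_inv I\<^sub>0) *v u"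
  have adj: "u \<bullet> (matrix_inv I\<^sub>0 *v w) = v \<bullet> w" for w
    unfolding v_def by (metis dot_lmul_matrix transpose_matrix_vector)
  have "v \<bullet> (I\<^sub>0 *v v) = u \<bullet> (matrix_inv I\<^sub>0 *v u)"
    by (metis adj I\<^sub>0_inverse inner_commute)
  then have lim: "(\<lambda>n. measure_pmf.expectation (?Q n) (\<lambda>x. iexp (v \<bullet> score h n x)))
     \<longlonglongrightarrow> exp (- (u \<bullet> (matrix_inv I\<^sub>0 *v u)) / 2)"
    using score_char[of h v] by simp
  have close: "(\<lambda>n. measure_pmf.expectation (?Q n) (\<lambda>x. iexp (u \<bullet> error h n x) - iexp (v \<bullet> score h n x))) \<longlonglongrightarrow> 0"
  proof (rule expectation_tendsto_zero)
    show "\<forall>\<^sub>F n in sequentially. \<forall>x\<in>set_pmf (?Q n). norm (iexp (u \<bullet> error h n x) - iexp (v \<bullet> score h n x)) \<le> 2"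
      by (intro always_eventually allI ballI order_trans[OF norm_triangle_ineq4]) simp
    fix e :: real assume "e > 0"
    show "(\<lambda>n. measure_pmf.prob (?Q n) {x. norm (iexp (u \<bullet> error h n x) - iexp (v \<bullet> score h n x)) > e}) \<longlonglongrightarrow> 0"
    proof (rule prob_tendsto_zero_mono[OF error_close_to_score[of "e / (norm u + 1)" h]])
      show "e / (norm u + 1) > 0" using \<open>e > 0\<close> by (simp add: add_nonneg_pos)
      show "\<forall>\<^sub>F n in sequentially. {x. norm (iexp (u \<bullet> error h n x) - iexp (v \<bullet> score h n x)) > e} \<inter> set_pmf (?Q n)
         \<subseteq> {x. norm (lin_error h n x) > e / (norm u + 1)}"
      proof (intro always_eventually allI subsetI)
        fix n x assume "x \<in> {x. norm (iexp (u \<bullet> error h n x) - iexp (v \<bullet> score h n x)) > e} \<inter> set_pmf (?Q n)"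
        then have "e < cmod (iexp (u \<bullet> error h n x) - iexp (v \<bullet> score h n x))" by simp
        also have "\<dots> \<le> \<bar>u \<bullet> error h n x - v \<bullet> score h n x\<bar>" by (rule iexp_lipschitz)
        also have "u \<bullet> error h n x - v \<bullet> score h n x = u \<bullet> (lin_error h n x)"
          by (simp add: inner_diff_right adj)
        also have "\<bar>\<dots>\<bar> \<le> norm u * norm (lin_error h n x)"
          by (rule Cauchy_Schwarz_ineq2)
        also have "\<dots> \<le> (norm u + 1) * norm (lin_error h n x)"
          by (intro mult_right_mono) auto
        finally show "x \<in> {x. norm (lin_error h n x) > e / (norm u + 1)}"
          using norm_ge_zero[of u] by (simp add: divide_less_eq mult.commute add_nonneg_pos)
      qed
    qed
  qed
  have int: "integrable (measure_pmf (?Q n)) f" for n and f :: "_ \<Rightarrow> complex"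
    unfolding Law_def by (intro integrable_path_law pq_in)
  show ?thesis
    using tendsto_add[OF close lim] by (simp add: Bochner_Integration.integral_diff[OF int int])
qed

text \<open>Equality of the laws is asked only eventually, because \<open>P\<close> is unconstrained
  outside \<Theta> and the local parameter is sure to lie in \<Theta> only for large n.\<close>

lemma error_weak_conv:
  assumes \<mu>: "\<forall>\<^sub>F n in sequentially. \<mu> n = distr (measure_pmf (local_law h n)) borel (error h n)"
  shows "weak_conv_borel \<mu> (mv_normal 0 (matrix_inv I\<^sub>0))"
proof (rule weak_conv_borel_if_char_tight)
  show "\<forall>\<^sub>F n in sequentially. prob_space (\<mu> n) \<and> sets (\<mu> n) = sets borel"
    using \<mu> by eventually_elim (auto intro!: measure_pmf.prob_space_distr)
  show "prob_space (mv_normal 0 (matrix_inv I\<^sub>0))" by (rule prob_space_mv_normal[OF I\<^sub>0_pos])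
  show "sets (mv_normal 0 (matrix_inv I\<^sub>0)) = sets borel" by (simp add: mv_normal_def)
next
  fix e :: real assume "e > 0"
  obtain R where R: "R > 0" and ev: "\<forall>\<^sub>F n in sequentially. measure_pmf.prob (local_law h n) {x. norm (error h n x) > R} \<le> e"
    using error_tight[OF \<open>e > 0\<close>, of h] by blast
  have "\<forall>\<^sub>F n in sequentially. measure (\<mu> n) {x. norm x > R} \<le> e"
    using ev \<mu> by eventually_elim (simp add: measure_distr vimage_def)
  with R show "\<exists>R>0. \<forall>\<^sub>F n in sequentially. measure (\<mu> n) {x. norm x > R} \<le> e" by blast
next
  fix u :: "real^'d"
  have "\<forall>\<^sub>F n in sequentially. measure_pmf.expectation (local_law h n) (\<lambda>x. iexp (u \<bullet> error h n x)) = (CLINT x|\<mu> n. iexp (u \<bullet> x))"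
    using \<mu> by eventually_elim (simp add: integral_distr)
  with error_char[of h u]
  show "(\<lambda>n. CLINT x|\<mu> n. iexp (u \<bullet> x)) \<longlonglongrightarrow> (CLINT x|mv_normal 0 (matrix_inv I\<^sub>0). iexp (u \<bullet> x))"
    unfolding char_mv_normal[OF I\<^sub>0_pos] by (rule Lim_transform_eventually)
qed

end

section \<open>Smoothness and gating frequencies\<close>

text \<open>The vector of values of the derivative on the basis represents it by inner products;
  uniqueness of derivatives makes the definite description in \<open>gradient\<close>
  meaningful.\<close>

lemma gradient_has_derivative:
  fixes f :: "'a::euclidean_space \<Rightarrow> real"
  assumes "(f has_derivative f') (at x)"
  shows "gradient f x = (\<Sum>b\<in>Basis. f' b *\<^sub>R b)" "(f has_derivative (\<lambda>v. gradient f x \<bullet> v)) (at x)"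
proof -
  interpret f': bounded_linear f' by (rule has_derivative_bounded_linear[OF assms])
  define d where "d = (\<Sum>b\<in>Basis. f' b *\<^sub>R b)"
  have f'_eq: "f' v = d \<bullet> v" for v
  proof -
    have "f' v = f' (\<Sum>b\<in>Basis. (v \<bullet> b) *\<^sub>R b)" by (simp add: euclidean_representation)
    also have "\<dots> = d \<bullet> v"
      by (simp only: f'.sum f'.scale d_def inner_sum_left inner_scaleR_left real_scaleR_def inner_commute[of v] mult.commute)
    finally show ?thesis .
  qed
  have d: "GDERIV f x :> d"
    unfolding gderiv_def using assms by (simp add: f'_eq[abs_def] inner_commute)
  have "gradient f x = d" unfolding gradient_def
  proof (rule the_equality)
    show "GDERIV f x :> d" by (rule d)
  next
    fix d' assume "GDERIV f x :> d'"
    then have "(\<lambda>h. h \<bullet> d') = (\<lambda>h. h \<bullet> d)"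
      using d unfolding gderiv_def by (rule has_derivative_unique)
    then have "(d' - d) \<bullet> (d' - d) = 0" by (metis inner_diff_right cancel_comm_monoid_add_class.diff_cancel)
    then show "d' = d" by simp
  qed
  then show "gradient f x = (\<Sum>b\<in>Basis. f' b *\<^sub>R b)" "(f has_derivative (\<lambda>v. gradient f x \<bullet> v)) (at x)"
    using assms by (simp_all add: f'_eq[abs_def] euclidean_representation)
qed

text \<open>The directional derivatives of \<open>g\<close> are themselves differentiable, hence
  continuous, and on the basis they are the coordinates of the gradient. Agreement on the open set
  \<open>S\<close> transfers derivatives from \<open>g\<close> to \<open>f\<close>.\<close>

lemma C_k_on_gradient:
  fixes f g :: "'a::euclidean_space \<Rightarrow> real"
  assumes g: "C_k_on (Suc (Suc k)) g V" and S: "open S" "S \<subseteq> V" and eq: "\<And>x. x \<in> S \<Longrightarrow> f x = g x"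
  shows "x \<in> S \<Longrightarrow> (f has_derivative (\<lambda>v. gradient f x \<bullet> v)) (at x)" "continuous_on S (gradient f)"
proof -
  have f_deriv: "(f has_derivative frechet_derivative g (at x)) (at x)" if "x \<in> S" for x
  proof (rule has_derivative_transform_within_open[OF _ S(1) that])
    show "(g has_derivative frechet_derivative g (at x)) (at x)"
      using g S that by (auto simp: frechet_derivative_works[symmetric])
  qed (simp add: eq)
  then show "x \<in> S \<Longrightarrow> (f has_derivative (\<lambda>v. gradient f x \<bullet> v)) (at x)"
    by (rule gradient_has_derivative(2))
  have "continuous_on S (\<lambda>x. frechet_derivative g (at x) v)" for v
    using g S by (auto intro!: differentiable_imp_continuous_on simp: differentiable_on_def subset_iff differentiable_at_withinI)
  then have "continuous_on S (\<lambda>x. \<Sum>b\<in>Basis. frechet_derivative g (at x) b *\<^sub>R b)"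
    by (intro continuous_intros)
  then show "continuous_on S (gradient f)"
    by (rule continuous_on_eq) (simp add: gradient_has_derivative(1)[OF f_deriv])
qed

text \<open>On a countable type agreement on singletons suffices; lists of a length other than
  \<open>T\<close> have mass zero under both laws.\<close>

lemma obs_law_eq_path_law:
  fixes P :: "'p \<Rightarrow> 'w measure"
  assumes "path_kernel \<kappa>" "prob_space (P \<theta>)" and om: "obs G Y T \<in> measurable (P \<theta>) (count_space UNIV)"
    and eq: "\<And>x. length x = T \<Longrightarrow> measure (obs_law P G Y \<theta> T) {x} = path_prob \<kappa> q x" and q: "\<And>t. q t \<in> {0..1}"
  shows "obs_law P G Y \<theta> T = measure_pmf (path_law \<kappa> q T)"
proof -
  interpret path_kernel \<kappa> by fact
  interpret P: prob_space "P \<theta>" by fact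
  interpret L: prob_space "obs_law P G Y \<theta> T"
    unfolding obs_law_def by (rule P.prob_space_distr[OF om])
  show ?thesis
  proof (rule measure_eqI_countable[of _ UNIV])
    fix x :: "(bool \<times> bool) list"
    have "measure (obs_law P G Y \<theta> T) {x} = pmf (path_law \<kappa> q T) x"
    proof (cases "length x = T")
      case True
      then show ?thesis using eq q by (simp add: pmf_path_law)
    next
      case False
      then have "obs G Y T -` {x} \<inter> space (P \<theta>) = {}" by (auto simp: obs_def)
      then show ?thesis using False q om by (simp add: pmf_path_law obs_law_def measure_distr)
    qed
    then show "emeasure (obs_law P G Y \<theta> T) {x} = emeasure (measure_pmf (path_law \<kappa> q T)) {x}"
      by (simp add: L.emeasure_eq_measure measure_pmf.emeasure_eq_measure measure_pmf_single)
  qed (auto simp: obs_law_def)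
qed

text \<open>The number of t < n with t mod K = r, that is, the ceiling of (n - r) / K. Adding K - 1
  first keeps the subtraction of natural numbers from truncating when r < K.\<close>

definition phase_length :: "nat \<Rightarrow> nat \<Rightarrow> nat \<Rightarrow> nat" where
  "phase_length K r n = (n + K - 1 - r) div K"

lemma gate_count_obs:
  assumes "r < K"
  shows "gate_count K r (obs G Y n \<omega>) = (\<Sum>l<phase_length K r n. of_bool (G (r + l * K) \<omega>))"
proof -
  have less: "l < phase_length K r n \<longleftrightarrow> r + l * K < n" for l
  proof -
    have "l < phase_length K r n \<longleftrightarrow> Suc l * K \<le> n + K - 1 - r"
      unfolding phase_length_def using assms by (subst less_eq_div_iff_mult_less_eq[symmetric]) auto
    then show ?thesis using assms by auto
  qed
  have "gate_count K r (obs G Y n \<omega>) = (\<Sum>t<n. of_bool (t mod K = r) * of_bool (G t \<omega>))"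
    by (simp add: gate_count_def obs_def)
  also have "\<dots> = (\<Sum>t\<in>{t\<in>{..<n}. t mod K = r}. of_bool (G t \<omega>))"
    unfolding sum.inter_filter[OF finite_lessThan] by (intro sum.cong) auto
  also have "\<dots> = (\<Sum>l<phase_length K r n. of_bool (G (r + l * K) \<omega>))"
  proof (rule sum.reindex_bij_witness[where i="\<lambda>l. r + l * K" and j="\<lambda>t. t div K"])
    fix t assume t: "t \<in> {t\<in>{..<n}. t mod K = r}"
    then show rt: "r + t div K * K = t" using mod_div_mult_eq[of t K] by auto
    show "t div K \<in> {..<phase_length K r n}" using t rt by (simp add: less)
    show "of_bool (G (r + t div K * K) \<omega>) = of_bool (G t \<omega>)" using rt by simp
  qed (use assms less in auto)
  finally show ?thesis .
qed

lemma phase_length_asymp: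
  assumes "r < K" "n > 0"
  shows "\<bar>phase_length K r n / n - 1 / K\<bar> \<le> 1 / n"
proof -
  have "phase_length K r n * K \<le> n + K - 1 - r" "n + K - 1 - r < phase_length K r n * K + K"
    unfolding phase_length_def using assms mod_less_divisor[of K "n + K - 1 - r"] div_mult_mod_eq[of "n + K - 1 - r" K]
    by linarith+
  then have "phase_length K r n * K \<le> n + K" "n \<le> phase_length K r n * K + K"
    using assms by auto
  then have "\<bar>real (phase_length K r n * K) - real n\<bar> \<le> K" by linarith
  moreover have "phase_length K r n / n - 1 / K = (real (phase_length K r n * K) - real n) / (n * K)"
    using assms by (simp add: field_simps)
  ultimately show ?thesis using assms by (simp add: field_simps)
qed

lemma filterlim_phase_length:
  assumes "r < K"
  shows "filterlim (phase_length K r) at_top sequentially"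
  unfolding filterlim_at_top
proof
  fix m
  show "\<forall>\<^sub>F n in sequentially. m \<le> phase_length K r n"
  proof (rule eventually_sequentiallyI)
    fix n assume "m * K + r \<le> n"
    then show "m \<le> phase_length K r n"
      unfolding phase_length_def using assms by (subst less_eq_div_iff_mult_less_eq) auto
  qed
qed

text \<open>The count is the phase length \<open>L\<close> times the gating frequency over
  \<open>L\<close> periods. As \<open>L\<close> tends to infinity with n, the assumed limit may be
  composed with it, and L / n tends to 1 / K.\<close>

lemma gate_count_frequency:
  fixes M :: "'w measure"
  assumes r: "r < K" and M: "prob_space M" and G: "\<And>t. G t \<in> measurable M (count_space UNIV)"
    and lim: "tendsto_in_prob (\<lambda>_. M) (gating_freq K G r) c" and c: "c \<in> {0..1}" and "e > 0"
  shows "(\<lambda>n. measure M {\<omega> \<in> space M. \<bar>gate_count K r (obs G Y n \<omega>) / n - c / K\<bar> > e}) \<longlonglongrightarrow> 0"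
proof -
  interpret prob_space M by fact
  have [measurable]: "gating_freq K G r L \<in> borel_measurable M" for L
    using G unfolding gating_freq_def[abs_def] by measurable
  have "(\<lambda>L. prob {\<omega> \<in> space M. dist (gating_freq K G r L \<omega>) c > e / 4}) \<longlonglongrightarrow> 0"
    using lim[unfolded tendsto_in_prob_def, rule_format, of "e / 4"] \<open>e > 0\<close> by simp
  then have lim': "(\<lambda>n. prob {\<omega> \<in> space M. dist (gating_freq K G r (phase_length K r n) \<omega>) c > e / 4}) \<longlonglongrightarrow> 0"
    using filterlim_compose filterlim_phase_length[OF r] by blast
  show ?thesis
  proof (rule tendsto_sandwich[OF _ _ tendsto_const lim'])
    have "\<forall>\<^sub>F n in sequentially. 1 / real n < e / 2"
      using lim_1_over_n[where 'a=real] \<open>e > 0\<close> by (intro order_tendstoD(2)[where y=0]) auto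
    then show "\<forall>\<^sub>F n in sequentially. prob {\<omega> \<in> space M. \<bar>gate_count K r (obs G Y n \<omega>) / n - c / K\<bar> > e}
        \<le> prob {\<omega> \<in> space M. dist (gating_freq K G r (phase_length K r n) \<omega>) c > e / 4}"
      using eventually_gt_at_top[of 0]
    proof eventually_elim
      case (elim n)
      define L where "L = phase_length K r n"
      have L: "\<bar>L / n - 1 / K\<bar> \<le> 1 / n" using phase_length_asymp[OF r elim(2)] by (simp add: L_def)
      have "1 / n \<le> 1" "1 / K \<le> 1" using elim r by auto
      then have L2: "L / n \<le> 2" using L by linarith
      have "dist (gating_freq K G r L \<omega>) c > e / 4" if "\<bar>gate_count K r (obs G Y n \<omega>) / n - c / K\<bar> > e" for \<omega>
      proof (rule ccontr)
        assume "\<not> dist (gating_freq K G r L \<omega>) c > e / 4"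
        then have le: "\<bar>gating_freq K G r L \<omega> - c\<bar> \<le> e / 4" by (simp add: dist_real_def)
        have "gate_count K r (obs G Y n \<omega>) = L * gating_freq K G r L \<omega>"
          by (simp add: gate_count_obs[OF r] gating_freq_def L_def)
        then have "gate_count K r (obs G Y n \<omega>) / n - c / K = L / n * (gating_freq K G r L \<omega> - c) + c * (L / n - 1 / K)"
          by (simp add: algebra_simps)
        also have "\<bar>\<dots>\<bar> \<le> \<bar>L / n * (gating_freq K G r L \<omega> - c)\<bar> + \<bar>c * (L / n - 1 / K)\<bar>"
          by (rule abs_triangle_ineq)
        also have "\<dots> \<le> 2 * (e / 4) + 1 * (1 / n)"
          unfolding abs_mult using L L2 le c by (intro add_mono mult_mono) auto
        also have "\<dots> < e" using elim(1) by linarith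
        finally show False using that by simp
      qed
      then show ?case
        unfolding L_def by (intro finite_measure_mono) auto
    qed
  qed auto
qed

theorem theorem3:
  fixes K D :: nat
    and \<Theta> :: "(real^'d) set"
    and p lam :: "nat \<Rightarrow> real^'d \<Rightarrow> real"
    and \<gamma> :: "real^'d \<Rightarrow> nat \<Rightarrow> real"
    and P :: "real^'d \<Rightarrow> 'w measure"
    and G Y :: "nat \<Rightarrow> 'w \<Rightarrow> bool"
    and \<theta>\<^sub>0 :: "real^'d"
    and lmin lmax :: real
    and I\<^sub>0 :: "real^'d^'d"
    and est :: "nat \<Rightarrow> (bool \<times> bool) list \<Rightarrow> real^'d"
  assumes K: "K \<ge> 1"
    and ded: "ded_process K D \<Theta> p \<gamma> P G Y"
    and p_lam: "\<And>t \<theta>. \<theta> \<in> \<Theta> \<Longrightarrow> p t \<theta> = 1 - exp (- lam t \<theta>)"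
    and lam_periodic: "\<And>t \<theta>. \<theta> \<in> \<Theta> \<Longrightarrow> lam t \<theta> = lam (t mod K) \<theta>"
    and interior: "\<theta>\<^sub>0 \<in> interior \<Theta>"
    and lbounds: "0 < lmin" "lmin \<le> lmax"
    and lam_bounds: "\<And>r \<theta>. r < K \<Longrightarrow> \<theta> \<in> \<Theta> \<Longrightarrow> lmin \<le> lam r \<theta> \<and> lam r \<theta> \<le> lmax"
    and smooth: "\<And>r. r < K \<Longrightarrow>
          \<exists>V g. open V \<and> \<Theta> \<subseteq> V \<and> (\<forall>\<theta>\<in>\<Theta>. g \<theta> = lam r \<theta>) \<and> C_k_on 3 g V"
    and identifiable: "\<And>\<theta>. \<theta> \<in> \<Theta> \<Longrightarrow>
          (\<And>r. r < K \<Longrightarrow> \<gamma> \<theta>\<^sub>0 r > 0 \<Longrightarrow> lam r \<theta> = lam r \<theta>\<^sub>0) \<Longrightarrow> \<theta> = \<theta>\<^sub>0"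
    and compact: "compact \<Theta>"
    and I\<^sub>0: "I\<^sub>0 = fisher_info K p lam \<theta>\<^sub>0 (\<gamma> \<theta>\<^sub>0)"
    and I\<^sub>0_pos: "pos_definite I\<^sub>0"
    and mle: "is_mle \<Theta> P G Y est"
  shows "tendsto_in_prob (\<lambda>T. obs_law P G Y \<theta>\<^sub>0 T) est \<theta>\<^sub>0 \<and>
         weak_conv_borel
           (\<lambda>T. distr (obs_law P G Y \<theta>\<^sub>0 T) borel (\<lambda>x. sqrt (real T) *\<^sub>R (est T x - \<theta>\<^sub>0)))
           (mv_normal 0 (matrix_inv I\<^sub>0)) \<and>
         (\<forall>h. weak_conv_borel
           (\<lambda>T. distr (obs_law P G Y (\<theta>\<^sub>0 + (1 / sqrt (real T)) *\<^sub>R h) T) borel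
              (\<lambda>x. sqrt (real T) *\<^sub>R (est T x - \<theta>\<^sub>0 - (1 / sqrt (real T)) *\<^sub>R h)))
           (mv_normal 0 (matrix_inv I\<^sub>0)))"
proof -
  obtain \<kappa> where \<kappa>: "\<And>x. \<kappa> x True + \<kappa> x False = 1" "\<And>x g. \<kappa> x g \<ge> 0"
    and law: "\<And>\<theta> x. \<theta> \<in> \<Theta> \<Longrightarrow> measure (obs_law P G Y \<theta> (length x)) {x} = path_prob \<kappa> (\<lambda>t. p t \<theta>) x"
    and om: "\<And>\<theta> T. \<theta> \<in> \<Theta> \<Longrightarrow> obs G Y T \<in> measurable (P \<theta>) (count_space UNIV)"
    by (rule ded_path_law[OF ded]) blast
  interpret path_kernel \<kappa> by standard (rule \<kappa>)+
  have \<theta>\<^sub>0_in: "\<theta>\<^sub>0 \<in> \<Theta>" using interior interior_subset by blast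
  have ps: "prob_space (P \<theta>)" if "\<theta> \<in> \<Theta>" for \<theta> using ded that by (simp add: ded_process_def)
  define pq where "pq = (\<lambda>r \<theta>. if r < K \<and> \<theta> \<in> \<Theta> then 1 - exp (- lam r \<theta>) else 1 / 2)"
  define Law where "Law = (\<lambda>\<theta> n. path_law \<kappa> (\<lambda>t. pq (t mod K) \<theta>) n)"
  have p_eq: "(\<lambda>t. p t \<theta>) = (\<lambda>t. pq (t mod K) \<theta>)" if "\<theta> \<in> \<Theta>" for \<theta>
  proof
    fix t
    have "t mod K < K" using K by simp
    then show "p t \<theta> = pq (t mod K) \<theta>" using p_lam[OF that, of t] lam_periodic[OF that, of t] that by (simp add: pq_def)
  qed
  have p_in: "p t \<theta> \<in> {0..1}" if "\<theta> \<in> \<Theta>" for t \<theta> using ded that by (simp add: ded_process_def)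
  have obs_law: "obs_law P G Y \<theta> T = measure_pmf (Law \<theta> T)" if "\<theta> \<in> \<Theta>" for \<theta> T
    unfolding Law_def p_eq[OF that, symmetric]
    using law[OF that] p_in[OF that]
    by (intro obs_law_eq_path_law[where P = P and \<theta> = \<theta>] path_kernel_axioms ps om that) auto
  have smooth_lam: "continuous_on \<Theta> (lam r)" "continuous_on (interior \<Theta>) (gradient (lam r))"
    "\<theta> \<in> interior \<Theta> \<Longrightarrow> (lam r has_derivative (\<lambda>v. gradient (lam r) \<theta> \<bullet> v)) (at \<theta>)" if r: "r < K" for r \<theta>
  proof -
    obtain V g where V: "open V" "\<Theta> \<subseteq> V" "\<And>\<theta>. \<theta> \<in> \<Theta> \<Longrightarrow> g \<theta> = lam r \<theta>" and g: "C_k_on 3 g V"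
      using smooth[OF r] by blast
    have g': "C_k_on (Suc (Suc 1)) g V" using g by (simp only: numeral_3_eq_3 One_nat_def)
    have int: "interior \<Theta> \<subseteq> V" "\<And>\<theta>. \<theta> \<in> interior \<Theta> \<Longrightarrow> lam r \<theta> = g \<theta>"
      using V interior_subset[of \<Theta>] by auto
    show "continuous_on (interior \<Theta>) (gradient (lam r))"
      by (rule C_k_on_gradient(2)[OF g' open_interior int])
    show "\<theta> \<in> interior \<Theta> \<Longrightarrow> (lam r has_derivative (\<lambda>v. gradient (lam r) \<theta> \<bullet> v)) (at \<theta>)"
      by (rule C_k_on_gradient(1)[OF g' open_interior int])
    have "continuous_on \<Theta> g"
      using g' V(2) by (auto intro!: differentiable_imp_continuous_on simp: differentiable_on_def subset_iff differentiable_at_withinI)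
    then show "continuous_on \<Theta> (lam r)" by (rule continuous_on_eq) (rule V(3))
  qed
  have \<gamma>: "\<gamma> \<theta>\<^sub>0 r \<in> {0..1}" "tendsto_in_prob (\<lambda>_. P \<theta>\<^sub>0) (gating_freq K G r) (\<gamma> \<theta>\<^sub>0 r)" if "r < K" for r
    using ded that \<theta>\<^sub>0_in by (auto simp: ded_process_def)
  interpret ded_mle \<kappa> K \<Theta> lam "\<lambda>r. gradient (lam r)" "\<lambda>r. \<gamma> \<theta>\<^sub>0 r / K" \<theta>\<^sub>0 est I\<^sub>0 lmin lmax pq Law
  proof
    show "pq = (\<lambda>r \<theta>. if r < K \<and> \<theta> \<in> \<Theta> then 1 - exp (- lam r \<theta>) else 1 / 2)"
      by (rule pq_def)
    show "Law = (\<lambda>\<theta> n. path_law \<kappa> (\<lambda>t. pq (t mod K) \<theta>) n)"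
      by (rule Law_def)
    show "\<gamma> \<theta>\<^sub>0 r / K \<in> {0..1}" if "r < K" for r
    proof -
      have "\<gamma> \<theta>\<^sub>0 r \<le> K" using \<gamma>(1)[OF that] K by (auto intro: order_trans[of _ 1])
      then show ?thesis using \<gamma>(1)[OF that] K by simp
    qed
    show "\<theta> = \<theta>\<^sub>0" if "\<theta> \<in> \<Theta>" "\<And>r. r < K \<Longrightarrow> 0 < \<gamma> \<theta>\<^sub>0 r / K \<Longrightarrow> lam r \<theta> = lam r \<theta>\<^sub>0" for \<theta>
      using that K by (intro identifiable) auto
    show "(\<lambda>n. measure_pmf.prob (Law \<theta>\<^sub>0 n) {x. e < \<bar>gate_count K r x / n - \<gamma> \<theta>\<^sub>0 r / K\<bar>}) \<longlonglongrightarrow> 0"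
      if "r < K" "e > 0" for r e
    proof -
      have "measure_pmf.prob (Law \<theta>\<^sub>0 n) {x. e < \<bar>gate_count K r x / n - \<gamma> \<theta>\<^sub>0 r / K\<bar>}
        = measure (P \<theta>\<^sub>0) {\<omega> \<in> space (P \<theta>\<^sub>0). e < \<bar>gate_count K r (obs G Y n \<omega>) / n - \<gamma> \<theta>\<^sub>0 r / K\<bar>}" for n
        unfolding obs_law[OF \<theta>\<^sub>0_in, symmetric] obs_law_def
        by (subst measure_distr[OF om[OF \<theta>\<^sub>0_in]]) (auto intro!: arg_cong[where f="measure _"])
      then show ?thesis
        using gate_count_frequency[OF that(1) ps[OF \<theta>\<^sub>0_in] _ \<gamma>(2,1)[OF that(1)] that(2), of Y] ded \<theta>\<^sub>0_in
        by (simp add: ded_process_def)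
    qed
    show "est n x \<in> \<Theta> \<and> path_prob \<kappa> (\<lambda>t. pq (t mod K) \<theta>) x \<le> path_prob \<kappa> (\<lambda>t. pq (t mod K) (est n x)) x"
      if x: "x \<in> set_pmf (Law \<theta>\<^sub>0 n)" and \<theta>: "\<theta> \<in> \<Theta>" for n x \<theta>
    proof -
      have len: "length x = n"
        using x p_in[OF \<theta>\<^sub>0_in] by (simp add: Law_def p_eq[OF \<theta>\<^sub>0_in, symmetric] set_path_law)
      then have max: "is_arg_max (log_lik P G Y n x) (\<lambda>\<theta>. \<theta> \<in> \<Theta>) (est n x)"
        using mle unfolding is_mle_def by blast
      then have est: "est n x \<in> \<Theta>" and le: "log_lik P G Y n x \<theta> \<le> log_lik P G Y n x (est n x)"
        using \<theta> by (auto simp: is_arg_max_def not_less)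
      have ll: "log_lik P G Y n x \<theta>' = (let q = path_prob \<kappa> (\<lambda>t. pq (t mod K) \<theta>') x in if q = 0 then -\<infinity> else ereal (ln q))"
        if "\<theta>' \<in> \<Theta>" for \<theta>'
        using law[OF that, of x] len p_eq[OF that] by (simp add: log_lik_def)
      have nonneg: "path_prob \<kappa> (\<lambda>t. pq (t mod K) \<theta>') x \<ge> 0" if "\<theta>' \<in> \<Theta>" for \<theta>'
        unfolding p_eq[OF that, symmetric] by (rule path_prob_nonneg[OF p_in[OF that]])
      \<comment> \<open>The value -\<infinity> at probability zero and the monotonicity of ln turn
        the comparison of log-likelihoods into one of probabilities.\<close>
      show ?thesis
        using le nonneg[OF \<theta>] nonneg[OF est] est unfolding ll[OF \<theta>] ll[OF est]
        by (auto simp: Let_def split: if_splits)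
    qed
    show "I\<^sub>0 *v v = (\<Sum>r<K. (\<gamma> \<theta>\<^sub>0 r / K * ((1 - pq r \<theta>\<^sub>0) / pq r \<theta>\<^sub>0) * (gradient (lam r) \<theta>\<^sub>0 \<bullet> v)) *\<^sub>R gradient (lam r) \<theta>\<^sub>0)" for v
    proof -
      have outer: "outer_product w w *v v = (w \<bullet> v) *\<^sub>R w" for w :: "real^'d"
        by (simp add: vec_eq_iff outer_product_def matrix_vector_mult_def inner_vec_def sum_distrib_left mult_ac)
      have pr: "p r \<theta>\<^sub>0 = pq r \<theta>\<^sub>0" if "r < K" for r
        using fun_cong[OF p_eq[OF \<theta>\<^sub>0_in], of r] that by simp
      have lin: "(\<Sum>r<K. A r) *v v = (\<Sum>r<K. A r *v v)" for A :: "nat \<Rightarrow> real^'d^'d"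
        by (induction K) (simp_all add: matrix_vector_mult_add_rdistrib)
      show ?thesis
        unfolding I\<^sub>0 fisher_info_def fisher_phase_def
        by (simp add: scaleR_matrix_vector_assoc[symmetric] lin outer scaleR_sum_right pr mult_ac)
    qed
  qed (use K interior compact lbounds lam_bounds smooth_lam I\<^sub>0_pos in auto)
  have "tendsto_in_prob (\<lambda>T. obs_law P G Y \<theta>\<^sub>0 T) est \<theta>\<^sub>0"
    unfolding tendsto_in_prob_def using est_consistent by (simp add: obs_law[OF \<theta>\<^sub>0_in])
  moreover have regular: "weak_conv_borel
           (\<lambda>T. distr (obs_law P G Y (\<theta>\<^sub>0 + (1 / sqrt (real T)) *\<^sub>R h) T) borel
              (\<lambda>x. sqrt (real T) *\<^sub>R (est T x - \<theta>\<^sub>0 - (1 / sqrt (real T)) *\<^sub>R h)))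
           (mv_normal 0 (matrix_inv I\<^sub>0))" for h
  proof (rule error_weak_conv)
    \<comment> \<open>The law of the observations is identified only for parameters in \<Theta>,
      which contains a ball around \<open>\<theta>\<^sub>0\<close> and so, eventually, the local
      parameters.\<close>
    obtain \<rho> where \<rho>: "\<rho> > 0" "ball \<theta>\<^sub>0 \<rho> \<subseteq> \<Theta>"
      using interior by (auto simp: mem_interior)
    have "\<forall>\<^sub>F n in sequentially. local_param h n \<in> \<Theta>"
      using eventually_local_param_ball[OF \<rho>(1), of h] by (rule eventually_mono) (use \<rho>(2) in blast)
    then show "\<forall>\<^sub>F T in sequentially. distr (obs_law P G Y (\<theta>\<^sub>0 + (1 / sqrt (real T)) *\<^sub>R h) T) borel
              (\<lambda>x. sqrt (real T) *\<^sub>R (est T x - \<theta>\<^sub>0 - (1 / sqrt (real T)) *\<^sub>R h))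
          = distr (measure_pmf (Law (local_param h T) T)) borel (error h T)"
    proof eventually_elim
      case (elim T)
      show ?case
        using obs_law[OF elim, of T] by (simp add: local_param_def error_def[abs_def] diff_diff_eq)
    qed
  qed
  moreover have "weak_conv_borel
           (\<lambda>T. distr (obs_law P G Y \<theta>\<^sub>0 T) borel (\<lambda>x. sqrt (real T) *\<^sub>R (est T x - \<theta>\<^sub>0)))
           (mv_normal 0 (matrix_inv I\<^sub>0))"
    using regular[of 0] by simp
  ultimately show ?thesis by blast
qed

end
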